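(* Suppose that $E$ is a directed graph. Then $C^*(E)$ is a strongly $\mathbb{Z}$-graded $C^*$-algebra if and only if the Leavitt path algebra $L_{\mathbb{C}}(E)$ is a strongly $\mathbb{Z}$-graded ring.
   Context: A directed graph $E=(E^0,E^1,r,s)$ consists of sets $E^0$ (vertices), $E^1$ (edges) and maps $r,s:E^1\to E^0$ (range and source). Raeburn's path convention is used: a finite path of length $n\geq 1$ is a word $\alpha=\alpha_1\alpha_2\cdots\alpha_n$ of edges with $s(\alpha_i)=r(\alpha_{i+1})$ for $1\le i<n$; $|\alpha|=n$, $r(\alpha)=r(\alpha_1)$, $s(\alpha)=s(\alpha_n)$. Vertices are paths of length $0$ with $r(v)=s(v)=v$. $E^*$ is the set of all finite paths. $C^*(E)$ is the universal $C^*$-algebra generated by a Cuntz–Krieger $E$-family: mutually orthogonal projections $\{p_v:v\in E^0\}$ and partial isometries $\{s_e:e\in E^1\}$ with mutually orthogonal ranges such that $s_e^*s_e=p_{s(e)}$ and $s_es_e^*\le p_{r(e)}$ for all $e\in E^1$, and $p_v=\sum_{r(e)=v}s_es_e^*$ whenever $0<|r^{-1}(v)|<\infty$. The gauge action $\gamma:\mathbb{T}\to\operatorname{Aut}C^*(E)$ is determined by $\gamma_z(s_e)=zs_e$ and $\gamma_z(p_v)=p_v$; $C^*(E)$ is $\mathbb{Z}$-graded by $C^*(E)_n:=\{a\in C^*(E):\gamma_z(a)=z^na\text{ for all }z\in\mathbb{T}\}$. The Leavitt path algebra $L_{\mathbb{C}}(E)$ is the universal $\mathbb{C}$-algebra generated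 by $\{v:v\in E^0\}\cup\{e,e^*:e\in E^1\}$ subject to $vw=\delta_{v,w}v$; $r(e)e=e=e\,s(e)$; $s(e)e^*=e^*=e^*r(e)$; $e^*f=\delta_{e,f}s(e)$; and $v=\sum_{r(e)=v}ee^*$ whenever $0<|r^{-1}(v)|<\infty$. With $\alpha^*:=\alpha_n^*\cdots\alpha_1^*$ for $\alpha=\alpha_1\cdots\alpha_n$ and $v^*:=v$, it is spanned by the elements $\alpha\beta^*$ with $\alpha,\beta\in E^*$, $s(\alpha)=s(\beta)$, and is $\mathbb{Z}$-graded by $L_{\mathbb{C}}(E)_n:=\operatorname{span}\{\alpha\beta^*:s(\alpha)=s(\beta),|\alpha|-|\beta|=n\}$. For a group $\Gamma$, a ring $R$ is $\Gamma$-graded if there are additive subgroups $\{R_\gamma\}_{\gamma\in\Gamma}$ with $R_\alpha R_\beta\subseteq R_{\alpha\beta}$ (where $R_\alpha R_\beta$ is the set of finite sums of products) and $\bigoplus_\gamma R_\gamma=R$; it is strongly $\Gamma$-graded if $R_\alpha R_\beta=R_{\alpha\beta}$ for all $\alpha,\beta\in\Gamma$. A $C^*$-algebra $A$ is $\Gamma$-graded if there are linearly independent closed subspaces $\{A_\gamma\}_{\gamma\in\Gamma}$ such that for all $\alpha,\beta$: $A_\alpha\cdot A_\beta:=\operatorname{span}\{ab:a\in A_\alpha,b\in A_\beta\}\subseteq A_{\alpha\beta}$, $A_\alpha^*\subseteq A_{\alpha^{-1}}$, and $\bigoplus_\gamma A_\gamma$ is dense in $A$; it is strongly $\Gamma$-graded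 if in addition $A_\alpha\cdot A_\beta$ is dense in $A_{\alpha\beta}$ for all $\alpha,\beta\in\Gamma$. *)

theory Defs
  imports
    "HOL-Analysis.Analysis"
    "HOL-Algebra.Module"
    "HOL-Algebra.AbelCoset"
    "HOL-Library.Poly_Mapping"
    "Graph_Theory.Digraph"
begin

section \<open>Graded rings and graded C*-algebras\<close>

text \<open>
  Rings need not be unital: the field \<open>one\<close> of the HOL-Algebra records carries no
  meaning below and is never referred to.
\<close>

locale nonunital_ring = abelian_group R for R (structure) +
  assumes mult_closed: "\<lbrakk>x \<in> carrier R; y \<in> carrier R\<rbrakk> \<Longrightarrow> x \<otimes> y \<in> carrier R"
    and mult_assoc: "\<lbrakk>x \<in> carrier R; y \<in> carrier R; z \<in> carrier R\<rbrakk> \<Longrightarrow>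
      (x \<otimes> y) \<otimes> z = x \<otimes> (y \<otimes> z)"
    and distr_right: "\<lbrakk>x \<in> carrier R; y \<in> carrier R; z \<in> carrier R\<rbrakk> \<Longrightarrow>
      (x \<oplus> y) \<otimes> z = x \<otimes> z \<oplus> y \<otimes> z"
    and distr_left: "\<lbrakk>x \<in> carrier R; y \<in> carrier R; z \<in> carrier R\<rbrakk> \<Longrightarrow>
      z \<otimes> (x \<oplus> y) = z \<otimes> x \<oplus> z \<otimes> y"

definition sums_of_products :: "('a, 'm) ring_scheme \<Rightarrow> 'a set \<Rightarrow> 'a set \<Rightarrow> 'a set" where
  "sums_of_products R X Y =
     {(\<Oplus>\<^bsub>R\<^esub>i\<in>{..<n}. x i \<otimes>\<^bsub>R\<^esub> y i) | (n::nat) x y. \<forall>i<n. x i \<in> X \<and> y i \<in> Y}"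

definition graded_ring :: "('a, 'm) ring_scheme \<Rightarrow> ('g::group_add \<Rightarrow> 'a set) \<Rightarrow> bool" where
  "graded_ring R G \<longleftrightarrow>
     nonunital_ring R \<and>
     (\<forall>\<gamma>. additive_subgroup (G \<gamma>) R) \<and>
     (\<forall>\<alpha> \<beta>. sums_of_products R (G \<alpha>) (G \<beta>) \<subseteq> G (\<alpha> + \<beta>)) \<and>
     (\<forall>x\<in>carrier R. \<exists>!f. (\<forall>\<gamma>. f \<gamma> \<in> G \<gamma>) \<and> finite {\<gamma>. f \<gamma> \<noteq> \<zero>\<^bsub>R\<^esub>} \<and>
        x = (\<Oplus>\<^bsub>R\<^esub>\<gamma>\<in>{\<gamma>. f \<gamma> \<noteq> \<zero>\<^bsub>R\<^esub>}. f \<gamma>))"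

definition strongly_graded_ring :: "('a, 'm) ring_scheme \<Rightarrow> ('g::group_add \<Rightarrow> 'a set) \<Rightarrow> bool" where
  "strongly_graded_ring R G \<longleftrightarrow>
     graded_ring R G \<and> (\<forall>\<alpha> \<beta>. sums_of_products R (G \<alpha>) (G \<beta>) = G (\<alpha> + \<beta>))"

locale complex_algebra = nonunital_ring A
  for A :: "(complex, 'a, 'm) module_scheme" (structure) +
  assumes smult_closed: "x \<in> carrier A \<Longrightarrow> c \<odot> x \<in> carrier A"
    and smult_distr_left: "x \<in> carrier A \<Longrightarrow> (c + d) \<odot> x = c \<odot> x \<oplus> d \<odot> x"
    and smult_distr_right: "\<lbrakk>x \<in> carrier A; y \<in> carrier A\<rbrakk> \<Longrightarrow> c \<odot> (x \<oplus> y) = c \<odot> x \<oplus> c \<odot> y"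
    and smult_smult: "x \<in> carrier A \<Longrightarrow> c \<odot> (d \<odot> x) = (c * d) \<odot> x"
    and smult_one: "x \<in> carrier A \<Longrightarrow> 1 \<odot> x = x"
    and smult_mult_left: "\<lbrakk>x \<in> carrier A; y \<in> carrier A\<rbrakk> \<Longrightarrow> (c \<odot> x) \<otimes> y = c \<odot> (x \<otimes> y)"
    and smult_mult_right: "\<lbrakk>x \<in> carrier A; y \<in> carrier A\<rbrakk> \<Longrightarrow> x \<otimes> (c \<odot> y) = c \<odot> (x \<otimes> y)"

definition cspan :: "(complex, 'a, 'm) module_scheme \<Rightarrow> 'a set \<Rightarrow> 'a set" where
  "cspan A X = {(\<Oplus>\<^bsub>A\<^esub>i\<in>{..<n}. c i \<odot>\<^bsub>A\<^esub> x i) | (n::nat) c x. \<forall>i<n. x i \<in> X}"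

record 'a normed_star_algebra = "(complex, 'a) module" +
  adj :: "'a \<Rightarrow> 'a"
  nrm :: "'a \<Rightarrow> real"

text \<open>
  The locale \<open>Metric_space\<close> demands nonnegativity and symmetry on the whole type, hence the
  value outside the carrier.
\<close>
definition norm_dist :: "'a normed_star_algebra \<Rightarrow> 'a \<Rightarrow> 'a \<Rightarrow> real" where
  "norm_dist A x y = (if x \<in> carrier A \<and> y \<in> carrier A then nrm A (x \<ominus>\<^bsub>A\<^esub> y) else 0)"

abbreviation norm_topology :: "'a normed_star_algebra \<Rightarrow> 'a topology" where
  "norm_topology A \<equiv> Metric_space.mtopology (carrier A) (norm_dist A)"

locale cstar_algebra = complex_algebra A
  for A :: "'a normed_star_algebra" (structure) +
  assumes adj_closed: "x \<in> carrier A \<Longrightarrow> adj A x \<in> carrier A"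
    and adj_adj: "x \<in> carrier A \<Longrightarrow> adj A (adj A x) = x"
    and adj_add: "\<lbrakk>x \<in> carrier A; y \<in> carrier A\<rbrakk> \<Longrightarrow> adj A (x \<oplus> y) = adj A x \<oplus> adj A y"
    and adj_smult: "x \<in> carrier A \<Longrightarrow> adj A (c \<odot> x) = cnj c \<odot> adj A x"
    and adj_mult: "\<lbrakk>x \<in> carrier A; y \<in> carrier A\<rbrakk> \<Longrightarrow> adj A (x \<otimes> y) = adj A y \<otimes> adj A x"
    and nrm_nonneg: "x \<in> carrier A \<Longrightarrow> 0 \<le> nrm A x"
    and nrm_eq_0_iff: "x \<in> carrier A \<Longrightarrow> nrm A x = 0 \<longleftrightarrow> x = \<zero>"
    and nrm_triangle: "\<lbrakk>x \<in> carrier A; y \<in> carrier A\<rbrakk> \<Longrightarrow> nrm A (x \<oplus> y) \<le> nrm A x + nrm A y"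
    and nrm_smult: "x \<in> carrier A \<Longrightarrow> nrm A (c \<odot> x) = cmod c * nrm A x"
    and nrm_mult: "\<lbrakk>x \<in> carrier A; y \<in> carrier A\<rbrakk> \<Longrightarrow> nrm A (x \<otimes> y) \<le> nrm A x * nrm A y"
    and nrm_cstar: "x \<in> carrier A \<Longrightarrow> nrm A (adj A x \<otimes> x) = (nrm A x)\<^sup>2"
    and complete: "Metric_space.mcomplete (carrier A) (norm_dist A)"

definition complex_subspace :: "'a set \<Rightarrow> (complex, 'a, 'm) module_scheme \<Rightarrow> bool" where
  "complex_subspace V A \<longleftrightarrow> additive_subgroup V A \<and> (\<forall>c. \<forall>x\<in>V. c \<odot>\<^bsub>A\<^esub> x \<in> V)"

definition span_product :: "(complex, 'a, 'm) module_scheme \<Rightarrow> 'a set \<Rightarrow> 'a set \<Rightarrow> 'a set" where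
  "span_product A X Y = cspan A {x \<otimes>\<^bsub>A\<^esub> y | x y. x \<in> X \<and> y \<in> Y}"

definition graded_cstar_algebra ::
    "'a normed_star_algebra \<Rightarrow> ('g::group_add \<Rightarrow> 'a set) \<Rightarrow> bool" where
  "graded_cstar_algebra A G \<longleftrightarrow>
     cstar_algebra A \<and>
     (\<forall>\<gamma>. complex_subspace (G \<gamma>) A \<and> closedin (norm_topology A) (G \<gamma>)) \<and>
     (\<forall>I f. finite I \<and> (\<forall>\<gamma>\<in>I. f \<gamma> \<in> G \<gamma>) \<and> (\<Oplus>\<^bsub>A\<^esub>\<gamma>\<in>I. f \<gamma>) = \<zero>\<^bsub>A\<^esub> \<longrightarrow>
        (\<forall>\<gamma>\<in>I. f \<gamma> = \<zero>\<^bsub>A\<^esub>)) \<and>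
     (\<forall>\<alpha> \<beta>. span_product A (G \<alpha>) (G \<beta>) \<subseteq> G (\<alpha> + \<beta>)) \<and>
     (\<forall>\<alpha>. adj A ` G \<alpha> \<subseteq> G (- \<alpha>)) \<and>
     norm_topology A closure_of {(\<Oplus>\<^bsub>A\<^esub>\<gamma>\<in>I. f \<gamma>) | I f. finite I \<and> (\<forall>\<gamma>\<in>I. f \<gamma> \<in> G \<gamma>)}
       = carrier A"

definition strongly_graded_cstar_algebra ::
    "'a normed_star_algebra \<Rightarrow> ('g::group_add \<Rightarrow> 'a set) \<Rightarrow> bool" where
  "strongly_graded_cstar_algebra A G \<longleftrightarrow>
     graded_cstar_algebra A G \<and>
     (\<forall>\<alpha> \<beta>. G (\<alpha> + \<beta>) \<subseteq> norm_topology A closure_of span_product A (G \<alpha>) (G \<beta>))"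

text \<open>
  Every *-homomorphism between C*-algebras is norm-decreasing; the last clause is therefore no
  restriction.
\<close>
definition star_hom :: "'a normed_star_algebra \<Rightarrow> 'b normed_star_algebra \<Rightarrow> ('a \<Rightarrow> 'b) set" where
  "star_hom A B = {\<phi> \<in> carrier A \<rightarrow>\<^sub>E carrier B.
     (\<forall>x\<in>carrier A. \<forall>y\<in>carrier A. \<phi> (x \<oplus>\<^bsub>A\<^esub> y) = \<phi> x \<oplus>\<^bsub>B\<^esub> \<phi> y \<and> \<phi> (x \<otimes>\<^bsub>A\<^esub> y) = \<phi> x \<otimes>\<^bsub>B\<^esub> \<phi> y) \<and>
     (\<forall>x\<in>carrier A. \<phi> (adj A x) = adj B (\<phi> x) \<and> (\<forall>c. \<phi> (c \<odot>\<^bsub>A\<^esub> x) = c \<odot>\<^bsub>B\<^esub> \<phi> x)) \<and>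
     (\<forall>x\<in>carrier A. nrm B (\<phi> x) \<le> nrm A x)}"

definition star_aut :: "'a normed_star_algebra \<Rightarrow> ('a \<Rightarrow> 'a) set" where
  "star_aut A = {\<phi> \<in> star_hom A A. bij_betw \<phi> (carrier A) (carrier A)}"


section \<open>Directed graphs and the free algebra on their vertices, edges and ghost edges\<close>

text \<open>
  Source and range of an edge are its \<open>tail\<close> and its \<open>head\<close>.
\<close>

definition edges_into :: "('v, 'e) pre_digraph \<Rightarrow> 'v \<Rightarrow> 'e set" where
  "edges_into E v = {e \<in> arcs E. head E e = v}"

definition regular_vertex :: "('v, 'e) pre_digraph \<Rightarrow> 'v \<Rightarrow> bool" where
  "regular_vertex E v \<longleftrightarrow> v \<in> verts E \<and> finite (edges_into E v) \<and> edges_into E v \<noteq> {}"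

datatype ('v, 'e) gen = Vtx 'v | Edge 'e | Ghost 'e

fun gen_star :: "('v, 'e) gen \<Rightarrow> ('v, 'e) gen" where
  "gen_star (Vtx v) = Vtx v"
| "gen_star (Edge e) = Ghost e"
| "gen_star (Ghost e) = Edge e"

definition generators :: "('v, 'e) pre_digraph \<Rightarrow> ('v, 'e) gen set" where
  "generators E = Vtx ` verts E \<union> Edge ` arcs E \<union> Ghost ` arcs E"

text \<open>
  With concatenation as addition of words, the convolution product of finitely supported
  functions on words is the product of noncommutative polynomials.
\<close>
instantiation list :: (type) monoid_add
begin
definition zero_list :: "'a list" where "zero_list = []"
definition plus_list :: "'a list \<Rightarrow> 'a list \<Rightarrow> 'a list" where "plus_list = (@)"
instance by standard (simp_all add: zero_list_def plus_list_def)
end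

type_synonym ('v, 'e) ncpoly = "('v, 'e) gen list \<Rightarrow>\<^sub>0 complex"

abbreviation monomial :: "('v, 'e) gen list \<Rightarrow> ('v, 'e) ncpoly" where
  "monomial w \<equiv> Poly_Mapping.single w 1"

abbreviation vtx :: "'v \<Rightarrow> ('v, 'e) ncpoly" where "vtx v \<equiv> monomial [Vtx v]"
abbreviation edge :: "'e \<Rightarrow> ('v, 'e) ncpoly" where "edge e \<equiv> monomial [Edge e]"
abbreviation ghost :: "'e \<Rightarrow> ('v, 'e) ncpoly" where "ghost e \<equiv> monomial [Ghost e]"

definition pscale :: "complex \<Rightarrow> ('v, 'e) ncpoly \<Rightarrow> ('v, 'e) ncpoly" where
  "pscale c x = Poly_Mapping.map ((*) c) x"

definition pstar :: "('v, 'e) ncpoly \<Rightarrow> ('v, 'e) ncpoly" where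
  "pstar x = Poly_Mapping.map_key (\<lambda>w. rev (map gen_star w)) (Poly_Mapping.map cnj x)"

text \<open>Only nonempty words occur: the free algebra is the nonunital one.\<close>
definition free_algebra :: "('v, 'e) pre_digraph \<Rightarrow> ('v, 'e) ncpoly set" where
  "free_algebra E = {x. Poly_Mapping.keys x \<subseteq> lists (generators E) - {[]}}"


section \<open>The Leavitt path algebra\<close>

definition leavitt_relations :: "('v, 'e) pre_digraph \<Rightarrow> ('v, 'e) ncpoly set" where
  "leavitt_relations E =
     {vtx v * vtx w - (if v = w then vtx v else 0) | v w. v \<in> verts E \<and> w \<in> verts E} \<union>
     {vtx (head E e) * edge e - edge e | e. e \<in> arcs E} \<union>
     {edge e * vtx (tail E e) - edge e | e. e \<in> arcs E} \<union>
     {vtx (tail E e) * ghost e - ghost e | e. e \<in> arcs E} \<union>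
     {ghost e * vtx (head E e) - ghost e | e. e \<in> arcs E} \<union>
     {ghost e * edge f - (if e = f then vtx (tail E e) else 0) | e f. e \<in> arcs E \<and> f \<in> arcs E} \<union>
     {vtx v - (\<Sum>e\<in>edges_into E v. edge e * ghost e) | v. regular_vertex E v}"

inductive_set leavitt_ideal :: "('v, 'e) pre_digraph \<Rightarrow> ('v, 'e) ncpoly set"
  for E :: "('v, 'e) pre_digraph" where
  zero: "0 \<in> leavitt_ideal E"
| relation: "x \<in> leavitt_relations E \<Longrightarrow> x \<in> leavitt_ideal E"
| add: "\<lbrakk>x \<in> leavitt_ideal E; y \<in> leavitt_ideal E\<rbrakk> \<Longrightarrow> x + y \<in> leavitt_ideal E"
| scale: "x \<in> leavitt_ideal E \<Longrightarrow> pscale c x \<in> leavitt_ideal E"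
| mult_left: "\<lbrakk>x \<in> leavitt_ideal E; y \<in> free_algebra E\<rbrakk> \<Longrightarrow> y * x \<in> leavitt_ideal E"
| mult_right: "\<lbrakk>x \<in> leavitt_ideal E; y \<in> free_algebra E\<rbrakk> \<Longrightarrow> x * y \<in> leavitt_ideal E"

definition leavitt_rel :: "('v, 'e) pre_digraph \<Rightarrow> (('v, 'e) ncpoly \<times> ('v, 'e) ncpoly) set" where
  "leavitt_rel E = {(x, y). x \<in> free_algebra E \<and> y \<in> free_algebra E \<and> x - y \<in> leavitt_ideal E}"

definition leavitt_class :: "('v, 'e) pre_digraph \<Rightarrow> ('v, 'e) ncpoly \<Rightarrow> ('v, 'e) ncpoly set" where
  "leavitt_class E x = leavitt_rel E `` {x}"

definition leavitt_path_algebra ::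
    "('v, 'e) pre_digraph \<Rightarrow> (complex, ('v, 'e) ncpoly set) module" where
  "leavitt_path_algebra E =
     \<lparr>carrier = free_algebra E // leavitt_rel E,
      mult = (\<lambda>a b. \<Union>x\<in>a. \<Union>y\<in>b. leavitt_class E (x * y)),
      one = undefined,
      zero = leavitt_class E 0,
      add = (\<lambda>a b. \<Union>x\<in>a. \<Union>y\<in>b. leavitt_class E (x + y)),
      smult = (\<lambda>c a. \<Union>x\<in>a. leavitt_class E (pscale c x))\<rparr>"

text \<open>Paths in Raeburn's convention: \<open>s(\<alpha>\<^sub>i) = r(\<alpha>\<^sub>i\<^sub>+\<^sub>1)\<close>.\<close>

datatype ('v, 'e) path = Trivial 'v | Edges "'e list"

fun is_path :: "('v, 'e) pre_digraph \<Rightarrow> ('v, 'e) path \<Rightarrow> bool" where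
  "is_path E (Trivial v) \<longleftrightarrow> v \<in> verts E"
| "is_path E (Edges es) \<longleftrightarrow> es \<noteq> [] \<and> set es \<subseteq> arcs E \<and>
     (\<forall>i. Suc i < length es \<longrightarrow> tail E (es ! i) = head E (es ! Suc i))"

fun path_length :: "('v, 'e) path \<Rightarrow> nat" where
  "path_length (Trivial v) = 0"
| "path_length (Edges es) = length es"

fun path_source :: "('v, 'e) pre_digraph \<Rightarrow> ('v, 'e) path \<Rightarrow> 'v" where
  "path_source E (Trivial v) = v"
| "path_source E (Edges es) = tail E (last es)"

fun path_word :: "('v, 'e) path \<Rightarrow> ('v, 'e) gen list" where
  "path_word (Trivial v) = [Vtx v]"
| "path_word (Edges es) = map Edge es"

fun ghost_word :: "('v, 'e) path \<Rightarrow> ('v, 'e) gen list" where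
  "ghost_word (Trivial v) = [Vtx v]"
| "ghost_word (Edges es) = map Ghost (rev es)"

definition leavitt_component :: "('v, 'e) pre_digraph \<Rightarrow> int \<Rightarrow> ('v, 'e) ncpoly set set" where
  "leavitt_component E n = cspan (leavitt_path_algebra E)
     {leavitt_class E (monomial (path_word \<alpha>)) \<otimes>\<^bsub>leavitt_path_algebra E\<^esub>
        leavitt_class E (monomial (ghost_word \<beta>)) | \<alpha> \<beta>.
      is_path E \<alpha> \<and> is_path E \<beta> \<and> path_source E \<alpha> = path_source E \<beta> \<and>
      int (path_length \<alpha>) - int (path_length \<beta>) = n}"


section \<open>The graph C*-algebra\<close>

definition is_projection :: "'a normed_star_algebra \<Rightarrow> 'a \<Rightarrow> bool" where
  "is_projection A p \<longleftrightarrow> p \<in> carrier A \<and> p \<otimes>\<^bsub>A\<^esub> p = p \<and> adj A p = p"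

definition is_partial_isometry :: "'a normed_star_algebra \<Rightarrow> 'a \<Rightarrow> bool" where
  "is_partial_isometry A s \<longleftrightarrow> s \<in> carrier A \<and> s \<otimes>\<^bsub>A\<^esub> adj A s \<otimes>\<^bsub>A\<^esub> s = s"

text \<open>For projections \<open>p \<le> q\<close> means \<open>q p = p\<close>.\<close>
definition cuntz_krieger_family ::
    "('v, 'e) pre_digraph \<Rightarrow> 'a normed_star_algebra \<Rightarrow> ('v \<Rightarrow> 'a) \<Rightarrow> ('e \<Rightarrow> 'a) \<Rightarrow> bool" where
  "cuntz_krieger_family E A p s \<longleftrightarrow>
     (\<forall>v\<in>verts E. is_projection A (p v)) \<and>
     (\<forall>v\<in>verts E. \<forall>w\<in>verts E. v \<noteq> w \<longrightarrow> p v \<otimes>\<^bsub>A\<^esub> p w = \<zero>\<^bsub>A\<^esub>) \<and>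
     (\<forall>e\<in>arcs E. is_partial_isometry A (s e)) \<and>
     (\<forall>e\<in>arcs E. \<forall>f\<in>arcs E. e \<noteq> f \<longrightarrow>
        (s e \<otimes>\<^bsub>A\<^esub> adj A (s e)) \<otimes>\<^bsub>A\<^esub> (s f \<otimes>\<^bsub>A\<^esub> adj A (s f)) = \<zero>\<^bsub>A\<^esub>) \<and>
     (\<forall>e\<in>arcs E. adj A (s e) \<otimes>\<^bsub>A\<^esub> s e = p (tail E e)) \<and>
     (\<forall>e\<in>arcs E. p (head E e) \<otimes>\<^bsub>A\<^esub> (s e \<otimes>\<^bsub>A\<^esub> adj A (s e)) = s e \<otimes>\<^bsub>A\<^esub> adj A (s e)) \<and>
     (\<forall>v. regular_vertex E v \<longrightarrow> p v = (\<Oplus>\<^bsub>A\<^esub>e\<in>edges_into E v. s e \<otimes>\<^bsub>A\<^esub> adj A (s e)))"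

text \<open>
  \<open>C*(E)\<close> is built in the standard way, as the Hausdorff completion of the free *-algebra in the
  largest C*-seminorm which annihilates the Cuntz-Krieger relations. That this is a C*-algebra
  with the universal property for Cuntz-Krieger families in arbitrary C*-algebras is
  \<open>cstar_algebra_graph_cstar\<close>, \<open>graph_cstar_cuntz_krieger\<close> and \<open>graph_cstar_universal\<close> below.
\<close>

definition ck_relations :: "('v, 'e) pre_digraph \<Rightarrow> ('v, 'e) ncpoly set" where
  "ck_relations E =
     {vtx v * vtx w - (if v = w then vtx v else 0) | v w. v \<in> verts E \<and> w \<in> verts E} \<union>
     {edge e * ghost e * edge e - edge e | e. e \<in> arcs E} \<union>
     {(edge e * ghost e) * (edge f * ghost f) | e f. e \<in> arcs E \<and> f \<in> arcs E \<and> e \<noteq> f} \<union>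
     {ghost e * edge e - vtx (tail E e) | e. e \<in> arcs E} \<union>
     {vtx (head E e) * (edge e * ghost e) - edge e * ghost e | e. e \<in> arcs E} \<union>
     {vtx v - (\<Sum>e\<in>edges_into E v. edge e * ghost e) | v. regular_vertex E v}"

definition ck_seminorm :: "('v, 'e) pre_digraph \<Rightarrow> (('v, 'e) ncpoly \<Rightarrow> real) \<Rightarrow> bool" where
  "ck_seminorm E q \<longleftrightarrow>
     (\<forall>x\<in>free_algebra E. 0 \<le> q x) \<and>
     (\<forall>x\<in>free_algebra E. \<forall>y\<in>free_algebra E. q (x + y) \<le> q x + q y) \<and>
     (\<forall>x\<in>free_algebra E. \<forall>c. q (pscale c x) = cmod c * q x) \<and>
     (\<forall>x\<in>free_algebra E. \<forall>y\<in>free_algebra E. q (x * y) \<le> q x * q y) \<and>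
     (\<forall>x\<in>free_algebra E. q (pstar x * x) = (q x)\<^sup>2) \<and>
     (\<forall>x\<in>ck_relations E. q x = 0)"

definition universal_seminorm :: "('v, 'e) pre_digraph \<Rightarrow> ('v, 'e) ncpoly \<Rightarrow> real" where
  "universal_seminorm E x = (SUP q\<in>{q. ck_seminorm E q}. q x)"

definition cauchy_seqs :: "('v, 'e) pre_digraph \<Rightarrow> (nat \<Rightarrow> ('v, 'e) ncpoly) set" where
  "cauchy_seqs E = {X. (\<forall>n. X n \<in> free_algebra E) \<and>
     (\<forall>\<epsilon>>0. \<exists>N. \<forall>m\<ge>N. \<forall>n\<ge>N. universal_seminorm E (X m - X n) < \<epsilon>)}"

definition cauchy_rel ::
    "('v, 'e) pre_digraph \<Rightarrow> ((nat \<Rightarrow> ('v, 'e) ncpoly) \<times> (nat \<Rightarrow> ('v, 'e) ncpoly)) set" where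
  "cauchy_rel E = {(X, Y). X \<in> cauchy_seqs E \<and> Y \<in> cauchy_seqs E \<and>
     (\<lambda>n. universal_seminorm E (X n - Y n)) \<longlonglongrightarrow> 0}"

definition cauchy_class ::
    "('v, 'e) pre_digraph \<Rightarrow> (nat \<Rightarrow> ('v, 'e) ncpoly) \<Rightarrow> (nat \<Rightarrow> ('v, 'e) ncpoly) set" where
  "cauchy_class E X = cauchy_rel E `` {X}"

definition graph_cstar ::
    "('v, 'e) pre_digraph \<Rightarrow> (nat \<Rightarrow> ('v, 'e) ncpoly) set normed_star_algebra" where
  "graph_cstar E =
     \<lparr>carrier = cauchy_seqs E // cauchy_rel E,
      mult = (\<lambda>a b. \<Union>X\<in>a. \<Union>Y\<in>b. cauchy_class E (\<lambda>n. X n * Y n)),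
      one = undefined,
      zero = cauchy_class E (\<lambda>n. 0),
      add = (\<lambda>a b. \<Union>X\<in>a. \<Union>Y\<in>b. cauchy_class E (\<lambda>n. X n + Y n)),
      smult = (\<lambda>c a. \<Union>X\<in>a. cauchy_class E (\<lambda>n. pscale c (X n))),
      adj = (\<lambda>a. \<Union>X\<in>a. cauchy_class E (\<lambda>n. pstar (X n))),
      nrm = (\<lambda>a. THE l. \<exists>X\<in>a. (\<lambda>n. universal_seminorm E (X n)) \<longlonglongrightarrow> l)\<rparr>"

definition cstar_vertex :: "('v, 'e) pre_digraph \<Rightarrow> 'v \<Rightarrow> (nat \<Rightarrow> ('v, 'e) ncpoly) set" where
  "cstar_vertex E v = cauchy_class E (\<lambda>n. vtx v)"

definition cstar_edge :: "('v, 'e) pre_digraph \<Rightarrow> 'e \<Rightarrow> (nat \<Rightarrow> ('v, 'e) ncpoly) set" where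
  "cstar_edge E e = cauchy_class E (\<lambda>n. edge e)"

text \<open>Existence and uniqueness for \<open>|z| = 1\<close>: \<open>gauge_action_exists\<close> below.\<close>
definition gauge_action :: "('v, 'e) pre_digraph \<Rightarrow> complex \<Rightarrow>
    (nat \<Rightarrow> ('v, 'e) ncpoly) set \<Rightarrow> (nat \<Rightarrow> ('v, 'e) ncpoly) set" where
  "gauge_action E z = (THE \<phi>. \<phi> \<in> star_aut (graph_cstar E) \<and>
     (\<forall>e\<in>arcs E. \<phi> (cstar_edge E e) = z \<odot>\<^bsub>graph_cstar E\<^esub> cstar_edge E e) \<and>
     (\<forall>v\<in>verts E. \<phi> (cstar_vertex E v) = cstar_vertex E v))"

definition gauge_component ::
    "('v, 'e) pre_digraph \<Rightarrow> int \<Rightarrow> (nat \<Rightarrow> ('v, 'e) ncpoly) set set" where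
  "gauge_component E n = {a \<in> carrier (graph_cstar E).
     \<forall>z. cmod z = 1 \<longrightarrow> gauge_action E z a = (z powi n) \<odot>\<^bsub>graph_cstar E\<^esub> a}"


section \<open>The constructions have the defining properties\<close>


lemma lookup_pscale: "Poly_Mapping.lookup (pscale c x) w = c * Poly_Mapping.lookup x w"
  unfolding pscale_def by transfer (simp add: when_def)

lemma inj_word_star: "inj (\<lambda>w. rev (map gen_star w))"
proof -
  have "gen_star (gen_star g) = g" for g :: "('v, 'e) gen" by (cases g) auto
  then have "map gen_star (map gen_star w) = w" for w :: "('v, 'e) gen list"
    by (induction w) auto
  then show ?thesis by (metis (no_types, lifting) injI rev_map rev_rev_ident)
qed

lemma gen_star_gen_star [simp]: "gen_star (gen_star g) = g"
  by (cases g) auto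

lemma lookup_pstar:
  "Poly_Mapping.lookup (pstar x) w = cnj (Poly_Mapping.lookup x (rev (map gen_star w)))"
proof -
  have "Poly_Mapping.lookup (Poly_Mapping.map cnj x) v = cnj (Poly_Mapping.lookup x v)" for v
    by transfer (simp add: when_def)
  then show ?thesis
    unfolding pstar_def map_key.rep_eq[OF inj_word_star] by simp
qed

lemma pscale_add: "pscale c (x + y) = pscale c x + pscale c y"
  by (rule poly_mapping_eqI) (simp add: lookup_pscale lookup_add algebra_simps)
lemma pscale_diff: "pscale c (x - y) = pscale c x - pscale c y"
  by (rule poly_mapping_eqI) (simp add: lookup_pscale lookup_minus algebra_simps)
lemma pscale_add_left: "pscale (c + d) x = pscale c x + pscale d x"
  by (rule poly_mapping_eqI) (simp add: lookup_pscale lookup_add algebra_simps)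
lemma pscale_pscale: "pscale c (pscale d x) = pscale (c * d) x"
  by (rule poly_mapping_eqI) (simp add: lookup_pscale algebra_simps)
lemma pscale_one [simp]: "pscale 1 x = x"
  by (rule poly_mapping_eqI) (simp add: lookup_pscale)
lemma pscale_minus_one: "pscale (- 1) x = - x"
  by (rule poly_mapping_eqI) (simp add: lookup_pscale)
lemma pscale_0_left [simp]: "pscale 0 x = 0"
  by (rule poly_mapping_eqI) (simp add: lookup_pscale)
lemma pscale_0 [simp]: "pscale c 0 = 0"
  by (rule poly_mapping_eqI) (simp add: lookup_pscale)
lemma pscale_single [simp]: "pscale c (Poly_Mapping.single w d) = Poly_Mapping.single w (c * d)"
  by (rule poly_mapping_eqI) (simp add: lookup_pscale lookup_single when_def)

lemma pstar_add: "pstar (x + y) = pstar x + pstar y"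
  by (rule poly_mapping_eqI) (simp add: lookup_pstar lookup_add)
lemma pstar_diff: "pstar (x - y) = pstar x - pstar y"
  by (rule poly_mapping_eqI) (simp add: lookup_pstar lookup_minus)
lemma pstar_pscale: "pstar (pscale c x) = pscale (cnj c) (pstar x)"
  by (rule poly_mapping_eqI) (simp add: lookup_pstar lookup_pscale)
lemma pstar_0 [simp]: "pstar 0 = 0"
  by (rule poly_mapping_eqI) (simp add: lookup_pstar)
lemma pstar_pstar [simp]: "pstar (pstar x) = x"
  by (rule poly_mapping_eqI) (simp add: lookup_pstar rev_map comp_def)

lemma word_star_eq: "rev (map gen_star w) = v \<longleftrightarrow> w = rev (map gen_star v)"
  by (auto simp: rev_map comp_def)

lemma pstar_single:
  "pstar (Poly_Mapping.single w c) = Poly_Mapping.single (rev (map gen_star w)) (cnj c)"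
  by (rule poly_mapping_eqI) (auto simp: lookup_pstar lookup_single when_def word_star_eq)

lemma ncpoly_sum:
  "x = (\<Sum>w\<in>Poly_Mapping.keys x. Poly_Mapping.single w (Poly_Mapping.lookup x w))"
  by (rule poly_mapping_eqI)
    (simp add: lookup_sum lookup_single when_def sum.delta in_keys_iff)

lemma ncpoly_induct [case_names zero single add]:
  fixes x :: "('v, 'e) ncpoly"
  assumes "P 0" "\<And>w c. P (Poly_Mapping.single w c)" "\<And>x y. P x \<Longrightarrow> P y \<Longrightarrow> P (x + y)"
  shows "P x"
proof -
  have "P (\<Sum>w\<in>W. Poly_Mapping.single w (Poly_Mapping.lookup x w))" if "finite W" for W
    using that by (induction W rule: finite_induct) (use assms in auto)
  from this[OF finite_keys] show ?thesis by (metis ncpoly_sum)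
qed

lemma pscale_mult_left: "pscale c x * y = pscale c (x * y)"
  by (simp add: pscale_def mult_map_scale_conv_mult mult.assoc)

lemma single_mult: "Poly_Mapping.single v c * Poly_Mapping.single w d =
   (Poly_Mapping.single (v @ w) (c * d) :: ('v, 'e) ncpoly)"
  by (simp add: mult_single plus_list_def)

lemma pscale_mult_right: "x * pscale c y = pscale c (x * y)"
proof (induction x rule: ncpoly_induct)
  case (single w d)
  show ?case
    by (induction y rule: ncpoly_induct) (auto simp: single_mult pscale_add distrib_left mult_ac)
qed (auto simp: distrib_right pscale_add)

lemma pstar_mult: "pstar (x * y) = pstar y * pstar x"
proof (induction x rule: ncpoly_induct)
  case (single w d)
  show ?case
    by (induction y rule: ncpoly_induct)
      (auto simp: single_mult pstar_single pstar_add distrib_left distrib_right mult_ac)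
qed (auto simp: distrib_left distrib_right pstar_add)

lemma free_algebra_iff: "x \<in> free_algebra E \<longleftrightarrow>
    (\<forall>w. Poly_Mapping.lookup x w \<noteq> 0 \<longrightarrow> set w \<subseteq> generators E \<and> w \<noteq> [])"
  unfolding free_algebra_def by (auto simp: in_keys_iff subset_iff)

lemma free_algebra_0 [simp]: "0 \<in> free_algebra E"
  by (simp add: free_algebra_iff)
lemma free_algebra_add [simp]: "x \<in> free_algebra E \<Longrightarrow> y \<in> free_algebra E \<Longrightarrow> x + y \<in> free_algebra E"
  unfolding free_algebra_iff by (metis lookup_add add.right_neutral)
lemma free_algebra_diff [simp]: "x \<in> free_algebra E \<Longrightarrow> y \<in> free_algebra E \<Longrightarrow> x - y \<in> free_algebra E"
  unfolding free_algebra_iff by (metis lookup_minus diff_0_right)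
lemma free_algebra_scale [simp]: "x \<in> free_algebra E \<Longrightarrow> pscale c x \<in> free_algebra E"
  by (fastforce simp: free_algebra_iff lookup_pscale)
lemma free_algebra_mult [simp]:
  assumes "x \<in> free_algebra E" "y \<in> free_algebra E" shows "x * y \<in> free_algebra E"
proof -
  have "w \<in> lists (generators E) - {[]}" if "w \<in> Poly_Mapping.keys (x * y)" for w
  proof -
    from that keys_mult[of x y] obtain a b
      where w: "w = a @ b" and a: "a \<in> Poly_Mapping.keys x" and b: "b \<in> Poly_Mapping.keys y"
      by (auto simp: plus_list_def)
    have "a \<in> lists (generators E) - {[]}" "b \<in> lists (generators E) - {[]}"
      using assms a b unfolding free_algebra_def by blast+
    then show ?thesis by (simp add: w)
  qed
  then show ?thesis unfolding free_algebra_def by blast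
qed
lemma generators_star: "g \<in> generators E \<Longrightarrow> gen_star g \<in> generators E"
  by (auto simp: generators_def)
lemma free_algebra_star [simp]:
  assumes "x \<in> free_algebra E" shows "pstar x \<in> free_algebra E"
proof -
  have "set w \<subseteq> generators E \<and> w \<noteq> []" if "set (rev (map gen_star w)) \<subseteq> generators E \<and> rev (map gen_star w) \<noteq> []" for w
    using that generators_star by fastforce
  then show ?thesis using assms unfolding free_algebra_iff lookup_pstar by (metis complex_cnj_zero)
qed
lemma free_algebra_single:
  "set w \<subseteq> generators E \<Longrightarrow> w \<noteq> [] \<Longrightarrow> Poly_Mapping.single w c \<in> free_algebra E"
  by (auto simp: free_algebra_iff lookup_single when_def)
lemma free_algebra_sum: "(\<And>i. i \<in> I \<Longrightarrow> f i \<in> free_algebra E) \<Longrightarrow> sum f I \<in> free_algebra E"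
  by (induction I rule: infinite_finite_induct) auto

lemma free_algebra_induct [consumes 1, case_names zero single add]:
  assumes "x \<in> free_algebra E"
    and "P 0"
    and single: "\<And>w c. set w \<subseteq> generators E \<Longrightarrow> w \<noteq> [] \<Longrightarrow> P (Poly_Mapping.single w c)"
    and add: "\<And>x y. x \<in> free_algebra E \<Longrightarrow> y \<in> free_algebra E \<Longrightarrow> P x \<Longrightarrow> P y \<Longrightarrow> P (x + y)"
  shows "P x"
proof -
  let ?f = "\<lambda>w. Poly_Mapping.single w (Poly_Mapping.lookup x w)"
  have sub: "set w \<subseteq> generators E \<and> w \<noteq> []" if "w \<in> Poly_Mapping.keys x" for w
    using that assms(1) by (auto simp: free_algebra_iff in_keys_iff)
  have "sum ?f W \<in> free_algebra E \<and> P (sum ?f W)" if "finite W" "W \<subseteq> Poly_Mapping.keys x" for W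
    using that
  proof (induction W rule: finite_induct)
    case (insert w W)
    then show ?case using sub[of w] single add free_algebra_single[of w E] by auto
  qed (use \<open>P 0\<close> in auto)
  then show ?thesis using ncpoly_sum[of x] finite_keys by (metis subset_refl)
qed

lemma free_algebra_gens [simp]:
  "v \<in> verts E \<Longrightarrow> vtx v \<in> free_algebra E"
  "e \<in> arcs E \<Longrightarrow> edge e \<in> free_algebra E"
  "e \<in> arcs E \<Longrightarrow> ghost e \<in> free_algebra E"
  by (auto intro!: free_algebra_single simp: generators_def)

lemma pstar_gens [simp]: "pstar (vtx v) = vtx v" "pstar (edge e) = ghost e" "pstar (ghost e) = edge e"
  by (simp_all add: pstar_single)

lemma free_algebra_uminus [simp]: "x \<in> free_algebra E \<Longrightarrow> - x \<in> free_algebra E"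
  using free_algebra_diff[of 0 E x] by simp

lemma ck_relations_free:
  assumes "wf_digraph E" shows "ck_relations E \<subseteq> free_algebra E"
  using assms unfolding ck_relations_def
  by (auto simp: wf_digraph_def regular_vertex_def edges_into_def intro!: free_algebra_diff free_algebra_sum free_algebra_mult)


lemma ck_seminormD:
  assumes "ck_seminorm E q"
  shows "\<And>x. x \<in> free_algebra E \<Longrightarrow> 0 \<le> q x"
    "\<And>x y. x \<in> free_algebra E \<Longrightarrow> y \<in> free_algebra E \<Longrightarrow> q (x + y) \<le> q x + q y"
    "\<And>x c. x \<in> free_algebra E \<Longrightarrow> q (pscale c x) = cmod c * q x"
    "\<And>x y. x \<in> free_algebra E \<Longrightarrow> y \<in> free_algebra E \<Longrightarrow> q (x * y) \<le> q x * q y"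
    "\<And>x. x \<in> free_algebra E \<Longrightarrow> q (pstar x * x) = (q x)\<^sup>2"
    "\<And>x. x \<in> ck_relations E \<Longrightarrow> q x = 0"
  using assms unfolding ck_seminorm_def by auto

lemma ck_seminorm_more:
  assumes "ck_seminorm E q"
  shows "q 0 = 0"
    "\<And>x. x \<in> free_algebra E \<Longrightarrow> q (- x) = q x"
    "\<And>x. x \<in> free_algebra E \<Longrightarrow> q (pstar x) = q x"
    "\<And>x y. x \<in> free_algebra E \<Longrightarrow> y \<in> free_algebra E \<Longrightarrow> \<bar>q x - q y\<bar> \<le> q (x - y)"
    "\<And>x y. x \<in> free_algebra E \<Longrightarrow> y \<in> free_algebra E \<Longrightarrow> q (x - y) = q (y - x)"
proof -
  note D = ck_seminormD[OF assms]
  show "q 0 = 0" using D(3)[of 0 0] by simp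
  show neg: "q (- x) = q x" if "x \<in> free_algebra E" for x
    using D(3)[OF that, of "-1"] by (simp add: pscale_minus_one)
  have le: "q x \<le> q (pstar x)" if "x \<in> free_algebra E" for x
  proof (cases "q x = 0")
    case False
    then have "q x > 0" using D(1)[OF that] by simp
    moreover have "q x * q x \<le> q (pstar x) * q x"
      using D(5)[OF that] D(4)[of "pstar x" x] that by (simp add: power2_eq_square)
    ultimately show ?thesis by simp
  qed (use D(1)[of "pstar x"] that in auto)
  show "q (pstar x) = q x" if "x \<in> free_algebra E" for x
    using le[OF that] le[of "pstar x"] that by simp
  show sym: "q (x - y) = q (y - x)" if "x \<in> free_algebra E" "y \<in> free_algebra E" for x y
    using neg[of "x - y"] that by simp
  have *: "q x \<le> q (x - y) + q y" if "x \<in> free_algebra E" "y \<in> free_algebra E" for x y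
    using D(2)[of "x - y" y] that by simp
  show "\<bar>q x - q y\<bar> \<le> q (x - y)" if "x \<in> free_algebra E" "y \<in> free_algebra E" for x y
    using *[OF that] *[OF that(2,1)] sym[OF that] by simp
qed

lemma ck_seminorm_generator_le:
  assumes wf: "wf_digraph E" and q: "ck_seminorm E q" and g: "g \<in> generators E"
  shows "q (monomial [g]) \<le> 1"
proof -
  note D = ck_seminormD[OF q] and D' = ck_seminorm_more[OF q]
  have v: "q (vtx v) \<le> 1" if "v \<in> verts E" for v
  proof -
    have "vtx v * vtx v - vtx v \<in> ck_relations E"
      unfolding ck_relations_def using that by auto
    then have "q (vtx v * vtx v) = q (vtx v)"
      using D(6)[of "vtx v * vtx v - vtx v"] D'(4)[of "vtx v * vtx v" "vtx v"] that by simp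
    then have "(q (vtx v))\<^sup>2 = q (vtx v)" using D(5)[of "vtx v"] that by simp
    then show ?thesis by (auto simp: power2_eq_square)
  qed
  have e: "q (edge e) \<le> 1" if "e \<in> arcs E" for e
  proof -
    have t: "tail E e \<in> verts E" using wf that by (simp add: wf_digraph_def)
    have "ghost e * edge e - vtx (tail E e) \<in> ck_relations E"
      unfolding ck_relations_def using that by blast
    then have "q (ghost e * edge e) = q (vtx (tail E e))"
      using D(6)[of "ghost e * edge e - vtx (tail E e)"] D'(4)[of "ghost e * edge e" "vtx (tail E e)"]
        that t by simp
    then have "(q (edge e))\<^sup>2 = q (vtx (tail E e))" using D(5)[of "edge e"] that by simp
    then have "(q (edge e))\<^sup>2 \<le> 1" using v[OF t] by simp
    then show ?thesis using D(1)[of "edge e"] that by (simp add: power2_le_iff_abs_le abs_square_le_1)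
  qed
  have "q (ghost e) \<le> 1" if "e \<in> arcs E" for e
    using e[OF that] D'(3)[of "edge e"] that by simp
  with v e g show ?thesis by (auto simp: generators_def)
qed

lemma ck_seminorm_monomial_le:
  assumes wf: "wf_digraph E" and q: "ck_seminorm E q"
  shows "set w \<subseteq> generators E \<Longrightarrow> w \<noteq> [] \<Longrightarrow> q (monomial w) \<le> 1"
proof (induction w)
  case (Cons g w)
  note D = ck_seminormD[OF q]
  show ?case
  proof (cases "w = []")
    case False
    have "monomial (g # w) = monomial [g] * (monomial w :: ('a,'b) ncpoly)" by (simp add: single_mult)
    then have "q (monomial (g # w)) \<le> q (monomial [g]) * q (monomial w)"
      using D(4)[of "monomial [g]" "monomial w"] Cons False by (simp add: free_algebra_single)
    also have "\<dots> \<le> 1 * 1"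
      using Cons False ck_seminorm_generator_le[OF wf q, of g] D(1)
      by (intro mult_mono) (auto simp: free_algebra_single)
    finally show ?thesis by simp
  qed (use Cons ck_seminorm_generator_le[OF wf q, of g] in auto)
qed simp

lemma ck_seminorm_bdd:
  assumes wf: "wf_digraph E" and x: "x \<in> free_algebra E"
  shows "bdd_above ((\<lambda>q. q x) ` {q. ck_seminorm E q})"
proof -
  have "\<exists>M. \<forall>q. ck_seminorm E q \<longrightarrow> q x \<le> M" using x
  proof (induction rule: free_algebra_induct)
    case zero then show ?case by (metis ck_seminorm_more(1) order_refl)
  next
    case (single w c)
    have "q (Poly_Mapping.single w c) \<le> cmod c" if q: "ck_seminorm E q" for q
    proof -
      have "q (Poly_Mapping.single w c) = cmod c * q (monomial w)"
        using ck_seminormD(3)[OF q, of "monomial w" c] single free_algebra_single[of w E] by simp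
      also have "\<dots> \<le> cmod c * 1"
        by (intro mult_left_mono ck_seminorm_monomial_le[OF wf q]) (use single in auto)
      finally show ?thesis by simp
    qed
    then show ?case by blast
  next
    case (add x y)
    then obtain M N where "\<And>q. ck_seminorm E q \<Longrightarrow> q x \<le> M" "\<And>q. ck_seminorm E q \<Longrightarrow> q y \<le> N" by blast
    then have "q (x + y) \<le> M + N" if "ck_seminorm E q" for q
      using ck_seminormD(2)[OF that add(1,2)] that by (meson add_mono order_trans)
    then show ?case by blast
  qed
  then show ?thesis by (auto simp: bdd_above_def)
qed

lemma ck_seminorm_zero: "ck_seminorm E (\<lambda>_. 0)"
  by (simp add: ck_seminorm_def)

lemma universal_seminorm_upper:
  assumes "wf_digraph E" "x \<in> free_algebra E" "ck_seminorm E q"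
  shows "q x \<le> universal_seminorm E x"
  unfolding universal_seminorm_def
  by (rule cSUP_upper) (use assms ck_seminorm_bdd in auto)

lemma universal_seminorm_least:
  assumes "\<And>q. ck_seminorm E q \<Longrightarrow> q x \<le> M"
  shows "universal_seminorm E x \<le> M"
  unfolding universal_seminorm_def
  by (rule cSUP_least) (use assms ck_seminorm_zero in auto)

lemma ck_seminorm_universal:
  assumes wf: "wf_digraph E"
  shows "ck_seminorm E (universal_seminorm E)"
proof -
  let ?U = "universal_seminorm E"
  note up = universal_seminorm_upper[OF wf]
  have nn: "0 \<le> ?U x" if "x \<in> free_algebra E" for x
    using up[OF that ck_seminorm_zero] by simp
  have add: "?U (x + y) \<le> ?U x + ?U y" if "x \<in> free_algebra E" "y \<in> free_algebra E" for x y
    by (rule universal_seminorm_least)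
      (meson add_mono ck_seminormD(2) order_trans that up)
  have mult: "?U (x * y) \<le> ?U x * ?U y" if "x \<in> free_algebra E" "y \<in> free_algebra E" for x y
  proof (rule universal_seminorm_least)
    fix q assume q: "ck_seminorm E q"
    have "q (x * y) \<le> q x * q y" by (rule ck_seminormD(4)[OF q that])
    also have "\<dots> \<le> ?U x * ?U y"
      using that up q nn ck_seminormD(1)[OF q] by (intro mult_mono) auto
    finally show "q (x * y) \<le> ?U x * ?U y" .
  qed
  have le: "?U (pscale c x) \<le> cmod c * ?U x" if "x \<in> free_algebra E" for c x
    by (rule universal_seminorm_least) (simp add: ck_seminormD(3) that up mult_left_mono)
  have scale: "?U (pscale c x) = cmod c * ?U x" if "x \<in> free_algebra E" for c x
  proof (cases "c = 0")
    case False
    have "?U x \<le> cmod (1 / c) * ?U (pscale c x)"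
      using le[of "pscale c x" "1 / c"] that False by (simp add: pscale_pscale)
    then have "cmod c * ?U x \<le> ?U (pscale c x)" using False by (simp add: norm_divide field_simps)
    then show ?thesis using le[OF that, of c] by simp
  next
    case True
    have "?U 0 \<le> 0" by (rule universal_seminorm_least) (simp add: ck_seminorm_more(1))
    then show ?thesis using True nn[of 0] by simp
  qed
  have star: "?U (pstar x * x) = (?U x)\<^sup>2" if x: "x \<in> free_algebra E" for x
  proof (rule antisym)
    show "?U (pstar x * x) \<le> (?U x)\<^sup>2"
    proof (rule universal_seminorm_least)
      fix q assume q: "ck_seminorm E q"
      show "q (pstar x * x) \<le> (?U x)\<^sup>2"
        using ck_seminormD(5)[OF q x] ck_seminormD(1)[OF q x] up[OF x q] by (simp add: power_mono)
    qed
    have "?U x \<le> sqrt (?U (pstar x * x))"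
    proof (rule universal_seminorm_least)
      fix q assume q: "ck_seminorm E q"
      have "(q x)\<^sup>2 \<le> ?U (pstar x * x)"
        using ck_seminormD(5)[OF q x] up[of "pstar x * x" q] q x by simp
      then show "q x \<le> sqrt (?U (pstar x * x))" by (rule real_le_rsqrt)
    qed
    then have "(?U x)\<^sup>2 \<le> (sqrt (?U (pstar x * x)))\<^sup>2" using nn[OF x] by (intro power_mono) auto
    then show "(?U x)\<^sup>2 \<le> ?U (pstar x * x)" using nn[of "pstar x * x"] x by simp
  qed
  have rel: "?U x = 0" if "x \<in> ck_relations E" for x
  proof -
    have "?U x \<le> 0" by (rule universal_seminorm_least) (simp add: ck_seminormD(6) that)
    then show ?thesis using nn[of x] ck_relations_free[OF wf] that by force
  qed
  show ?thesis unfolding ck_seminorm_def using nn add scale mult star rel by blast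
qed


lemma norm_dist_metric:
  fixes A :: "'a normed_star_algebra" (structure)
  assumes "complex_algebra A"
    and nn: "\<And>x. x \<in> carrier A \<Longrightarrow> 0 \<le> nrm A x"
    and z: "\<And>x. x \<in> carrier A \<Longrightarrow> nrm A x = 0 \<longleftrightarrow> x = \<zero>"
    and tri: "\<And>x y. x \<in> carrier A \<Longrightarrow> y \<in> carrier A \<Longrightarrow> nrm A (x \<oplus> y) \<le> nrm A x + nrm A y"
    and sc: "\<And>x c. x \<in> carrier A \<Longrightarrow> nrm A (c \<odot> x) = cmod c * nrm A x"
  shows "Metric_space (carrier A) (norm_dist A)"
proof -
  interpret complex_algebra A by fact
  have s0: "0 \<odot> x = \<zero>" if "x \<in> carrier A" for x
  proof -
    have "0 \<odot> x = 0 \<odot> x \<oplus> 0 \<odot> x" using smult_distr_left[OF that, of 0 0] by simp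
    then show ?thesis using smult_closed[OF that] by (metis add.l_cancel_one')
  qed
  have neg: "(-1) \<odot> x = \<ominus> x" if "x \<in> carrier A" for x
    using smult_distr_left[OF that, of "-1" 1] smult_one[OF that] s0[OF that] smult_closed[OF that] that
    by (simp add: minus_equality)
  have sym: "nrm A (x \<ominus> y) = nrm A (y \<ominus> x)" if "x \<in> carrier A" "y \<in> carrier A" for x y
  proof -
    have "x \<ominus> y = \<ominus> (y \<ominus> x)" using that by (simp add: a_minus_def minus_add a_comm)
    then show ?thesis using sc[of "y \<ominus> x" "-1"] neg[of "y \<ominus> x"] that by simp
  qed
  have meq: "x \<ominus> y = \<zero> \<longleftrightarrow> x = y" if "x \<in> carrier A" "y \<in> carrier A" for x y
    using that by (metis a_inv_closed a_minus_def minus_equality minus_minus r_neg)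
  show ?thesis
  proof
    show "0 \<le> norm_dist A x y" for x y
      using nn by (simp add: norm_dist_def)
    show "norm_dist A x y = norm_dist A y x" for x y
      using sym by (simp add: norm_dist_def)
    show "norm_dist A x y = 0 \<longleftrightarrow> x = y" if "x \<in> carrier A" "y \<in> carrier A" for x y
      using that by (simp add: norm_dist_def z minus_closed meq)
    show "norm_dist A x w \<le> norm_dist A x y + norm_dist A y w"
      if c: "x \<in> carrier A" "y \<in> carrier A" "w \<in> carrier A" for x y w
    proof -
      have "x \<ominus> w = (x \<ominus> y) \<oplus> (y \<ominus> w)"
        using c by (simp add: a_minus_def a_assoc r_neg1)
      then show ?thesis using c tri[of "x \<ominus> y" "y \<ominus> w"] by (simp add: norm_dist_def)
    qed
  qed
qed

lemma (in cstar_algebra) metric: "Metric_space (carrier A) (norm_dist A)"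
  by (rule norm_dist_metric)
    (use complex_algebra_axioms nrm_nonneg nrm_eq_0_iff nrm_triangle nrm_smult in auto)

lemma UN2_eqI:
  "(\<And>x y. x \<in> a \<Longrightarrow> y \<in> b \<Longrightarrow> f x y = c) \<Longrightarrow> a \<noteq> {} \<Longrightarrow> b \<noteq> {} \<Longrightarrow> (\<Union>x\<in>a. \<Union>y\<in>b. f x y) = c"
  by blast

lemma UN1_eqI: "(\<And>x. x \<in> a \<Longrightarrow> f x = c) \<Longrightarrow> a \<noteq> {} \<Longrightarrow> (\<Union>x\<in>a. f x) = c"
  by blast

lemma null_sandwich:
  fixes f g :: "nat \<Rightarrow> real"
  assumes "\<And>n. 0 \<le> f n" "\<And>n. f n \<le> g n" "g \<longlonglongrightarrow> 0" shows "f \<longlonglongrightarrow> 0"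
  by (rule Lim_null_comparison[of f g]) (use assms in auto)

context
  fixes E :: "('v, 'e) pre_digraph"
  assumes wf: "wf_digraph E"
begin

private abbreviation (input) "U \<equiv> universal_seminorm E"
private abbreviation (input) "F \<equiv> free_algebra E"
private abbreviation (input) "CS \<equiv> cauchy_seqs E"
private abbreviation (input) "cl \<equiv> cauchy_class E"
private abbreviation (input) "A \<equiv> graph_cstar E"

lemmas U_nonneg = ck_seminormD(1)[OF ck_seminorm_universal[OF wf]]
  and U_add = ck_seminormD(2)[OF ck_seminorm_universal[OF wf]]
  and U_scale = ck_seminormD(3)[OF ck_seminorm_universal[OF wf]]
  and U_mult = ck_seminormD(4)[OF ck_seminorm_universal[OF wf]]
  and U_cstar = ck_seminormD(5)[OF ck_seminorm_universal[OF wf]]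
  and U_rel = ck_seminormD(6)[OF ck_seminorm_universal[OF wf]]
  and U_0 = ck_seminorm_more(1)[OF ck_seminorm_universal[OF wf]]
  and U_uminus = ck_seminorm_more(2)[OF ck_seminorm_universal[OF wf]]
  and U_star = ck_seminorm_more(3)[OF ck_seminorm_universal[OF wf]]
  and U_abs_diff = ck_seminorm_more(4)[OF ck_seminorm_universal[OF wf]]
  and U_sym = ck_seminorm_more(5)[OF ck_seminorm_universal[OF wf]]

lemma U_diff_triangle:
  assumes "x \<in> F" "y \<in> F" "z \<in> F" shows "U (x - z) \<le> U (x - y) + U (y - z)"
  using U_add[of "x - y" "y - z"] assms by simp

lemma CS_F: "X \<in> CS \<Longrightarrow> X n \<in> F"
  by (simp add: cauchy_seqs_def)

lemma CS_D: "X \<in> CS \<Longrightarrow> 0 < \<epsilon> \<Longrightarrow> \<exists>N. \<forall>m\<ge>N. \<forall>n\<ge>N. U (X m - X n) < \<epsilon>"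
  by (simp add: cauchy_seqs_def)

lemma CS_I: "(\<And>n. X n \<in> F) \<Longrightarrow> (\<And>\<epsilon>. 0 < \<epsilon> \<Longrightarrow> \<exists>N. \<forall>m\<ge>N. \<forall>n\<ge>N. U (X m - X n) < \<epsilon>) \<Longrightarrow> X \<in> CS"
  by (simp add: cauchy_seqs_def)

lemma CS_const: "x \<in> F \<Longrightarrow> (\<lambda>n. x) \<in> CS"
  by (rule CS_I) (auto simp: U_0)

lemma CS_convergent:
  assumes X: "X \<in> CS" shows "convergent (\<lambda>n. U (X n))"
proof -
  have "Cauchy (\<lambda>n. U (X n))"
    unfolding Cauchy_def dist_real_def
    using CS_D[OF X] U_abs_diff[OF CS_F[OF X] CS_F[OF X]] by (meson order_le_less_trans)
  then show ?thesis by (simp add: Cauchy_convergent_iff)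
qed

lemma CS_bounded:
  assumes X: "X \<in> CS" shows "\<exists>B>0. \<forall>n. U (X n) \<le> B"
proof -
  have "Bseq (\<lambda>n. U (X n))" using CS_convergent[OF X] by (rule convergent_imp_Bseq)
  then obtain B where "0 < B" "\<forall>n. norm (U (X n)) \<le> B" by (auto elim: BseqE)
  then show ?thesis by (metis abs_le_D1 real_norm_def)
qed

lemma CS_add:
  assumes X: "X \<in> CS" and Y: "Y \<in> CS" shows "(\<lambda>n. X n + Y n) \<in> CS"
proof (rule CS_I)
  show "X n + Y n \<in> F" for n using CS_F[OF X] CS_F[OF Y] by simp
  fix \<epsilon> :: real assume "0 < \<epsilon>"
  then obtain M N where M: "\<forall>m\<ge>M. \<forall>n\<ge>M. U (X m - X n) < \<epsilon> / 2" and N: "\<forall>m\<ge>N. \<forall>n\<ge>N. U (Y m - Y n) < \<epsilon> / 2"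
    using CS_D[OF X, of "\<epsilon> / 2"] CS_D[OF Y, of "\<epsilon> / 2"] by auto
  have "U (X m + Y m - (X n + Y n)) < \<epsilon>" if "m \<ge> max M N" "n \<ge> max M N" for m n
  proof -
    have *: "X m + Y m - (X n + Y n) = (X m - X n) + (Y m - Y n)" by simp
    have "U (X m + Y m - (X n + Y n)) \<le> U (X m - X n) + U (Y m - Y n)"
      unfolding * by (rule U_add) (use CS_F[OF X] CS_F[OF Y] in simp_all)
    also have "\<dots> < \<epsilon> / 2 + \<epsilon> / 2" using M N that by (intro add_strict_mono) auto
    finally show ?thesis by simp
  qed
  then show "\<exists>N. \<forall>m\<ge>N. \<forall>n\<ge>N. U (X m + Y m - (X n + Y n)) < \<epsilon>" by blast
qed

lemma CS_scale:
  assumes X: "X \<in> CS" shows "(\<lambda>n. pscale c (X n)) \<in> CS"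
proof (rule CS_I)
  show "pscale c (X n) \<in> F" for n using CS_F[OF X] by simp
  fix \<epsilon> :: real assume e: "0 < \<epsilon>"
  have p: "0 < cmod c + 1" by (simp add: add_nonneg_pos)
  obtain M where M: "\<forall>m\<ge>M. \<forall>n\<ge>M. U (X m - X n) < \<epsilon> / (cmod c + 1)"
    using CS_D[OF X, of "\<epsilon> / (cmod c + 1)"] e p by auto
  have "U (pscale c (X m) - pscale c (X n)) < \<epsilon>" if "m \<ge> M" "n \<ge> M" for m n
  proof -
    have "U (pscale c (X m) - pscale c (X n)) = cmod c * U (X m - X n)"
      using U_scale[of "X m - X n" c] CS_F[OF X] by (simp add: pscale_diff)
    also have "\<dots> \<le> (cmod c + 1) * U (X m - X n)"
      using U_nonneg[of "X m - X n"] CS_F[OF X] by (intro mult_right_mono) auto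
    also have "\<dots> < \<epsilon>" using M that p by (simp add: field_simps)
    finally show ?thesis .
  qed
  then show "\<exists>N. \<forall>m\<ge>N. \<forall>n\<ge>N. U (pscale c (X m) - pscale c (X n)) < \<epsilon>" by blast
qed

lemma CS_diff: "X \<in> CS \<Longrightarrow> Y \<in> CS \<Longrightarrow> (\<lambda>n. X n - Y n) \<in> CS"
  using CS_add[of X "\<lambda>n. pscale (-1) (Y n)"] CS_scale[of Y "-1"] by (simp add: pscale_minus_one)

lemma CS_star: "X \<in> CS \<Longrightarrow> (\<lambda>n. pstar (X n)) \<in> CS"
  unfolding cauchy_seqs_def
  by (auto simp: U_star simp flip: pstar_diff)

lemma mult_estimate:
  assumes "x \<in> F" "y \<in> F" "x' \<in> F" "y' \<in> F"
  shows "U (x * y - x' * y') \<le> U x * U (y - y') + U (x - x') * U y'"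
proof -
  have "x * y - x' * y' = x * (y - y') + (x - x') * y'" by (simp add: algebra_simps)
  then have "U (x * y - x' * y') \<le> U (x * (y - y')) + U ((x - x') * y')"
    using U_add[of "x * (y - y')" "(x - x') * y'"] assms by simp
  then show ?thesis using U_mult[of x "y - y'"] U_mult[of "x - x'" y'] assms by simp
qed

lemma CS_mult:
  assumes X: "X \<in> CS" and Y: "Y \<in> CS" shows "(\<lambda>n. X n * Y n) \<in> CS"
proof (rule CS_I)
  show "X n * Y n \<in> F" for n using CS_F[OF X] CS_F[OF Y] by simp
  fix \<epsilon> :: real assume e: "0 < \<epsilon>"
  obtain B where B: "0 < B" "\<And>n. U (X n) \<le> B" using CS_bounded[OF X] by blast
  obtain C where C: "0 < C" "\<And>n. U (Y n) \<le> C" using CS_bounded[OF Y] by blast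
  obtain M where M: "\<forall>m\<ge>M. \<forall>n\<ge>M. U (X m - X n) < \<epsilon> / (2 * C)"
    using CS_D[OF X, of "\<epsilon> / (2 * C)"] e C by auto
  obtain N where N: "\<forall>m\<ge>N. \<forall>n\<ge>N. U (Y m - Y n) < \<epsilon> / (2 * B)"
    using CS_D[OF Y, of "\<epsilon> / (2 * B)"] e B by auto
  have "U (X m * Y m - X n * Y n) < \<epsilon>" if "m \<ge> max M N" "n \<ge> max M N" for m n
  proof -
    note FF = CS_F[OF X] CS_F[OF Y]
    have "U (X m * Y m - X n * Y n) \<le> U (X m) * U (Y m - Y n) + U (X m - X n) * U (Y n)"
      by (rule mult_estimate) (use FF in auto)
    also have "\<dots> \<le> B * U (Y m - Y n) + U (X m - X n) * C"
      using B C U_nonneg FF by (intro add_mono mult_mono) (auto simp: less_imp_le)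
    also have "\<dots> < \<epsilon> / 2 + \<epsilon> / 2"
      using M N that B C by (intro add_strict_mono) (auto simp: field_simps)
    finally show ?thesis by simp
  qed
  then show "\<exists>N. \<forall>m\<ge>N. \<forall>n\<ge>N. U (X m * Y m - X n * Y n) < \<epsilon>" by blast
qed

lemma equiv_cauchy_rel: "equiv CS (cauchy_rel E)"
proof (rule equivI)
  show "cauchy_rel E \<subseteq> CS \<times> CS" by (auto simp: cauchy_rel_def)
  show "refl_on CS (cauchy_rel E)" by (auto simp: refl_on_def cauchy_rel_def U_0)
  show "sym (cauchy_rel E)"
    by (rule symI) (auto simp: cauchy_rel_def U_sym[OF CS_F CS_F])
  show "trans (cauchy_rel E)"
  proof (rule transI)
    fix X Y Z assume "(X, Y) \<in> cauchy_rel E" "(Y, Z) \<in> cauchy_rel E"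
    then have CS: "X \<in> CS" "Y \<in> CS" "Z \<in> CS"
      and l: "(\<lambda>n. U (X n - Y n)) \<longlonglongrightarrow> 0" "(\<lambda>n. U (Y n - Z n)) \<longlonglongrightarrow> 0" by (auto simp: cauchy_rel_def)
    have "(\<lambda>n. U (X n - Z n)) \<longlonglongrightarrow> 0"
    proof (rule null_sandwich)
      show "(\<lambda>n. U (X n - Y n) + U (Y n - Z n)) \<longlonglongrightarrow> 0" using tendsto_add[OF l] by simp
    qed (use U_nonneg U_diff_triangle CS_F[OF CS(1)] CS_F[OF CS(2)] CS_F[OF CS(3)] in auto)
    then show "(X, Z) \<in> cauchy_rel E" using CS by (simp add: cauchy_rel_def)
  qed
qed

lemma cl_eq_iff:
  "X \<in> CS \<Longrightarrow> Y \<in> CS \<Longrightarrow> cl X = cl Y \<longleftrightarrow> (\<lambda>n. U (X n - Y n)) \<longlonglongrightarrow> 0"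
  unfolding cauchy_class_def
  by (subst eq_equiv_class_iff[OF equiv_cauchy_rel]) (auto simp: cauchy_rel_def)

lemma mem_cl_iff: "X \<in> CS \<Longrightarrow> Y \<in> cl X \<longleftrightarrow> Y \<in> CS \<and> cl X = cl Y"
proof -
  assume X: "X \<in> CS"
  have "Y \<in> cl X \<longleftrightarrow> Y \<in> CS \<and> (\<lambda>n. U (X n - Y n)) \<longlonglongrightarrow> 0"
    using X unfolding cauchy_class_def cauchy_rel_def by blast
  then show ?thesis using cl_eq_iff[OF X] by metis
qed

lemma mem_cl_D:
  assumes X: "X \<in> CS" and Y: "Y \<in> cl X"
  shows "Y \<in> CS" "(\<lambda>n. U (Y n - X n)) \<longlonglongrightarrow> 0"
proof -
  show Y': "Y \<in> CS" using mem_cl_iff[OF X] Y by blast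
  have "cl Y = cl X" using mem_cl_iff[OF X] Y by simp
  then show "(\<lambda>n. U (Y n - X n)) \<longlonglongrightarrow> 0" using cl_eq_iff[OF Y' X] by blast
qed

lemma cl_self: "X \<in> CS \<Longrightarrow> X \<in> cl X"
  by (simp add: mem_cl_iff)

lemma carrier_A: "a \<in> carrier A \<longleftrightarrow> (\<exists>X\<in>CS. a = cl X)"
  by (auto simp: graph_cstar_def quotient_def cauchy_class_def)

lemma cl_carrier: "X \<in> CS \<Longrightarrow> cl X \<in> carrier A"
  by (auto simp: carrier_A)

lemma carrier_cases: assumes "a \<in> carrier A" obtains X where "X \<in> CS" "a = cl X"
  using assms by (auto simp: carrier_A)

lemma A_zero: "\<zero>\<^bsub>A\<^esub> = cl (\<lambda>n. 0)"
  by (simp add: graph_cstar_def)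

lemma A_ops:
  "a \<oplus>\<^bsub>A\<^esub> b = (\<Union>X\<in>a. \<Union>Y\<in>b. cl (\<lambda>n. X n + Y n))"
  "a \<otimes>\<^bsub>A\<^esub> b = (\<Union>X\<in>a. \<Union>Y\<in>b. cl (\<lambda>n. X n * Y n))"
  "c \<odot>\<^bsub>A\<^esub> a = (\<Union>X\<in>a. cl (\<lambda>n. pscale c (X n)))"
  "adj A a = (\<Union>X\<in>a. cl (\<lambda>n. pstar (X n)))"
  by (simp_all add: graph_cstar_def)

lemma A_add:
  assumes X: "X \<in> CS" and Y: "Y \<in> CS" shows "cl X \<oplus>\<^bsub>A\<^esub> cl Y = cl (\<lambda>n. X n + Y n)"
proof -
  have "cl (\<lambda>n. X' n + Y' n) = cl (\<lambda>n. X n + Y n)" if "X' \<in> cl X" "Y' \<in> cl Y" for X' Y'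
  proof -
    have CS': "X' \<in> CS" "Y' \<in> CS" and l: "(\<lambda>n. U (X' n - X n)) \<longlonglongrightarrow> 0" "(\<lambda>n. U (Y' n - Y n)) \<longlonglongrightarrow> 0"
      using mem_cl_D[OF X that(1)] mem_cl_D[OF Y that(2)] by simp_all
    note FF = CS_F[OF X] CS_F[OF Y] CS_F[OF CS'(1)] CS_F[OF CS'(2)]
    have "(\<lambda>n. U (X' n + Y' n - (X n + Y n))) \<longlonglongrightarrow> 0"
    proof (rule null_sandwich)
      show "(\<lambda>n. U (X' n - X n) + U (Y' n - Y n)) \<longlonglongrightarrow> 0" using tendsto_add[OF l] by simp
      show "U (X' n + Y' n - (X n + Y n)) \<le> U (X' n - X n) + U (Y' n - Y n)" for n
        using U_add[of "X' n - X n" "Y' n - Y n"] FF by (simp add: algebra_simps)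
    qed (use U_nonneg FF in auto)
    then show ?thesis using CS' X Y by (simp add: cl_eq_iff CS_add)
  qed
  note * = this
  show ?thesis unfolding A_ops
    by (rule UN2_eqI) (use * cl_self[OF X] cl_self[OF Y] in blast)+
qed

lemma A_mult:
  assumes X: "X \<in> CS" and Y: "Y \<in> CS" shows "cl X \<otimes>\<^bsub>A\<^esub> cl Y = cl (\<lambda>n. X n * Y n)"
proof -
  have "cl (\<lambda>n. X' n * Y' n) = cl (\<lambda>n. X n * Y n)" if "X' \<in> cl X" "Y' \<in> cl Y" for X' Y'
  proof -
    have CS': "X' \<in> CS" "Y' \<in> CS" and l: "(\<lambda>n. U (X' n - X n)) \<longlonglongrightarrow> 0" "(\<lambda>n. U (Y' n - Y n)) \<longlonglongrightarrow> 0"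
      using mem_cl_D[OF X that(1)] mem_cl_D[OF Y that(2)] by simp_all
    note FF = CS_F[OF X] CS_F[OF Y] CS_F[OF CS'(1)] CS_F[OF CS'(2)]
    obtain B where B: "0 < B" "\<And>n. U (X' n) \<le> B" using CS_bounded[OF CS'(1)] by blast
    obtain C where C: "0 < C" "\<And>n. U (Y n) \<le> C" using CS_bounded[OF Y] by blast
    have "(\<lambda>n. U (X' n * Y' n - X n * Y n)) \<longlonglongrightarrow> 0"
    proof (rule null_sandwich)
      show "(\<lambda>n. B * U (Y' n - Y n) + U (X' n - X n) * C) \<longlonglongrightarrow> 0"
        using tendsto_add[OF tendsto_mult[OF tendsto_const[of B] l(2)] tendsto_mult[OF l(1) tendsto_const[of C]]]
        by simp
      show "U (X' n * Y' n - X n * Y n) \<le> B * U (Y' n - Y n) + U (X' n - X n) * C" for n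
      proof -
        have "U (X' n * Y' n - X n * Y n) \<le> U (X' n) * U (Y' n - Y n) + U (X' n - X n) * U (Y n)"
          by (rule mult_estimate) (use FF in auto)
        also have "\<dots> \<le> B * U (Y' n - Y n) + U (X' n - X n) * C"
          using B C U_nonneg FF by (intro add_mono mult_mono) (auto simp: less_imp_le)
        finally show ?thesis .
      qed
    qed (use U_nonneg FF in auto)
    then show ?thesis using CS' X Y by (simp add: cl_eq_iff CS_mult)
  qed
  note * = this
  show ?thesis unfolding A_ops
    by (rule UN2_eqI) (use * cl_self[OF X] cl_self[OF Y] in blast)+
qed

lemma A_scale:
  assumes X: "X \<in> CS" shows "c \<odot>\<^bsub>A\<^esub> cl X = cl (\<lambda>n. pscale c (X n))"
proof -
  have "cl (\<lambda>n. pscale c (X' n)) = cl (\<lambda>n. pscale c (X n))" if "X' \<in> cl X" for X'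
  proof -
    have CS': "X' \<in> CS" and l: "(\<lambda>n. U (X' n - X n)) \<longlonglongrightarrow> 0"
      using mem_cl_D[OF X that] by simp_all
    have "U (pscale c (X' n) - pscale c (X n)) = cmod c * U (X' n - X n)" for n
      using U_scale[of "X' n - X n" c] CS_F[OF X] CS_F[OF CS'] by (simp add: pscale_diff)
    then have "(\<lambda>n. U (pscale c (X' n) - pscale c (X n))) \<longlonglongrightarrow> 0"
      using tendsto_mult[OF tendsto_const[of "cmod c"] l] by simp
    then show ?thesis using CS' X by (simp add: cl_eq_iff CS_scale)
  qed
  note * = this
  show ?thesis unfolding A_ops
    by (rule UN1_eqI) (use * cl_self[OF X] in blast)+
qed

lemma A_star:
  assumes X: "X \<in> CS" shows "adj A (cl X) = cl (\<lambda>n. pstar (X n))"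
proof -
  have "cl (\<lambda>n. pstar (X' n)) = cl (\<lambda>n. pstar (X n))" if "X' \<in> cl X" for X'
  proof -
    have CS': "X' \<in> CS" and l: "(\<lambda>n. U (X' n - X n)) \<longlonglongrightarrow> 0"
      using mem_cl_D[OF X that] by simp_all
    have "U (pstar (X' n) - pstar (X n)) = U (X' n - X n)" for n
      using U_star[of "X' n - X n"] CS_F[OF X] CS_F[OF CS'] by (simp add: pstar_diff)
    then have "(\<lambda>n. U (pstar (X' n) - pstar (X n))) \<longlonglongrightarrow> 0" using l by simp
    then show ?thesis using CS' X by (simp add: cl_eq_iff CS_star)
  qed
  note * = this
  show ?thesis unfolding A_ops
    by (rule UN1_eqI) (use * cl_self[OF X] in blast)+
qed

lemma A_norm_lim:
  assumes X: "X \<in> CS" shows "(\<lambda>n. U (X n)) \<longlonglongrightarrow> nrm A (cl X)"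
proof -
  obtain l where l: "(\<lambda>n. U (X n)) \<longlonglongrightarrow> l" using CS_convergent[OF X] by (auto simp: convergent_def)
  have "nrm A (cl X) = (THE l. \<exists>X'\<in>cl X. (\<lambda>n. U (X' n)) \<longlonglongrightarrow> l)" by (simp add: graph_cstar_def)
  also have "\<dots> = l"
  proof (rule the_equality)
    show "\<exists>X'\<in>cl X. (\<lambda>n. U (X' n)) \<longlonglongrightarrow> l" using l cl_self[OF X] by blast
    fix k assume "\<exists>X'\<in>cl X. (\<lambda>n. U (X' n)) \<longlonglongrightarrow> k"
    then obtain Y where Y: "Y \<in> cl X" and k: "(\<lambda>n. U (Y n)) \<longlonglongrightarrow> k" by blast
    have CS': "Y \<in> CS" and d: "(\<lambda>n. U (Y n - X n)) \<longlonglongrightarrow> 0"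
      using mem_cl_D[OF X Y] by simp_all
    have "(\<lambda>n. \<bar>U (Y n) - U (X n)\<bar>) \<longlonglongrightarrow> 0"
      by (rule null_sandwich[OF _ _ d]) (use U_abs_diff CS_F[OF X] CS_F[OF CS'] in auto)
    then have "(\<lambda>n. U (Y n) - U (X n)) \<longlonglongrightarrow> 0" by (simp only: tendsto_rabs_zero_iff)
    moreover have "(\<lambda>n. U (Y n) - U (X n)) \<longlonglongrightarrow> k - l" by (intro tendsto_intros l k)
    ultimately show "k = l" using LIMSEQ_unique by force
  qed
  finally show ?thesis using l by simp
qed

lemma A_norm_eqI: "X \<in> CS \<Longrightarrow> (\<lambda>n. U (X n)) \<longlonglongrightarrow> l \<Longrightarrow> nrm A (cl X) = l"
  using A_norm_lim LIMSEQ_unique by blast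

lemma complex_algebra_A: "complex_algebra A"
proof -
  have g: "abelian_group A"
  proof (rule abelian_groupI)
    fix x assume "x \<in> carrier A"
    then obtain X where X: "X \<in> CS" "x = cl X" by (rule carrier_cases)
    have "cl (\<lambda>n. pscale (-1) (X n)) \<oplus>\<^bsub>A\<^esub> x = \<zero>\<^bsub>A\<^esub>"
      using A_add[OF CS_scale[OF X(1), of "-1"] X(1)] X by (simp add: pscale_minus_one A_zero)
    then show "\<exists>y\<in>carrier A. y \<oplus>\<^bsub>A\<^esub> x = \<zero>\<^bsub>A\<^esub>"
      using cl_carrier[OF CS_scale[OF X(1)]] by blast
  qed (auto elim!: carrier_cases simp: A_zero A_add CS_add CS_const add_ac intro!: cl_carrier)
  show ?thesis
  proof (intro complex_algebra.intro nonunital_ring.intro g nonunital_ring_axioms.intro complex_algebra_axioms.intro)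
  qed (auto elim!: carrier_cases simp: A_add A_mult A_scale CS_add CS_mult CS_scale mult.assoc
      distrib_left distrib_right pscale_add pscale_add_left pscale_pscale pscale_mult_left
      pscale_mult_right intro!: cl_carrier)
qed

lemma A_minus:
  assumes X: "X \<in> CS" and Y: "Y \<in> CS" shows "cl X \<ominus>\<^bsub>A\<^esub> cl Y = cl (\<lambda>n. X n - Y n)"
proof -
  interpret A: complex_algebra A by (rule complex_algebra_A)
  have "\<ominus>\<^bsub>A\<^esub> cl Y = cl (\<lambda>n. pscale (-1) (Y n))"
  proof (rule A.minus_equality)
    show "cl (\<lambda>n. pscale (-1) (Y n)) \<oplus>\<^bsub>A\<^esub> cl Y = \<zero>\<^bsub>A\<^esub>"
      using A_add[OF CS_scale[OF Y, of "-1"] Y] by (simp add: pscale_minus_one A_zero)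
  qed (use Y CS_scale cl_carrier in auto)
  then show ?thesis using A_add[OF X CS_scale[OF Y, of "-1"]]
    by (simp add: a_minus_def pscale_minus_one)
qed

lemma A_norm:
  shows A_norm_nonneg: "a \<in> carrier A \<Longrightarrow> 0 \<le> nrm A a"
    and A_norm_eq_0: "a \<in> carrier A \<Longrightarrow> nrm A a = 0 \<longleftrightarrow> a = \<zero>\<^bsub>A\<^esub>"
    and A_norm_add: "a \<in> carrier A \<Longrightarrow> b \<in> carrier A \<Longrightarrow> nrm A (a \<oplus>\<^bsub>A\<^esub> b) \<le> nrm A a + nrm A b"
    and A_norm_scale: "a \<in> carrier A \<Longrightarrow> nrm A (c \<odot>\<^bsub>A\<^esub> a) = cmod c * nrm A a"
    and A_norm_mult: "a \<in> carrier A \<Longrightarrow> b \<in> carrier A \<Longrightarrow> nrm A (a \<otimes>\<^bsub>A\<^esub> b) \<le> nrm A a * nrm A b"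
    and A_norm_cstar: "a \<in> carrier A \<Longrightarrow> nrm A (adj A a \<otimes>\<^bsub>A\<^esub> a) = (nrm A a)\<^sup>2"
proof -
  {
    assume "a \<in> carrier A"
    then obtain X where X: "X \<in> CS" "a = cl X" by (rule carrier_cases)
    note lX = A_norm_lim[OF X(1)]
    show "0 \<le> nrm A a"
      using LIMSEQ_le_const[OF lX, of 0] U_nonneg CS_F[OF X(1)] X(2) by blast
    show "nrm A a = 0 \<longleftrightarrow> a = \<zero>\<^bsub>A\<^esub>"
      using cl_eq_iff[OF X(1) CS_const[of 0]] lX A_norm_eqI[OF X(1), of 0] X(2) by (auto simp: A_zero)
    have "(\<lambda>n. U (pscale c (X n))) \<longlonglongrightarrow> cmod c * nrm A a"
      using tendsto_mult[OF tendsto_const[of "cmod c"] lX] X CS_F[OF X(1)] by (simp add: U_scale)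
    then show "nrm A (c \<odot>\<^bsub>A\<^esub> a) = cmod c * nrm A a"
      using A_norm_eqI[OF CS_scale[OF X(1)]] X by (simp add: A_scale)
    have "(\<lambda>n. U (pstar (X n) * X n)) \<longlonglongrightarrow> (nrm A a)\<^sup>2"
      using tendsto_power[OF lX, of 2] X CS_F[OF X(1)] by (simp add: U_cstar)
    then show "nrm A (adj A a \<otimes>\<^bsub>A\<^esub> a) = (nrm A a)\<^sup>2"
      using A_norm_eqI[OF CS_mult[OF CS_star[OF X(1)] X(1)]] X by (simp add: A_star A_mult CS_star)
    assume "b \<in> carrier A"
    then obtain Y where Y: "Y \<in> CS" "b = cl Y" by (rule carrier_cases)
    note lY = A_norm_lim[OF Y(1)]
    show "nrm A (a \<oplus>\<^bsub>A\<^esub> b) \<le> nrm A a + nrm A b"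
      using LIMSEQ_le[OF A_norm_lim[OF CS_add[OF X(1) Y(1)]] tendsto_add[OF lX lY]]
        U_add CS_F[OF X(1)] CS_F[OF Y(1)] X Y by (simp add: A_add)
    show "nrm A (a \<otimes>\<^bsub>A\<^esub> b) \<le> nrm A a * nrm A b"
      using LIMSEQ_le[OF A_norm_lim[OF CS_mult[OF X(1) Y(1)]] tendsto_mult[OF lX lY]]
        U_mult CS_F[OF X(1)] CS_F[OF Y(1)] X Y by (simp add: A_mult)
  }
qed

lemma A_metric: "Metric_space (carrier A) (norm_dist A)"
  by (rule norm_dist_metric[OF complex_algebra_A])
    (use A_norm_nonneg A_norm_eq_0 A_norm_add A_norm_scale in auto)

lemma A_dist_le:
  assumes X: "X \<in> CS" and Y: "Y \<in> CS" and le: "\<And>n. n \<ge> N \<Longrightarrow> U (X n - Y n) \<le> \<epsilon>"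
  shows "norm_dist A (cl X) (cl Y) \<le> \<epsilon>"
proof -
  have "(\<lambda>n. U (X n - Y n)) \<longlonglongrightarrow> norm_dist A (cl X) (cl Y)"
    using A_norm_lim[OF CS_diff[OF X Y]] X Y by (simp add: norm_dist_def A_minus cl_carrier)
  then show ?thesis by (rule LIMSEQ_le_const2) (use le in blast)
qed

lemma A_complete: "Metric_space.mcomplete (carrier A) (norm_dist A)"
proof -
  interpret M: Metric_space "carrier A" "norm_dist A" by (rule A_metric)
  show ?thesis unfolding M.mcomplete_def
  proof (intro allI impI)
    fix s assume s: "M.MCauchy s"
    then have sc: "s k \<in> carrier A" for k by (auto simp: M.MCauchy_def)
    then have "\<forall>k. \<exists>X. X \<in> CS \<and> s k = cl X" by (auto simp: carrier_A)
    then obtain X where X: "\<And>k. X k \<in> CS" "\<And>k. s k = cl (X k)" by metis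
    have "\<exists>N. \<forall>m\<ge>N. \<forall>n\<ge>N. U (X k m - X k n) < 1 / real (Suc k)" for k
      by (rule CS_D[OF X(1)]) simp
    then obtain N where N: "\<And>k m n. m \<ge> N k \<Longrightarrow> n \<ge> N k \<Longrightarrow> U (X k m - X k n) < 1 / real (Suc k)"
      by metis
    define Y where "Y k = X k (N k)" for k
    have YF: "Y k \<in> F" for k using CS_F[OF X(1)] by (simp add: Y_def)
    let ?c = "\<lambda>k. cl (\<lambda>n. Y k)"
    have cC: "?c k \<in> carrier A" for k by (intro cl_carrier CS_const YF)
    have close: "norm_dist A (s k) (?c k) \<le> 1 / real (Suc k)" for k
      unfolding X(2)
    proof (rule A_dist_le)
      show "U (X k n - Y k) \<le> 1 / real (Suc k)" if "n \<ge> N k" for n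
        using N[OF that, of "N k"] by (simp add: Y_def)
    qed (use X CS_const YF in auto)
    have UY: "U (Y k - Y l) = norm_dist A (?c k) (?c l)" for k l
      using A_norm_eqI[of "\<lambda>n. Y k - Y l" "U (Y k - Y l)"] YF
      by (simp add: norm_dist_def A_minus cC CS_const)
    have inv0: "(\<lambda>k. 1 / real (Suc k)) \<longlonglongrightarrow> 0"
      using LIMSEQ_inverse_real_of_nat by (simp add: inverse_eq_divide)
    have YC: "Y \<in> CS"
    proof (rule CS_I[OF YF])
      fix \<epsilon> :: real assume e: "0 < \<epsilon>"
      obtain K where K: "1 / real (Suc K) < \<epsilon> / 3"
        using reals_Archimedean[of "\<epsilon> / 3"] e by (auto simp: inverse_eq_divide)
      have K': "1 / real (Suc k) < \<epsilon> / 3" if "k \<ge> K" for k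
        using K that by (meson order_le_less_trans frac_le zero_le_one order_refl of_nat_mono Suc_le_mono of_nat_0_less_iff zero_less_Suc)
      obtain M where M: "\<And>k l. k \<ge> M \<Longrightarrow> l \<ge> M \<Longrightarrow> norm_dist A (s k) (s l) < \<epsilon> / 3"
        using s e unfolding M.MCauchy_def by (meson divide_pos_pos zero_less_numeral)
      have "U (Y k - Y l) < \<epsilon>" if "k \<ge> max K M" "l \<ge> max K M" for k l
      proof -
        have "norm_dist A (?c k) (?c l) \<le> norm_dist A (?c k) (s k) + norm_dist A (s k) (?c l)"
          by (rule M.triangle) (use sc cC in auto)
        also have "norm_dist A (s k) (?c l) \<le> norm_dist A (s k) (s l) + norm_dist A (s l) (?c l)"
          by (rule M.triangle) (use sc cC in auto)
        finally show ?thesis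
          using UY[of k l] close[of k] close[of l] K'[of k] K'[of l] M[of k l] that
            M.commute[of "?c k" "s k"] by simp
      qed
      then show "\<exists>N. \<forall>m\<ge>N. \<forall>n\<ge>N. U (Y m - Y n) < \<epsilon>" by blast
    qed
    have "(\<lambda>k. norm_dist A (?c k) (cl Y)) \<longlonglongrightarrow> 0"
    proof (rule LIMSEQ_I)
      fix \<epsilon> :: real assume e: "0 < \<epsilon>"
      obtain K where K: "\<And>m n. m \<ge> K \<Longrightarrow> n \<ge> K \<Longrightarrow> U (Y m - Y n) < \<epsilon> / 2"
        using CS_D[OF YC, of "\<epsilon> / 2"] e by (metis half_gt_zero)
      have "norm_dist A (?c k) (cl Y) \<le> \<epsilon> / 2" if "k \<ge> K" for k
        by (rule A_dist_le[where N = K]) (use K that YC CS_const YF in \<open>auto simp: less_imp_le\<close>)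
      note * = this
      have "norm (norm_dist A (?c k) (cl Y) - 0) < \<epsilon>" if "k \<ge> K" for k
        using *[OF that] e M.nonneg[of "?c k" "cl Y"] unfolding real_norm_def by linarith
      then show "\<exists>no. \<forall>k\<ge>no. norm (norm_dist A (?c k) (cl Y) - 0) < \<epsilon>" by blast
    qed
    from tendsto_add[OF inv0 this]
    have l: "(\<lambda>k. 1 / real (Suc k) + norm_dist A (?c k) (cl Y)) \<longlonglongrightarrow> 0" by simp
    have "(\<lambda>k. norm_dist A (s k) (cl Y)) \<longlonglongrightarrow> 0"
    proof (rule null_sandwich[OF _ _ l])
      show "norm_dist A (s k) (cl Y) \<le> 1 / real (Suc k) + norm_dist A (?c k) (cl Y)" for k
        using M.triangle[of "s k" "?c k" "cl Y"] close[of k] sc cC cl_carrier[OF YC] by fastforce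
    qed (rule M.nonneg)
    then have "limitin M.mtopology s (cl Y) sequentially"
      using cl_carrier[OF YC] sc by (simp add: M.limitin_metric_dist_null)
    then show "\<exists>x. limitin M.mtopology s x sequentially" by blast
  qed
qed

theorem cstar_algebra_graph_cstar: "cstar_algebra A"
proof (intro cstar_algebra.intro complex_algebra_A cstar_algebra_axioms.intro)
  show "Metric_space.mcomplete (carrier A) (norm_dist A)" by (rule A_complete)
qed (use A_norm in \<open>auto elim!: carrier_cases simp: A_star A_add A_mult A_scale CS_add CS_mult CS_scale
   CS_star pstar_add pstar_mult pstar_pscale intro!: cl_carrier\<close>)

end


context cstar_algebra
begin

lemma smult_zero_left: "x \<in> carrier A \<Longrightarrow> 0 \<odot> x = \<zero>"
proof -
  assume x: "x \<in> carrier A"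
  have "0 \<odot> x = 0 \<odot> x \<oplus> 0 \<odot> x" using smult_distr_left[OF x, of 0 0] by simp
  then show ?thesis using smult_closed[OF x] by (metis add.l_cancel_one')
qed

lemma smult_minus_one: "x \<in> carrier A \<Longrightarrow> (-1) \<odot> x = \<ominus> x"
  using smult_distr_left[of x "-1" 1] smult_one[of x] smult_zero_left[of x] smult_closed[of x]
  by (simp add: minus_equality)

lemma minus_conv: "x \<in> carrier A \<Longrightarrow> y \<in> carrier A \<Longrightarrow> x \<ominus> y = x \<oplus> (-1) \<odot> y"
  by (simp add: a_minus_def smult_minus_one)

lemma smult_zero: "c \<odot> \<zero> = \<zero>"
  using smult_zero_left[of \<zero>] smult_smult[of \<zero> c 0] by simp

lemma adj_zero: "adj A \<zero> = \<zero>"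
  using adj_smult[of \<zero> 0] smult_zero_left[of \<zero>] smult_zero_left[of "adj A \<zero>"] adj_closed[of \<zero>] by simp

lemma mult_zero: "x \<in> carrier A \<Longrightarrow> x \<otimes> \<zero> = \<zero>" "x \<in> carrier A \<Longrightarrow> \<zero> \<otimes> x = \<zero>"
  using smult_mult_right[of x \<zero> 0] smult_mult_left[of \<zero> x 0] smult_zero_left mult_closed by auto

lemma nrm_zero: "nrm A \<zero> = 0"
  using nrm_eq_0_iff by simp

lemma nrm_adj: assumes x: "x \<in> carrier A" shows "nrm A (adj A x) = nrm A x"
proof -
  have le: "nrm A x \<le> nrm A (adj A x)" if x: "x \<in> carrier A" for x
  proof (cases "nrm A x = 0")
    case False
    then have "nrm A x > 0" using nrm_nonneg[OF x] by simp
    moreover have "nrm A x * nrm A x \<le> nrm A (adj A x) * nrm A x"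
      using nrm_cstar[OF x] nrm_mult[OF adj_closed[OF x] x] by (simp add: power2_eq_square)
    ultimately show ?thesis by simp
  qed (use nrm_nonneg[OF adj_closed[OF x]] in auto)
  show ?thesis using le[OF x] le[OF adj_closed[OF x]] adj_adj[OF x] by simp
qed

lemma nrm_minus_triangle:
  "x \<in> carrier A \<Longrightarrow> y \<in> carrier A \<Longrightarrow> w \<in> carrier A \<Longrightarrow> nrm A (x \<ominus> w) \<le> nrm A (x \<ominus> y) + nrm A (y \<ominus> w)"
  using Metric_space.triangle[OF metric, of x y w] by (simp add: norm_dist_def)

lemma nrm_minus_commute: "x \<in> carrier A \<Longrightarrow> y \<in> carrier A \<Longrightarrow> nrm A (x \<ominus> y) = nrm A (y \<ominus> x)"
  using Metric_space.commute[OF metric, of x y] by (simp add: norm_dist_def)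

lemma nrm_minus_eq_0: "x \<in> carrier A \<Longrightarrow> y \<in> carrier A \<Longrightarrow> nrm A (x \<ominus> y) = 0 \<longleftrightarrow> x = y"
  using Metric_space.zero[OF metric, of x y] by (simp add: norm_dist_def)

lemma minus_add_minus:
  assumes "x \<in> carrier A" "y \<in> carrier A" "x' \<in> carrier A" "y' \<in> carrier A"
  shows "(x \<oplus> y) \<ominus> (x' \<oplus> y') = (x \<ominus> x') \<oplus> (y \<ominus> y')"
  using assms by (simp add: a_minus_def minus_add a_ac)

lemma minus_smult:
  assumes "x \<in> carrier A" "y \<in> carrier A" shows "c \<odot> x \<ominus> c \<odot> y = c \<odot> (x \<ominus> y)"
  using assms by (simp add: minus_conv smult_distr_right smult_smult smult_closed)

lemma minus_adj:
  assumes "x \<in> carrier A" "y \<in> carrier A" shows "adj A x \<ominus> adj A y = adj A (x \<ominus> y)"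
  using assms by (simp add: minus_conv adj_add adj_smult smult_closed adj_closed)

lemma minus_mult_estimate:
  assumes c: "x \<in> carrier A" "y \<in> carrier A" "x' \<in> carrier A" "y' \<in> carrier A"
  shows "nrm A (x \<otimes> y \<ominus> x' \<otimes> y') \<le> nrm A x * nrm A (y \<ominus> y') + nrm A (x \<ominus> x') * nrm A y'"
proof -
  have "x \<otimes> y \<ominus> x \<otimes> y' = x \<otimes> (y \<ominus> y')"
    using c by (simp add: minus_conv distr_left smult_mult_right mult_closed smult_closed)
  moreover have "x \<otimes> y' \<ominus> x' \<otimes> y' = (x \<ominus> x') \<otimes> y'"
    using c by (simp add: minus_conv distr_right smult_mult_left mult_closed smult_closed)
  ultimately have "nrm A (x \<otimes> y \<ominus> x' \<otimes> y') \<le> nrm A (x \<otimes> (y \<ominus> y')) + nrm A ((x \<ominus> x') \<otimes> y')"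
    using nrm_minus_triangle[of "x \<otimes> y" "x \<otimes> y'" "x' \<otimes> y'"] c by (simp add: mult_closed)
  also have "\<dots> \<le> nrm A x * nrm A (y \<ominus> y') + nrm A (x \<ominus> x') * nrm A y'"
    by (intro add_mono nrm_mult) (use c in auto)
  finally show ?thesis .
qed

lemma nrm_limit_unique:
  assumes "\<And>n::nat. f n \<in> carrier A" "a \<in> carrier A" "b \<in> carrier A"
    "(\<lambda>n. nrm A (f n \<ominus> a)) \<longlonglongrightarrow> 0" "(\<lambda>n. nrm A (f n \<ominus> b)) \<longlonglongrightarrow> 0"
  shows "a = b"
proof -
  have "(\<lambda>n. nrm A (a \<ominus> b)) \<longlonglongrightarrow> 0"
  proof (rule null_sandwich)
    show "(\<lambda>n. nrm A (f n \<ominus> a) + nrm A (f n \<ominus> b)) \<longlonglongrightarrow> 0"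
      using tendsto_add[OF assms(4,5)] by simp
    show "nrm A (a \<ominus> b) \<le> nrm A (f n \<ominus> a) + nrm A (f n \<ominus> b)" for n
      using nrm_minus_triangle[of a "f n" b] nrm_minus_commute[of a "f n"] assms by simp
  qed (use assms nrm_nonneg in auto)
  then have "nrm A (a \<ominus> b) = 0" by (simp add: LIMSEQ_const_iff)
  then show ?thesis using nrm_minus_eq_0 assms by simp
qed

end

lemma star_homD:
  assumes "\<phi> \<in> star_hom A B"
  shows "\<And>x. x \<in> carrier A \<Longrightarrow> \<phi> x \<in> carrier B"
    "\<And>x y. x \<in> carrier A \<Longrightarrow> y \<in> carrier A \<Longrightarrow> \<phi> (x \<oplus>\<^bsub>A\<^esub> y) = \<phi> x \<oplus>\<^bsub>B\<^esub> \<phi> y"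
    "\<And>x y. x \<in> carrier A \<Longrightarrow> y \<in> carrier A \<Longrightarrow> \<phi> (x \<otimes>\<^bsub>A\<^esub> y) = \<phi> x \<otimes>\<^bsub>B\<^esub> \<phi> y"
    "\<And>x. x \<in> carrier A \<Longrightarrow> \<phi> (adj A x) = adj B (\<phi> x)"
    "\<And>c x. x \<in> carrier A \<Longrightarrow> \<phi> (c \<odot>\<^bsub>A\<^esub> x) = c \<odot>\<^bsub>B\<^esub> \<phi> x"
    "\<And>x. x \<in> carrier A \<Longrightarrow> nrm B (\<phi> x) \<le> nrm A x"
    "\<phi> \<in> extensional (carrier A)"
  using assms unfolding star_hom_def by (auto simp: PiE_def)

lemma cuntz_krieger_familyD:
  assumes "cuntz_krieger_family E A p s"
  shows "\<And>v. v \<in> verts E \<Longrightarrow> p v \<in> carrier A"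
    "\<And>v. v \<in> verts E \<Longrightarrow> p v \<otimes>\<^bsub>A\<^esub> p v = p v"
    "\<And>v. v \<in> verts E \<Longrightarrow> adj A (p v) = p v"
    "\<And>v w. v \<in> verts E \<Longrightarrow> w \<in> verts E \<Longrightarrow> v \<noteq> w \<Longrightarrow> p v \<otimes>\<^bsub>A\<^esub> p w = \<zero>\<^bsub>A\<^esub>"
    "\<And>e. e \<in> arcs E \<Longrightarrow> s e \<in> carrier A"
    "\<And>e. e \<in> arcs E \<Longrightarrow> s e \<otimes>\<^bsub>A\<^esub> adj A (s e) \<otimes>\<^bsub>A\<^esub> s e = s e"
    "\<And>e f. e \<in> arcs E \<Longrightarrow> f \<in> arcs E \<Longrightarrow> e \<noteq> f \<Longrightarrow>
        (s e \<otimes>\<^bsub>A\<^esub> adj A (s e)) \<otimes>\<^bsub>A\<^esub> (s f \<otimes>\<^bsub>A\<^esub> adj A (s f)) = \<zero>\<^bsub>A\<^esub>"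
    "\<And>e. e \<in> arcs E \<Longrightarrow> adj A (s e) \<otimes>\<^bsub>A\<^esub> s e = p (tail E e)"
    "\<And>e. e \<in> arcs E \<Longrightarrow> p (head E e) \<otimes>\<^bsub>A\<^esub> (s e \<otimes>\<^bsub>A\<^esub> adj A (s e)) = s e \<otimes>\<^bsub>A\<^esub> adj A (s e)"
    "\<And>v. regular_vertex E v \<Longrightarrow> p v = (\<Oplus>\<^bsub>A\<^esub>e\<in>edges_into E v. s e \<otimes>\<^bsub>A\<^esub> adj A (s e))"
  using assms unfolding cuntz_krieger_family_def is_projection_def is_partial_isometry_def by auto

lemma cuntz_krieger_family_rotate:
  assumes B: "cstar_algebra B" and ck: "cuntz_krieger_family E B p s" and z: "cmod z = 1"
  shows "cuntz_krieger_family E B p (\<lambda>e. z \<odot>\<^bsub>B\<^esub> s e)"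
proof -
  interpret B: cstar_algebra B by fact
  note D = cuntz_krieger_familyD[OF ck]
  have zz: "z * cnj z = 1" "cnj z * z = 1"
    using z by (simp_all add: complex_norm_square[symmetric] mult.commute)
  have 1: "z \<odot>\<^bsub>B\<^esub> s e \<otimes>\<^bsub>B\<^esub> adj B (z \<odot>\<^bsub>B\<^esub> s e) = s e \<otimes>\<^bsub>B\<^esub> adj B (s e)"
    and 2: "adj B (z \<odot>\<^bsub>B\<^esub> s e) \<otimes>\<^bsub>B\<^esub> (z \<odot>\<^bsub>B\<^esub> s e) = adj B (s e) \<otimes>\<^bsub>B\<^esub> s e"
    if "e \<in> arcs E" for e
    using D(5)[OF that]
    by (simp_all add: B.adj_smult B.smult_mult_left B.smult_mult_right B.smult_smult B.adj_closed
        B.smult_closed B.mult_closed zz B.smult_one)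
  have 3: "(\<Oplus>\<^bsub>B\<^esub>e\<in>edges_into E v. z \<odot>\<^bsub>B\<^esub> s e \<otimes>\<^bsub>B\<^esub> adj B (z \<odot>\<^bsub>B\<^esub> s e)) =
      (\<Oplus>\<^bsub>B\<^esub>e\<in>edges_into E v. s e \<otimes>\<^bsub>B\<^esub> adj B (s e))" for v
    by (rule B.finsum_cong') (auto simp: edges_into_def 1 D(5) B.mult_closed B.adj_closed)
  show ?thesis
    unfolding cuntz_krieger_family_def is_projection_def is_partial_isometry_def 3
  proof (intro conjI ballI allI impI)
    fix e assume e: "e \<in> arcs E"
    show "z \<odot>\<^bsub>B\<^esub> s e \<in> carrier B" using D(5)[OF e] by (rule B.smult_closed)
    show "z \<odot>\<^bsub>B\<^esub> s e \<otimes>\<^bsub>B\<^esub> adj B (z \<odot>\<^bsub>B\<^esub> s e) \<otimes>\<^bsub>B\<^esub> (z \<odot>\<^bsub>B\<^esub> s e) = z \<odot>\<^bsub>B\<^esub> s e"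
      unfolding 1[OF e] using D(5,6)[OF e] by (simp add: B.smult_mult_right B.mult_closed B.adj_closed)
  qed (use D in \<open>simp_all only: 1 2\<close>)
qed

fun word_prod :: "'a normed_star_algebra \<Rightarrow> ('g \<Rightarrow> 'a) \<Rightarrow> 'g list \<Rightarrow> 'a" where
  "word_prod B h [] = \<zero>\<^bsub>B\<^esub>"
| "word_prod B h [g] = h g"
| "word_prod B h (g # g' # w) = h g \<otimes>\<^bsub>B\<^esub> word_prod B h (g' # w)"

fun gen_value :: "'a normed_star_algebra \<Rightarrow> ('v \<Rightarrow> 'a) \<Rightarrow> ('e \<Rightarrow> 'a) \<Rightarrow> ('v, 'e) gen \<Rightarrow> 'a" where
  "gen_value B p s (Vtx v) = p v"
| "gen_value B p s (Edge e) = s e"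
| "gen_value B p s (Ghost e) = adj B (s e)"

definition poly_value ::
    "'a normed_star_algebra \<Rightarrow> ('v \<Rightarrow> 'a) \<Rightarrow> ('e \<Rightarrow> 'a) \<Rightarrow> ('v, 'e) ncpoly \<Rightarrow> 'a" where
  "poly_value B p s x = (\<Oplus>\<^bsub>B\<^esub>w\<in>Poly_Mapping.keys x.
     Poly_Mapping.lookup x w \<odot>\<^bsub>B\<^esub> word_prod B (gen_value B p s) w)"

context
  fixes E :: "('v, 'e) pre_digraph" and B :: "'b normed_star_algebra"
    and p :: "'v \<Rightarrow> 'b" and s :: "'e \<Rightarrow> 'b"
  assumes wf: "wf_digraph E" and cstar: "cstar_algebra B" and ck: "cuntz_krieger_family E B p s"
begin

interpretation B: cstar_algebra B by (rule cstar)

private abbreviation (input) "ev \<equiv> gen_value B p s"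
private abbreviation (input) "wp \<equiv> word_prod B ev"
private abbreviation (input) "pv \<equiv> poly_value B p s"
private abbreviation (input) "FE \<equiv> free_algebra E"
private abbreviation (input) "UE \<equiv> universal_seminorm E"

private lemmas D = cuntz_krieger_familyD[OF ck]

lemma ev_closed: "g \<in> generators E \<Longrightarrow> ev g \<in> carrier B"
  using D(1,5) B.adj_closed by (auto simp: generators_def)

lemma ev_star: "g \<in> generators E \<Longrightarrow> ev (gen_star g) = adj B (ev g)"
  using D(3,5) B.adj_adj by (auto simp: generators_def)

lemma wp_closed: "set w \<subseteq> generators E \<Longrightarrow> wp w \<in> carrier B"
  by (induction w rule: induct_list012) (auto simp: ev_closed intro!: B.mult_closed)

lemma wp_Cons: "w \<noteq> [] \<Longrightarrow> wp (g # w) = ev g \<otimes>\<^bsub>B\<^esub> wp w"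
  by (cases w) auto

lemma wp_append:
  "set v \<subseteq> generators E \<Longrightarrow> set w \<subseteq> generators E \<Longrightarrow> v \<noteq> [] \<Longrightarrow> w \<noteq> [] \<Longrightarrow> wp (v @ w) = wp v \<otimes>\<^bsub>B\<^esub> wp w"
proof (induction v)
  case (Cons g v)
  show ?case
  proof (cases "v = []")
    case False
    then show ?thesis using Cons by (simp add: wp_Cons B.mult_assoc ev_closed wp_closed)
  qed (use Cons in \<open>simp add: wp_Cons\<close>)
qed simp

lemma wp_star: "set w \<subseteq> generators E \<Longrightarrow> w \<noteq> [] \<Longrightarrow> wp (rev (map gen_star w)) = adj B (wp w)"
proof (induction w)
  case (Cons g w)
  show ?case
  proof (cases "w = []")
    case False
    have "wp (rev (map gen_star w) @ [gen_star g]) = wp (rev (map gen_star w)) \<otimes>\<^bsub>B\<^esub> wp [gen_star g]"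
      by (rule wp_append) (use Cons False generators_star in auto)
    then show ?thesis using Cons False by (simp add: wp_Cons B.adj_mult ev_closed wp_closed ev_star)
  qed (use Cons in \<open>simp add: ev_star\<close>)
qed simp

lemma keys_generators: "x \<in> FE \<Longrightarrow> w \<in> Poly_Mapping.keys x \<Longrightarrow> set w \<subseteq> generators E \<and> w \<noteq> []"
  by (simp add: free_algebra_iff in_keys_iff)

lemma pv_superset:
  assumes fin: "finite K" and sub: "Poly_Mapping.keys x \<subseteq> K" and K: "\<And>w. w \<in> K \<Longrightarrow> set w \<subseteq> generators E"
  shows "pv x = (\<Oplus>\<^bsub>B\<^esub>w\<in>K. Poly_Mapping.lookup x w \<odot>\<^bsub>B\<^esub> wp w)"
proof -
  let ?f = "\<lambda>w. Poly_Mapping.lookup x w \<odot>\<^bsub>B\<^esub> wp w"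
  have f: "?f \<in> K \<rightarrow> carrier B" using K wp_closed B.smult_closed by auto
  have "finsum B ?f (Poly_Mapping.keys x) = finsum B ?f K"
    by (rule B.add.finprod_mono_neutral_cong_left)
      (use fin sub f B.smult_zero_left wp_closed K in \<open>auto simp: in_keys_iff\<close>)
  then show ?thesis by (simp add: poly_value_def)
qed

lemma pv_closed: "x \<in> FE \<Longrightarrow> pv x \<in> carrier B"
  unfolding poly_value_def
  by (rule B.finsum_closed) (use keys_generators wp_closed B.smult_closed in auto)

lemma pv_0: "pv 0 = \<zero>\<^bsub>B\<^esub>"
  by (simp add: poly_value_def)

lemma pv_add: assumes x: "x \<in> FE" and y: "y \<in> FE" shows "pv (x + y) = pv x \<oplus>\<^bsub>B\<^esub> pv y"
proof -
  let ?K = "Poly_Mapping.keys x \<union> Poly_Mapping.keys y"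
  have K: "set w \<subseteq> generators E" if "w \<in> ?K" for w using keys_generators x y that by blast
  have "pv (x + y) = (\<Oplus>\<^bsub>B\<^esub>w\<in>?K. Poly_Mapping.lookup (x + y) w \<odot>\<^bsub>B\<^esub> wp w)"
    by (rule pv_superset) (use K keys_add[of x y] in auto)
  also have "\<dots> = (\<Oplus>\<^bsub>B\<^esub>w\<in>?K. Poly_Mapping.lookup x w \<odot>\<^bsub>B\<^esub> wp w \<oplus>\<^bsub>B\<^esub> Poly_Mapping.lookup y w \<odot>\<^bsub>B\<^esub> wp w)"
    by (rule B.finsum_cong') (use K wp_closed B.smult_closed B.smult_distr_left in \<open>auto simp: lookup_add\<close>)
  also have "\<dots> = (\<Oplus>\<^bsub>B\<^esub>w\<in>?K. Poly_Mapping.lookup x w \<odot>\<^bsub>B\<^esub> wp w) \<oplus>\<^bsub>B\<^esub> (\<Oplus>\<^bsub>B\<^esub>w\<in>?K. Poly_Mapping.lookup y w \<odot>\<^bsub>B\<^esub> wp w)"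
    by (rule B.finsum_addf) (use K wp_closed B.smult_closed in auto)
  also have "\<dots> = pv x \<oplus>\<^bsub>B\<^esub> pv y"
    using pv_superset[of ?K x] pv_superset[of ?K y] K by simp
  finally show ?thesis .
qed

lemma pv_single: "set w \<subseteq> generators E \<Longrightarrow> pv (Poly_Mapping.single w c) = c \<odot>\<^bsub>B\<^esub> wp w"
  using pv_superset[of "{w}" "Poly_Mapping.single w c"] wp_closed[of w] B.smult_closed by simp

lemma pv_scale: "x \<in> FE \<Longrightarrow> pv (pscale c x) = c \<odot>\<^bsub>B\<^esub> pv x"
proof (induction rule: free_algebra_induct)
  case (single w d)
  then show ?case by (simp add: pv_single B.smult_smult wp_closed)
next
  case (add x y)
  then show ?case by (simp add: pscale_add pv_add B.smult_distr_right pv_closed)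
qed (simp add: pv_0 B.smult_zero)

lemma pv_mult: "x \<in> FE \<Longrightarrow> y \<in> FE \<Longrightarrow> pv (x * y) = pv x \<otimes>\<^bsub>B\<^esub> pv y"
proof (induction rule: free_algebra_induct)
  case (single w c)
  note w = single(1,2)
  from single(3) show ?case
  proof (induction rule: free_algebra_induct)
    case (single v d)
    then show ?case using w
      by (simp add: single_mult pv_single wp_append B.smult_smult wp_closed B.smult_mult_left
          B.smult_mult_right B.smult_closed B.mult_closed mult.commute)
  next
    case (add x y)
    then show ?case using w
      by (simp add: distrib_left pv_add B.distr_left pv_closed free_algebra_single)
  qed (use w in \<open>simp add: pv_0 B.mult_zero pv_closed free_algebra_single\<close>)
next
  case (add x z)
  then show ?case by (simp add: distrib_right pv_add B.distr_right pv_closed)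
qed (simp add: pv_0 B.mult_zero pv_closed)

lemma pv_star: "x \<in> FE \<Longrightarrow> pv (pstar x) = adj B (pv x)"
proof (induction rule: free_algebra_induct)
  case (single w c)
  have "set (rev (map gen_star w)) \<subseteq> generators E" using single generators_star by auto
  then show ?case using single by (simp add: pstar_single pv_single wp_star B.adj_smult wp_closed)
next
  case (add x y)
  then show ?case by (simp add: pstar_add pv_add B.adj_add pv_closed)
qed (simp add: pv_0 B.adj_zero)

lemma pv_gens:
  "v \<in> verts E \<Longrightarrow> pv (vtx v) = p v"
  "e \<in> arcs E \<Longrightarrow> pv (edge e) = s e"
  "e \<in> arcs E \<Longrightarrow> pv (ghost e) = adj B (s e)"
  using D(1,5) B.adj_closed by (auto simp: pv_single generators_def B.smult_one)

lemma pv_diff: "x \<in> FE \<Longrightarrow> y \<in> FE \<Longrightarrow> pv (x - y) = pv x \<ominus>\<^bsub>B\<^esub> pv y"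
  using pv_add[of x "pscale (-1) y"] pv_scale[of y "-1"]
  by (simp add: pscale_minus_one B.minus_conv pv_closed)

lemma pv_sum:
  "finite I \<Longrightarrow> (\<And>i. i \<in> I \<Longrightarrow> f i \<in> FE) \<Longrightarrow> pv (\<Sum>i\<in>I. f i) = (\<Oplus>\<^bsub>B\<^esub>i\<in>I. pv (f i))"
proof (induction I rule: finite_induct)
  case (insert i I)
  have "pv (\<Sum>i\<in>insert i I. f i) = pv (f i) \<oplus>\<^bsub>B\<^esub> pv (\<Sum>i\<in>I. f i)"
    using insert by (simp add: pv_add free_algebra_sum)
  also have "\<dots> = (\<Oplus>\<^bsub>B\<^esub>i\<in>insert i I. pv (f i))"
    using insert by (subst B.finsum_insert) (auto simp: pv_closed)
  finally show ?case .
qed (simp add: pv_0)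

lemma pv_diff_0: "x \<in> FE \<Longrightarrow> y \<in> FE \<Longrightarrow> pv x = pv y \<Longrightarrow> pv (x - y) = \<zero>\<^bsub>B\<^esub>"
  using pv_closed by (simp add: pv_diff B.r_neg B.minus_eq)

lemma pv_relations: "x \<in> ck_relations E \<Longrightarrow> pv x = \<zero>\<^bsub>B\<^esub>"
proof -
  assume x: "x \<in> ck_relations E"
  have ends: "tail E e \<in> verts E" "head E e \<in> verts E" if "e \<in> arcs E" for e
    using wf that by (auto simp: wf_digraph_def)
  have into: "e \<in> arcs E" if "e \<in> edges_into E v" for e v using that by (simp add: edges_into_def)
  have vv: "pv (vtx v * vtx w - (if v = w then vtx v else 0)) = \<zero>\<^bsub>B\<^esub>"
    if "v \<in> verts E" "w \<in> verts E" for v w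
    using D(2,4) that by (intro pv_diff_0) (auto simp: pv_mult pv_gens pv_0)
  have r1: "pv (edge e * ghost e * edge e - edge e) = \<zero>\<^bsub>B\<^esub>" if "e \<in> arcs E" for e
    using D(6) that by (intro pv_diff_0) (auto simp: pv_mult pv_gens)
  have r2: "pv ((edge e * ghost e) * (edge f * ghost f)) = \<zero>\<^bsub>B\<^esub>"
    if "e \<in> arcs E" "f \<in> arcs E" "e \<noteq> f" for e f
    using D(7)[OF that] that by (simp only: pv_mult pv_gens free_algebra_mult free_algebra_gens)
  have r3: "pv (ghost e * edge e - vtx (tail E e)) = \<zero>\<^bsub>B\<^esub>" if "e \<in> arcs E" for e
    using D(8) that ends[OF that] by (intro pv_diff_0) (auto simp: pv_mult pv_gens)
  have r4: "pv (vtx (head E e) * (edge e * ghost e) - edge e * ghost e) = \<zero>\<^bsub>B\<^esub>" if "e \<in> arcs E" for e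
    using D(9) that ends[OF that] by (intro pv_diff_0) (auto simp: pv_mult pv_gens)
  have r5: "pv (vtx v - (\<Sum>e\<in>edges_into E v. edge e * ghost e)) = \<zero>\<^bsub>B\<^esub>" if r: "regular_vertex E v" for v
  proof (rule pv_diff_0)
    have fin: "finite (edges_into E v)" and v: "v \<in> verts E" using r by (auto simp: regular_vertex_def)
    show "vtx v \<in> FE" using v by simp
    show "(\<Sum>e\<in>edges_into E v. edge e * ghost e) \<in> FE"
      by (rule free_algebra_sum) (auto dest: into)
    have "pv (\<Sum>e\<in>edges_into E v. edge e * ghost e) = (\<Oplus>\<^bsub>B\<^esub>e\<in>edges_into E v. pv (edge e * ghost e))"
      by (rule pv_sum[OF fin]) (auto dest: into)
    also have "\<dots> = (\<Oplus>\<^bsub>B\<^esub>e\<in>edges_into E v. s e \<otimes>\<^bsub>B\<^esub> adj B (s e))"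
      by (rule B.finsum_cong') (auto dest!: into simp: pv_mult pv_gens D(5) B.mult_closed B.adj_closed)
    finally show "pv (vtx v) = pv (\<Sum>e\<in>edges_into E v. edge e * ghost e)"
      using D(10)[OF r] v by (simp add: pv_gens)
  qed
  show ?thesis using x unfolding ck_relations_def Un_iff mem_Collect_eq
    using vv r1 r2 r3 r4 r5 by (elim disjE exE conjE) (simp_all only:)
qed

lemma pv_seminorm: "ck_seminorm E (\<lambda>x. nrm B (pv x))"
  unfolding ck_seminorm_def
  by (auto simp: pv_closed pv_add pv_scale pv_mult pv_star pv_relations B.nrm_nonneg B.nrm_triangle
      B.nrm_smult B.nrm_mult B.nrm_cstar B.nrm_zero)

lemma pv_le: "x \<in> FE \<Longrightarrow> nrm B (pv x) \<le> UE x"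
  by (rule universal_seminorm_upper[OF wf _ pv_seminorm])

private abbreviation (input) "lim_to X b \<equiv> b \<in> carrier B \<and> (\<lambda>n. nrm B (pv (X n) \<ominus>\<^bsub>B\<^esub> b)) \<longlonglongrightarrow> 0"

lemma lim_exists: assumes X: "X \<in> cauchy_seqs E" shows "\<exists>b. lim_to X b"
proof -
  interpret M: Metric_space "carrier B" "norm_dist B" by (rule B.metric)
  note F = CS_F[OF wf X]
  have "M.MCauchy (\<lambda>n. pv (X n))"
    unfolding M.MCauchy_def
  proof (intro conjI allI impI)
    fix \<epsilon> :: real assume "0 < \<epsilon>"
    then obtain N where N: "\<forall>m\<ge>N. \<forall>n\<ge>N. UE (X m - X n) < \<epsilon>" using CS_D[OF wf X] by blast
    have "norm_dist B (pv (X m)) (pv (X n)) < \<epsilon>" if "N \<le> m" "N \<le> n" for m n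
      using pv_le[of "X m - X n"] N that F
      by (simp add: norm_dist_def pv_closed pv_diff) (meson order_le_less_trans)
    then show "\<exists>N. \<forall>n n'. N \<le> n \<longrightarrow> N \<le> n' \<longrightarrow> norm_dist B (pv (X n)) (pv (X n')) < \<epsilon>" by blast
  qed (use F pv_closed in auto)
  then obtain b where "limitin M.mtopology (\<lambda>n. pv (X n)) b sequentially"
    using B.complete M.mcomplete_def by blast
  then have "b \<in> carrier B" "(\<lambda>n. norm_dist B (pv (X n)) b) \<longlonglongrightarrow> 0"
    by (simp_all add: M.limitin_metric_dist_null)
  then show ?thesis using F by (auto simp: norm_dist_def pv_closed)
qed

lemma lim_equiv:
  assumes X: "X \<in> cauchy_seqs E" and Y: "Y \<in> cauchy_class E X" and b: "lim_to X b" shows "lim_to Y b"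
proof
  note Y' = mem_cl_D[OF wf X Y]
  note F = CS_F[OF wf X] CS_F[OF wf Y'(1)]
  show "b \<in> carrier B" using b by simp
  show "(\<lambda>n. nrm B (pv (Y n) \<ominus>\<^bsub>B\<^esub> b)) \<longlonglongrightarrow> 0"
  proof (rule null_sandwich)
    show "(\<lambda>n. UE (Y n - X n) + nrm B (pv (X n) \<ominus>\<^bsub>B\<^esub> b)) \<longlonglongrightarrow> 0"
      using tendsto_add[OF Y'(2)] b by force
    show "nrm B (pv (Y n) \<ominus>\<^bsub>B\<^esub> b) \<le> UE (Y n - X n) + nrm B (pv (X n) \<ominus>\<^bsub>B\<^esub> b)" for n
      using B.nrm_minus_triangle[of "pv (Y n)" "pv (X n)" b] pv_le[of "Y n - X n"] F b
      by (simp add: pv_closed pv_diff)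
  qed (use F b B.nrm_nonneg pv_closed in auto)
qed

lemma lim_unique:
  assumes "X \<in> cauchy_seqs E" "lim_to X b" "lim_to X c" shows "b = c"
  by (rule B.nrm_limit_unique[of "\<lambda>n. pv (X n)"]) (use assms CS_F[OF wf assms(1)] pv_closed in auto)

definition rep_ext :: "(nat \<Rightarrow> ('v, 'e) ncpoly) set \<Rightarrow> 'b" where
  "rep_ext = (\<lambda>a\<in>carrier (graph_cstar E). THE b. \<exists>X\<in>a. lim_to X b)"

lemma rep_ext_eqI: assumes X: "X \<in> cauchy_seqs E" and b: "lim_to X b" shows "rep_ext (cauchy_class E X) = b"
proof -
  have "(THE b. \<exists>X\<in>cauchy_class E X. lim_to X b) = b"
  proof (rule the_equality)
    show "\<exists>X\<in>cauchy_class E X. lim_to X b" using b cl_self[OF wf X] by blast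
    fix c assume "\<exists>X\<in>cauchy_class E X. lim_to X c"
    then obtain Y where Y: "Y \<in> cauchy_class E X" and c: "lim_to Y c" by blast
    show "c = b" using lim_unique[OF mem_cl_D(1)[OF wf X Y] c lim_equiv[OF X Y b]] .
  qed
  then show ?thesis using cl_carrier[OF wf X] by (simp add: rep_ext_def)
qed

lemma rep_ext_lim: "X \<in> cauchy_seqs E \<Longrightarrow> lim_to X (rep_ext (cauchy_class E X))"
  using rep_ext_eqI lim_exists by metis

lemma rep_ext_const: "x \<in> FE \<Longrightarrow> rep_ext (cauchy_class E (\<lambda>n. x)) = pv x"
  by (rule rep_ext_eqI) (auto simp: CS_const[OF wf] pv_closed B.nrm_zero B.r_neg B.minus_eq)

lemma rep_ext_star_hom: "rep_ext \<in> star_hom (graph_cstar E) B"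
proof -
  let ?cl = "cauchy_class E" and ?A = "graph_cstar E"
  have closed: "rep_ext a \<in> carrier B" if "a \<in> carrier ?A" for a
    using that rep_ext_lim by (auto elim!: carrier_cases[OF wf])
  have one: "rep_ext (adj ?A (?cl X)) = adj B (rep_ext (?cl X)) \<and> (\<forall>c. rep_ext (c \<odot>\<^bsub>?A\<^esub> ?cl X) = c \<odot>\<^bsub>B\<^esub> rep_ext (?cl X))
      \<and> nrm B (rep_ext (?cl X)) \<le> nrm ?A (?cl X)" if X: "X \<in> cauchy_seqs E" for X
  proof (intro conjI allI)
    note F = CS_F[OF wf X] and L = rep_ext_lim[OF X]
    have "lim_to (\<lambda>n. pstar (X n)) (adj B (rep_ext (?cl X)))"
      using L F by (simp add: B.adj_closed pv_star B.minus_adj pv_closed B.nrm_adj)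
    from rep_ext_eqI[OF CS_star[OF wf X] this] show "rep_ext (adj ?A (?cl X)) = adj B (rep_ext (?cl X))"
      by (simp add: A_star[OF wf X])
    show "rep_ext (c \<odot>\<^bsub>?A\<^esub> ?cl X) = c \<odot>\<^bsub>B\<^esub> rep_ext (?cl X)" for c
    proof -
      have "lim_to (\<lambda>n. pscale c (X n)) (c \<odot>\<^bsub>B\<^esub> rep_ext (?cl X))"
        using L F tendsto_mult[OF tendsto_const[of "cmod c"] conjunct2[OF L]]
        by (simp add: B.smult_closed pv_scale B.minus_smult pv_closed B.nrm_smult)
      from rep_ext_eqI[OF CS_scale[OF wf X] this] show ?thesis by (simp add: A_scale[OF wf X])
    qed
    have t: "(\<lambda>n. UE (X n) + nrm B (pv (X n) \<ominus>\<^bsub>B\<^esub> rep_ext (?cl X))) \<longlonglongrightarrow> nrm ?A (?cl X) + 0"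
      by (rule tendsto_add[OF A_norm_lim[OF wf X] conjunct2[OF L]])
    have le: "nrm B (rep_ext (?cl X)) \<le> UE (X n) + nrm B (pv (X n) \<ominus>\<^bsub>B\<^esub> rep_ext (?cl X))" for n
    proof -
      have c: "pv (X n) \<in> carrier B" "rep_ext (?cl X) \<in> carrier B" using pv_closed F L by auto
      have z: "x \<ominus>\<^bsub>B\<^esub> \<zero>\<^bsub>B\<^esub> = x" if "x \<in> carrier B" for x
        using that by (simp add: B.minus_eq)
      show ?thesis
        using B.nrm_minus_triangle[of "rep_ext (?cl X)" "pv (X n)" "\<zero>\<^bsub>B\<^esub>"] c z[OF c(1)] z[OF c(2)] pv_le[OF F, of n]
          B.nrm_minus_commute[OF c] by simp
    qed
    have "nrm B (rep_ext (?cl X)) \<le> nrm ?A (?cl X) + 0"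
      by (rule LIMSEQ_le_const[OF t]) (use le in blast)
    then show "nrm B (rep_ext (?cl X)) \<le> nrm ?A (?cl X)" by simp
  qed
  have two: "rep_ext (?cl X \<oplus>\<^bsub>?A\<^esub> ?cl Y) = rep_ext (?cl X) \<oplus>\<^bsub>B\<^esub> rep_ext (?cl Y) \<and>
      rep_ext (?cl X \<otimes>\<^bsub>?A\<^esub> ?cl Y) = rep_ext (?cl X) \<otimes>\<^bsub>B\<^esub> rep_ext (?cl Y)"
    if X: "X \<in> cauchy_seqs E" and Y: "Y \<in> cauchy_seqs E" for X Y
  proof
    note F = CS_F[OF wf X] CS_F[OF wf Y] and L = rep_ext_lim[OF X] rep_ext_lim[OF Y]
    let ?x = "rep_ext (?cl X)" and ?y = "rep_ext (?cl Y)"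
    have c: "pv (X n) \<in> carrier B" "pv (Y n) \<in> carrier B" "?x \<in> carrier B" "?y \<in> carrier B" for n
      using pv_closed F L by auto
    have "lim_to (\<lambda>n. X n + Y n) (?x \<oplus>\<^bsub>B\<^esub> ?y)"
    proof
      show "(\<lambda>n. nrm B (pv (X n + Y n) \<ominus>\<^bsub>B\<^esub> (?x \<oplus>\<^bsub>B\<^esub> ?y))) \<longlonglongrightarrow> 0"
      proof (rule null_sandwich)
        show "(\<lambda>n. nrm B (pv (X n) \<ominus>\<^bsub>B\<^esub> ?x) + nrm B (pv (Y n) \<ominus>\<^bsub>B\<^esub> ?y)) \<longlonglongrightarrow> 0"
          using tendsto_add[OF conjunct2[OF L(1)] conjunct2[OF L(2)]] by simp
        show "nrm B (pv (X n + Y n) \<ominus>\<^bsub>B\<^esub> (?x \<oplus>\<^bsub>B\<^esub> ?y)) \<le> nrm B (pv (X n) \<ominus>\<^bsub>B\<^esub> ?x) + nrm B (pv (Y n) \<ominus>\<^bsub>B\<^esub> ?y)" for n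
          using c F by (simp add: pv_add B.minus_add_minus B.nrm_triangle)
      qed (use c F in \<open>simp add: B.nrm_nonneg pv_closed\<close>)
    qed (use c in simp)
    from rep_ext_eqI[OF CS_add[OF wf X Y] this] show "rep_ext (?cl X \<oplus>\<^bsub>?A\<^esub> ?cl Y) = ?x \<oplus>\<^bsub>B\<^esub> ?y"
      by (simp add: A_add[OF wf X Y])
    obtain C where C: "0 < C" "\<And>n. UE (X n) \<le> C" using CS_bounded[OF wf X] by blast
    have "lim_to (\<lambda>n. X n * Y n) (?x \<otimes>\<^bsub>B\<^esub> ?y)"
    proof
      show "(\<lambda>n. nrm B (pv (X n * Y n) \<ominus>\<^bsub>B\<^esub> (?x \<otimes>\<^bsub>B\<^esub> ?y))) \<longlonglongrightarrow> 0"
      proof (rule null_sandwich)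
        show "(\<lambda>n. C * nrm B (pv (Y n) \<ominus>\<^bsub>B\<^esub> ?y) + nrm B (pv (X n) \<ominus>\<^bsub>B\<^esub> ?x) * nrm B ?y) \<longlonglongrightarrow> 0"
          using tendsto_add[OF tendsto_mult[OF tendsto_const[of C] conjunct2[OF L(2)]]
              tendsto_mult[OF conjunct2[OF L(1)] tendsto_const[of "nrm B ?y"]]] by simp
        show "nrm B (pv (X n * Y n) \<ominus>\<^bsub>B\<^esub> (?x \<otimes>\<^bsub>B\<^esub> ?y)) \<le>
            C * nrm B (pv (Y n) \<ominus>\<^bsub>B\<^esub> ?y) + nrm B (pv (X n) \<ominus>\<^bsub>B\<^esub> ?x) * nrm B ?y" for n
        proof -
          have "nrm B (pv (X n * Y n) \<ominus>\<^bsub>B\<^esub> (?x \<otimes>\<^bsub>B\<^esub> ?y)) \<le>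
              nrm B (pv (X n)) * nrm B (pv (Y n) \<ominus>\<^bsub>B\<^esub> ?y) + nrm B (pv (X n) \<ominus>\<^bsub>B\<^esub> ?x) * nrm B ?y"
            using B.minus_mult_estimate[of "pv (X n)" "pv (Y n)" ?x ?y] c F by (simp add: pv_mult)
          moreover have "nrm B (pv (X n)) \<le> C" using pv_le[OF F(1)] C(2) order_trans by blast
          then have "nrm B (pv (X n)) * nrm B (pv (Y n) \<ominus>\<^bsub>B\<^esub> ?y) \<le> C * nrm B (pv (Y n) \<ominus>\<^bsub>B\<^esub> ?y)"
            by (rule mult_right_mono) (use c B.nrm_nonneg in simp)
          ultimately show ?thesis by simp
        qed
      qed (use c F in \<open>simp add: B.nrm_nonneg pv_closed B.mult_closed\<close>)
    qed (use c in \<open>simp add: B.mult_closed\<close>)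
    from rep_ext_eqI[OF CS_mult[OF wf X Y] this] show "rep_ext (?cl X \<otimes>\<^bsub>?A\<^esub> ?cl Y) = ?x \<otimes>\<^bsub>B\<^esub> ?y"
      by (simp add: A_mult[OF wf X Y])
  qed
  have e: "rep_ext \<in> extensional (carrier ?A)" by (simp add: rep_ext_def)
  have one': "rep_ext (adj ?A a) = adj B (rep_ext a) \<and> (\<forall>c. rep_ext (c \<odot>\<^bsub>?A\<^esub> a) = c \<odot>\<^bsub>B\<^esub> rep_ext a)
      \<and> nrm B (rep_ext a) \<le> nrm ?A a" if "a \<in> carrier ?A" for a
    using that one by (elim carrier_cases[OF wf]) simp
  have two': "rep_ext (a \<oplus>\<^bsub>?A\<^esub> b) = rep_ext a \<oplus>\<^bsub>B\<^esub> rep_ext b \<and>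
      rep_ext (a \<otimes>\<^bsub>?A\<^esub> b) = rep_ext a \<otimes>\<^bsub>B\<^esub> rep_ext b" if "a \<in> carrier ?A" "b \<in> carrier ?A" for a b
    using that two by (elim carrier_cases[OF wf]) simp
  show ?thesis
    unfolding star_hom_def using closed one' two' e by (auto simp: PiE_def)
qed

end

lemma graph_cstar_cuntz_krieger:
  assumes wf: "wf_digraph E"
  shows "cuntz_krieger_family E (graph_cstar E) (cstar_vertex E) (cstar_edge E)"
proof -
  let ?A = "graph_cstar E"
  let ?c = "\<lambda>x. cauchy_class E (\<lambda>n. x)"
  interpret A: cstar_algebra ?A by (rule cstar_algebra_graph_cstar[OF wf])
  note const = CS_const[OF wf]
  have eq: "?c x = ?c y" if "x - y \<in> ck_relations E" "x \<in> free_algebra E" "y \<in> free_algebra E" for x y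
    using U_rel[OF wf that(1)] that by (simp add: cl_eq_iff[OF wf] const)
  have zero: "\<zero>\<^bsub>?A\<^esub> = ?c 0" by (rule A_zero[OF wf])
  have mult: "?c x \<otimes>\<^bsub>?A\<^esub> ?c y = ?c (x * y)" if "x \<in> free_algebra E" "y \<in> free_algebra E" for x y
    by (rule A_mult[OF wf const const]) (use that in auto)
  have star: "adj ?A (?c x) = ?c (pstar x)" if "x \<in> free_algebra E" for x
    by (rule A_star[OF wf const]) (use that in auto)
  have add: "?c x \<oplus>\<^bsub>?A\<^esub> ?c y = ?c (x + y)" if "x \<in> free_algebra E" "y \<in> free_algebra E" for x y
    by (rule A_add[OF wf const const]) (use that in auto)
  have cc: "?c x \<in> carrier ?A" if "x \<in> free_algebra E" for x
    by (rule cl_carrier[OF wf const]) (use that in auto)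
  have sum: "(\<Oplus>\<^bsub>?A\<^esub>i\<in>I. ?c (f i)) = ?c (\<Sum>i\<in>I. f i)"
    if "finite I" "\<And>i. i \<in> I \<Longrightarrow> f i \<in> free_algebra E" for I :: "'b set" and f
    using that
  proof (induction I rule: finite_induct)
    case (insert i I)
    then show ?case by (subst A.finsum_insert) (auto simp: cc add free_algebra_sum)
  qed (simp add: zero)
  have ends: "tail E e \<in> verts E" "head E e \<in> verts E" if "e \<in> arcs E" for e
    using wf that by (auto simp: wf_digraph_def)
  have ve: "adj ?A (?c (edge e)) = ?c (ghost e)" if "e \<in> arcs E" for e using star[of "edge e"] that by simp
  have vv: "?c (vtx v) \<otimes>\<^bsub>?A\<^esub> ?c (vtx w) = ?c (if v = w then vtx v else 0)"
    if "v \<in> verts E" "w \<in> verts E" for v w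
    unfolding mult[OF free_algebra_gens(1)[OF that(1)] free_algebra_gens(1)[OF that(2)]]
    by (rule eq) (use that in \<open>auto simp: ck_relations_def simp del: single_mult mult_single\<close>)
  have ss: "?c (edge e) \<otimes>\<^bsub>?A\<^esub> ?c (ghost e) = ?c (edge e * ghost e)" if "e \<in> arcs E" for e
    by (rule mult) (use that in auto)
  show ?thesis
    unfolding cuntz_krieger_family_def is_projection_def is_partial_isometry_def cstar_vertex_def cstar_edge_def
  proof (intro conjI ballI allI impI)
    fix v assume v: "v \<in> verts E"
    show "?c (vtx v) \<in> carrier ?A" using v by (simp add: cc)
    show "?c (vtx v) \<otimes>\<^bsub>?A\<^esub> ?c (vtx v) = ?c (vtx v)" using vv[OF v v] by simp
    show "adj ?A (?c (vtx v)) = ?c (vtx v)" using star[of "vtx v"] v by simp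
    show "?c (vtx v) \<otimes>\<^bsub>?A\<^esub> ?c (vtx w) = \<zero>\<^bsub>?A\<^esub>" if "w \<in> verts E" "v \<noteq> w" for w
      using vv[OF v that(1)] that by (simp add: zero)
  next
    fix e assume e: "e \<in> arcs E"
    show "?c (edge e) \<in> carrier ?A" using e by (simp add: cc)
    have "?c (edge e * ghost e * edge e) = ?c (edge e)"
      by (rule eq) (use e in \<open>auto simp: ck_relations_def simp del: mult_single\<close>)
    then show "?c (edge e) \<otimes>\<^bsub>?A\<^esub> adj ?A (?c (edge e)) \<otimes>\<^bsub>?A\<^esub> ?c (edge e) = ?c (edge e)"
      using e by (simp add: ve mult)
    have "?c (ghost e * edge e) = ?c (vtx (tail E e))"
      by (rule eq) (use e ends in \<open>auto simp: ck_relations_def simp del: mult_single\<close>)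
    then show "adj ?A (?c (edge e)) \<otimes>\<^bsub>?A\<^esub> ?c (edge e) = ?c (vtx (tail E e))"
      using e by (simp add: ve mult)
    have "?c (vtx (head E e) * (edge e * ghost e)) = ?c (edge e * ghost e)"
      by (rule eq) (use e ends in \<open>auto simp: ck_relations_def simp del: mult_single\<close>)
    then show "?c (vtx (head E e)) \<otimes>\<^bsub>?A\<^esub> (?c (edge e) \<otimes>\<^bsub>?A\<^esub> adj ?A (?c (edge e))) =
        ?c (edge e) \<otimes>\<^bsub>?A\<^esub> adj ?A (?c (edge e))"
      using e ends by (simp add: ve mult)
    fix f assume f: "f \<in> arcs E" "e \<noteq> f"
    have "?c ((edge e * ghost e) * (edge f * ghost f)) = ?c 0"
      by (rule eq) (use e f in \<open>auto simp: ck_relations_def simp del: mult_single\<close>)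
    then show "?c (edge e) \<otimes>\<^bsub>?A\<^esub> adj ?A (?c (edge e)) \<otimes>\<^bsub>?A\<^esub> (?c (edge f) \<otimes>\<^bsub>?A\<^esub> adj ?A (?c (edge f))) = \<zero>\<^bsub>?A\<^esub>"
      using e f by (simp add: ve mult zero)
  next
    fix v assume r: "regular_vertex E v"
    then have v: "v \<in> verts E" "finite (edges_into E v)" by (auto simp: regular_vertex_def)
    have into: "e \<in> arcs E" if "e \<in> edges_into E v" for e using that by (simp add: edges_into_def)
    have "?c (vtx v) = ?c (\<Sum>e\<in>edges_into E v. edge e * ghost e)"
      by (rule eq) (use r v into in \<open>auto simp: ck_relations_def simp del: mult_single intro!: free_algebra_sum\<close>)
    also have "\<dots> = (\<Oplus>\<^bsub>?A\<^esub>e\<in>edges_into E v. ?c (edge e * ghost e))"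
      by (rule sum[symmetric]) (use v into in auto)
    also have "\<dots> = (\<Oplus>\<^bsub>?A\<^esub>e\<in>edges_into E v. ?c (edge e) \<otimes>\<^bsub>?A\<^esub> adj ?A (?c (edge e)))"
      by (rule A.finsum_cong') (auto dest!: into simp: ve ss A.mult_closed cc simp del: mult_single)
    finally show "?c (vtx v) = (\<Oplus>\<^bsub>?A\<^esub>e\<in>edges_into E v. ?c (edge e) \<otimes>\<^bsub>?A\<^esub> adj ?A (?c (edge e)))" .
  qed
qed

lemma star_hom_eqI:
  assumes wf: "wf_digraph E" and B: "cstar_algebra B"
    and \<phi>: "\<phi> \<in> star_hom (graph_cstar E) B" and \<psi>: "\<psi> \<in> star_hom (graph_cstar E) B"
    and v: "\<And>v. v \<in> verts E \<Longrightarrow> \<phi> (cstar_vertex E v) = \<psi> (cstar_vertex E v)"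
    and e: "\<And>e. e \<in> arcs E \<Longrightarrow> \<phi> (cstar_edge E e) = \<psi> (cstar_edge E e)"
  shows "\<phi> = \<psi>"
proof (rule extensionalityI)
  let ?A = "graph_cstar E"
  let ?c = "\<lambda>x. cauchy_class E (\<lambda>n. x)"
  interpret A: cstar_algebra ?A by (rule cstar_algebra_graph_cstar[OF wf])
  interpret B: cstar_algebra B by (rule B)
  note P = star_homD[OF \<phi>] and Q = star_homD[OF \<psi>]
  note const = CS_const[OF wf]
  have cc: "?c x \<in> carrier ?A" if "x \<in> free_algebra E" for x
    by (rule cl_carrier[OF wf const]) (use that in auto)
  have g: "\<phi> (?c (monomial [g])) = \<psi> (?c (monomial [g]))" if "g \<in> generators E" for g
  proof (cases g)
    case (Ghost f)
    then have f: "f \<in> arcs E" using that by (auto simp: generators_def)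
    have "?c (ghost f) = adj ?A (?c (edge f))" using A_star[OF wf const[of "edge f"]] f by simp
    then show ?thesis using P(4)[of "?c (edge f)"] Q(4)[of "?c (edge f)"] e[OF f] cc f Ghost
      by (simp add: cstar_edge_def)
  qed (use that v e in \<open>auto simp: generators_def cstar_vertex_def cstar_edge_def\<close>)
  have w: "set w \<subseteq> generators E \<Longrightarrow> w \<noteq> [] \<Longrightarrow> \<phi> (?c (monomial w)) = \<psi> (?c (monomial w))" for w
  proof (induction w)
    case (Cons g' w)
    show ?case
    proof (cases "w = []")
      case False
      have F: "monomial [g'] \<in> free_algebra E" "monomial w \<in> free_algebra E"
        using Cons False by (auto intro!: free_algebra_single)
      have "?c (monomial (g' # w)) = ?c (monomial [g']) \<otimes>\<^bsub>?A\<^esub> ?c (monomial w)"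
        using A_mult[OF wf const[OF F(1)] const[OF F(2)]] by (simp add: single_mult)
      then show ?thesis using Cons False g[of g'] P(3)[OF cc[OF F(1)] cc[OF F(2)]] Q(3)[OF cc[OF F(1)] cc[OF F(2)]]
        by simp
    qed (use Cons g in simp)
  qed simp
  have dense: "\<phi> (?c x) = \<psi> (?c x)" if "x \<in> free_algebra E" for x
    using that
  proof (induction rule: free_algebra_induct)
    case zero
    have "?c 0 = 0 \<odot>\<^bsub>?A\<^esub> ?c 0" using A_scale[OF wf const[of 0], of 0] by simp
    then show ?case using P(5)[OF cc[of 0], of 0] Q(5)[OF cc[of 0], of 0] P(1)[OF cc[of 0]] Q(1)[OF cc[of 0]]
      by (simp add: B.smult_zero_left)
  next
    case (single w c)
    have F: "monomial w \<in> free_algebra E" using single by (simp add: free_algebra_single)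
    have "?c (Poly_Mapping.single w c) = c \<odot>\<^bsub>?A\<^esub> ?c (monomial w)"
      using A_scale[OF wf const[OF F], of c] by simp
    then show ?case using w[OF single] P(5)[OF cc[OF F]] Q(5)[OF cc[OF F]] by simp
  next
    case (add x y)
    have "?c (x + y) = ?c x \<oplus>\<^bsub>?A\<^esub> ?c y" using A_add[OF wf const const] add by simp
    then show ?case using add P(2)[OF cc cc] Q(2)[OF cc cc] by simp
  qed
  have minus: "\<theta> (a \<ominus>\<^bsub>?A\<^esub> b) = \<theta> a \<ominus>\<^bsub>B\<^esub> \<theta> b"
    if "\<theta> \<in> star_hom ?A B" "a \<in> carrier ?A" "b \<in> carrier ?A" for \<theta> a b
    using star_homD[OF that(1)] that by (simp add: A.minus_conv B.minus_conv A.smult_closed)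
  show "\<phi> \<in> extensional (carrier ?A)" "\<psi> \<in> extensional (carrier ?A)" using P(7) Q(7) .
  fix a assume a: "a \<in> carrier ?A"
  then obtain X where X: "X \<in> cauchy_seqs E" "a = cauchy_class E X" by (rule carrier_cases[OF wf])
  note F = CS_F[OF wf X(1)]
  have conv: "(\<lambda>k. nrm ?A (?c (X k) \<ominus>\<^bsub>?A\<^esub> a)) \<longlonglongrightarrow> 0"
  proof (rule LIMSEQ_I)
    fix \<epsilon> :: real assume \<epsilon>: "0 < \<epsilon>"
    then obtain K where K: "\<And>m n. m \<ge> K \<Longrightarrow> n \<ge> K \<Longrightarrow> universal_seminorm E (X m - X n) < \<epsilon> / 2"
      using CS_D[OF wf X(1), of "\<epsilon> / 2"] by (metis half_gt_zero)
    have "norm (nrm ?A (?c (X k) \<ominus>\<^bsub>?A\<^esub> a) - 0) < \<epsilon>" if "k \<ge> K" for k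
    proof -
      have "norm_dist ?A (?c (X k)) a \<le> \<epsilon> / 2"
        unfolding X(2) by (rule A_dist_le[OF wf const[OF F] X(1), of K]) (use K that in \<open>auto simp: less_imp_le\<close>)
      moreover have "0 \<le> nrm ?A (?c (X k) \<ominus>\<^bsub>?A\<^esub> a)" using a cc F by (intro A.nrm_nonneg) simp
      ultimately show ?thesis using \<epsilon> a cc[OF F, of k] by (simp add: norm_dist_def)
    qed
    then show "\<exists>no. \<forall>k\<ge>no. norm (nrm ?A (?c (X k) \<ominus>\<^bsub>?A\<^esub> a) - 0) < \<epsilon>" by blast
  qed
  have lim: "(\<lambda>k. nrm B (\<theta> (?c (X k)) \<ominus>\<^bsub>B\<^esub> \<theta> a)) \<longlonglongrightarrow> 0" if \<theta>: "\<theta> \<in> star_hom ?A B" for \<theta>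
  proof (rule null_sandwich[OF _ _ conv])
    show "nrm B (\<theta> (?c (X k)) \<ominus>\<^bsub>B\<^esub> \<theta> a) \<le> nrm ?A (?c (X k) \<ominus>\<^bsub>?A\<^esub> a)" for k
      using star_homD(6)[OF \<theta>, of "?c (X k) \<ominus>\<^bsub>?A\<^esub> a"] minus[OF \<theta> cc[OF F] a] a cc[OF F] by simp
    show "0 \<le> nrm B (\<theta> (?c (X k)) \<ominus>\<^bsub>B\<^esub> \<theta> a)" for k
      using star_homD(1)[OF \<theta>] a cc[OF F] by (simp add: B.nrm_nonneg)
  qed
  show "\<phi> a = \<psi> a"
    by (rule B.nrm_limit_unique[of "\<lambda>k. \<phi> (?c (X k))"])
      (use lim[OF \<phi>] lim[OF \<psi>] P(1) Q(1) a cc F dense in auto)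
qed

theorem graph_cstar_universal:
  assumes wf: "wf_digraph E" and B: "cstar_algebra B" and ck: "cuntz_krieger_family E B p s"
  shows "\<exists>!\<phi>. \<phi> \<in> star_hom (graph_cstar E) B \<and>
    (\<forall>v\<in>verts E. \<phi> (cstar_vertex E v) = p v) \<and> (\<forall>e\<in>arcs E. \<phi> (cstar_edge E e) = s e)"
proof (rule ex_ex1I)
  have "rep_ext E B p s (cstar_vertex E v) = p v" if "v \<in> verts E" for v
    using rep_ext_const[OF wf B ck, of "vtx v"] pv_gens(1)[OF wf B ck] that by (simp add: cstar_vertex_def)
  moreover have "rep_ext E B p s (cstar_edge E e) = s e" if "e \<in> arcs E" for e
    using rep_ext_const[OF wf B ck, of "edge e"] pv_gens(2)[OF wf B ck] that by (simp add: cstar_edge_def)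
  ultimately show "\<exists>\<phi>. \<phi> \<in> star_hom (graph_cstar E) B \<and>
    (\<forall>v\<in>verts E. \<phi> (cstar_vertex E v) = p v) \<and> (\<forall>e\<in>arcs E. \<phi> (cstar_edge E e) = s e)"
    using rep_ext_star_hom[OF wf B ck] by blast
qed (use star_hom_eqI[OF wf B] in metis)

lemma star_hom_comp:
  assumes "\<phi> \<in> star_hom A B" "\<psi> \<in> star_hom B C"
    and "\<And>x y. x \<in> carrier A \<Longrightarrow> y \<in> carrier A \<Longrightarrow> x \<oplus>\<^bsub>A\<^esub> y \<in> carrier A \<and> x \<otimes>\<^bsub>A\<^esub> y \<in> carrier A"
    and "\<And>x c. x \<in> carrier A \<Longrightarrow> adj A x \<in> carrier A \<and> c \<odot>\<^bsub>A\<^esub> x \<in> carrier A"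
  shows "compose (carrier A) \<psi> \<phi> \<in> star_hom A C"
proof -
  note P = star_homD[OF assms(1)] and Q = star_homD[OF assms(2)]
  have "nrm C (\<psi> (\<phi> x)) \<le> nrm A x" if "x \<in> carrier A" for x
    using P(1,6)[OF that] Q(6)[of "\<phi> x"] by simp
  then show ?thesis unfolding star_hom_def
    using P Q assms(3,4) by (auto simp: compose_def)
qed

theorem gauge_action_exists:
  assumes wf: "wf_digraph E" and z: "cmod z = 1"
  shows "\<exists>!\<phi>. \<phi> \<in> star_aut (graph_cstar E) \<and>
     (\<forall>e\<in>arcs E. \<phi> (cstar_edge E e) = z \<odot>\<^bsub>graph_cstar E\<^esub> cstar_edge E e) \<and>
     (\<forall>v\<in>verts E. \<phi> (cstar_vertex E v) = cstar_vertex E v)"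
proof -
  let ?A = "graph_cstar E"
  have A: "cstar_algebra ?A" by (rule cstar_algebra_graph_cstar[OF wf])
  interpret A: cstar_algebra ?A by (rule A)
  note ck = graph_cstar_cuntz_krieger[OF wf]
  note D = cuntz_krieger_familyD[OF ck]
  define R where "R z \<phi> \<longleftrightarrow> \<phi> \<in> star_hom ?A ?A \<and> (\<forall>v\<in>verts E. \<phi> (cstar_vertex E v) = cstar_vertex E v) \<and>
     (\<forall>e\<in>arcs E. \<phi> (cstar_edge E e) = z \<odot>\<^bsub>?A\<^esub> cstar_edge E e)" for z \<phi>
  have ex: "\<exists>!\<phi>. R z \<phi>" if "cmod z = 1" for z
    unfolding R_def
    by (rule graph_cstar_universal[OF wf A cuntz_krieger_family_rotate[OF A ck that]])
  have inv: "\<psi> (\<phi> a) = a" if R: "R z \<phi>" "R w \<psi>" and zw: "z * w = 1" and a: "a \<in> carrier ?A" for z w \<phi> \<psi> a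
  proof -
    have h: "\<phi> \<in> star_hom ?A ?A" "\<psi> \<in> star_hom ?A ?A" using R by (auto simp: R_def)
    have id: "restrict id (carrier ?A) \<in> star_hom ?A ?A"
      unfolding star_hom_def
      by (auto simp: A.mult_closed A.smult_closed A.adj_closed)
    have "compose (carrier ?A) \<psi> \<phi> = restrict id (carrier ?A)"
    proof (rule star_hom_eqI[OF wf A _ id])
      show "compose (carrier ?A) \<psi> \<phi> \<in> star_hom ?A ?A"
        by (rule star_hom_comp[OF h]) (auto simp: A.mult_closed A.smult_closed A.adj_closed)
      show "compose (carrier ?A) \<psi> \<phi> (cstar_vertex E v) = restrict id (carrier ?A) (cstar_vertex E v)"
        if "v \<in> verts E" for v using R D(1)[OF that] that by (simp add: R_def compose_def)
      show "compose (carrier ?A) \<psi> \<phi> (cstar_edge E e) = restrict id (carrier ?A) (cstar_edge E e)"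
        if "e \<in> arcs E" for e
        using R D(5)[OF that] that star_homD(5)[OF h(2) D(5)[OF that]] zw
        by (simp add: R_def compose_def A.smult_smult A.smult_one)
    qed
    then have "compose (carrier ?A) \<psi> \<phi> a = restrict id (carrier ?A) a" by simp
    then show ?thesis using a by (simp add: compose_def)
  qed
  have bij: "bij_betw \<phi> (carrier ?A) (carrier ?A)" if R: "R z \<phi>" for \<phi>
  proof -
    have zz: "z * cnj z = 1" "cnj z * z = 1"
      using z by (simp_all add: complex_norm_square[symmetric] mult.commute)
    obtain \<psi> where \<psi>: "R (cnj z) \<psi>" using ex[of "cnj z"] z by auto
    have h: "\<phi> \<in> star_hom ?A ?A" "\<psi> \<in> star_hom ?A ?A" using R \<psi> by (auto simp: R_def)
    show ?thesis
      by (rule bij_betw_byWitness[of _ \<psi>])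
        (use inv[OF R \<psi> zz(1)] inv[OF \<psi> R zz(2)] star_homD(1)[OF h(1)] star_homD(1)[OF h(2)] in auto)
  qed
  have "(\<phi> \<in> star_aut ?A \<and> (\<forall>e\<in>arcs E. \<phi> (cstar_edge E e) = z \<odot>\<^bsub>?A\<^esub> cstar_edge E e) \<and>
     (\<forall>v\<in>verts E. \<phi> (cstar_vertex E v) = cstar_vertex E v)) \<longleftrightarrow> R z \<phi>" for \<phi>
    using bij[of \<phi>] by (auto simp: R_def star_aut_def)
  then show ?thesis using ex[OF z] by simp
qed


corollary gauge_action:
  assumes wf: "wf_digraph E" and z: "cmod z = 1"
  shows "gauge_action E z \<in> star_aut (graph_cstar E)"
    and "e \<in> arcs E \<Longrightarrow> gauge_action E z (cstar_edge E e) = z \<odot>\<^bsub>graph_cstar E\<^esub> cstar_edge E e"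
    and "v \<in> verts E \<Longrightarrow> gauge_action E z (cstar_vertex E v) = cstar_vertex E v"
  using theI'[OF gauge_action_exists[OF wf z]] unfolding gauge_action_def[symmetric] by blast+

context
  fixes E :: "('v, 'e) pre_digraph"
begin

private abbreviation (input) "L \<equiv> leavitt_path_algebra E"
private abbreviation (input) "lc \<equiv> leavitt_class E"
private abbreviation (input) "FL \<equiv> free_algebra E"
private abbreviation (input) "IL \<equiv> leavitt_ideal E"

lemma leavitt_ideal_uminus: "x \<in> IL \<Longrightarrow> - x \<in> IL"
  using leavitt_ideal.scale[of x E "-1"] by (simp add: pscale_minus_one)

lemma leavitt_ideal_diff: "x \<in> IL \<Longrightarrow> y \<in> IL \<Longrightarrow> x - y \<in> IL"
  using leavitt_ideal.add[OF _ leavitt_ideal_uminus, of x y] by simp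

lemma equiv_leavitt_rel: "equiv FL (leavitt_rel E)"
proof (rule equivI)
  show "trans (leavitt_rel E)"
  proof (rule transI)
    fix x y z assume "(x, y) \<in> leavitt_rel E" "(y, z) \<in> leavitt_rel E"
    then show "(x, z) \<in> leavitt_rel E"
      using leavitt_ideal.add[of "x - y" E "y - z"] by (auto simp: leavitt_rel_def)
  qed
  show "sym (leavitt_rel E)"
    by (rule symI) (use leavitt_ideal_uminus in \<open>fastforce simp: leavitt_rel_def\<close>)
qed (auto simp: leavitt_rel_def refl_on_def leavitt_ideal.zero)

lemma lc_eq_iff: "x \<in> FL \<Longrightarrow> y \<in> FL \<Longrightarrow> lc x = lc y \<longleftrightarrow> x - y \<in> IL"
  unfolding leavitt_class_def
  by (subst eq_equiv_class_iff[OF equiv_leavitt_rel]) (auto simp: leavitt_rel_def)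

lemma mem_lc_D: "x \<in> FL \<Longrightarrow> y \<in> lc x \<Longrightarrow> y \<in> FL \<and> y - x \<in> IL"
  using leavitt_ideal_uminus[of "x - y"] by (simp add: leavitt_class_def leavitt_rel_def)

lemma lc_self: "x \<in> FL \<Longrightarrow> x \<in> lc x"
  by (simp add: leavitt_class_def leavitt_rel_def leavitt_ideal.zero)

lemma carrier_L: "a \<in> carrier L \<longleftrightarrow> (\<exists>x\<in>FL. a = lc x)"
  by (auto simp: leavitt_path_algebra_def quotient_def leavitt_class_def)

lemma lc_carrier: "x \<in> FL \<Longrightarrow> lc x \<in> carrier L"
  by (auto simp: carrier_L)

lemma L_zero: "\<zero>\<^bsub>L\<^esub> = lc 0"
  by (simp add: leavitt_path_algebra_def)

lemma L_ops:
  "a \<oplus>\<^bsub>L\<^esub> b = (\<Union>x\<in>a. \<Union>y\<in>b. lc (x + y))"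
  "a \<otimes>\<^bsub>L\<^esub> b = (\<Union>x\<in>a. \<Union>y\<in>b. lc (x * y))"
  "c \<odot>\<^bsub>L\<^esub> a = (\<Union>x\<in>a. lc (pscale c x))"
  by (simp_all add: leavitt_path_algebra_def)

lemma L_add: assumes x: "x \<in> FL" and y: "y \<in> FL" shows "lc x \<oplus>\<^bsub>L\<^esub> lc y = lc (x + y)"
proof -
  have "lc (x' + y') = lc (x + y)" if "x' \<in> lc x" "y' \<in> lc y" for x' y'
  proof -
    have "x' + y' - (x + y) = (x' - x) + (y' - y)" by simp
    then have "x' + y' - (x + y) \<in> IL"
      using mem_lc_D[OF x that(1)] mem_lc_D[OF y that(2)] leavitt_ideal.add by metis
    then show ?thesis using mem_lc_D[OF x that(1)] mem_lc_D[OF y that(2)] x y by (simp add: lc_eq_iff)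
  qed
  note * = this
  show ?thesis unfolding L_ops by (rule UN2_eqI) (use * lc_self[OF x] lc_self[OF y] in blast)+
qed

lemma L_mult: assumes x: "x \<in> FL" and y: "y \<in> FL" shows "lc x \<otimes>\<^bsub>L\<^esub> lc y = lc (x * y)"
proof -
  have "lc (x' * y') = lc (x * y)" if "x' \<in> lc x" "y' \<in> lc y" for x' y'
  proof -
    note M = mem_lc_D[OF x that(1)] mem_lc_D[OF y that(2)]
    have "x' * y' - x * y = x' * (y' - y) + (x' - x) * y" by (simp add: algebra_simps)
    then have "x' * y' - x * y \<in> IL"
      using leavitt_ideal.add[OF leavitt_ideal.mult_left leavitt_ideal.mult_right] M y by metis
    then show ?thesis using M x y by (simp add: lc_eq_iff)
  qed
  note * = this
  show ?thesis unfolding L_ops by (rule UN2_eqI) (use * lc_self[OF x] lc_self[OF y] in blast)+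
qed

lemma L_scale: assumes x: "x \<in> FL" shows "c \<odot>\<^bsub>L\<^esub> lc x = lc (pscale c x)"
proof -
  have "lc (pscale c x') = lc (pscale c x)" if "x' \<in> lc x" for x'
    using mem_lc_D[OF x that] x leavitt_ideal.scale[of "x' - x" E c] by (simp add: lc_eq_iff pscale_diff)
  note * = this
  show ?thesis unfolding L_ops by (rule UN1_eqI) (use * lc_self[OF x] in blast)+
qed

theorem complex_algebra_leavitt: "complex_algebra L"
proof -
  have g: "abelian_group L"
  proof (rule abelian_groupI)
    fix a assume "a \<in> carrier L"
    then obtain x where x: "x \<in> FL" "a = lc x" by (auto simp: carrier_L)
    have "lc (- x) \<oplus>\<^bsub>L\<^esub> a = \<zero>\<^bsub>L\<^esub>" using x by (simp add: L_add L_zero)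
    then show "\<exists>y\<in>carrier L. y \<oplus>\<^bsub>L\<^esub> a = \<zero>\<^bsub>L\<^esub>" using x lc_carrier[of "- x"] by auto
  qed (auto simp: carrier_L L_zero L_add add_ac intro!: lc_carrier)
  show ?thesis
    by (intro complex_algebra.intro nonunital_ring.intro g nonunital_ring_axioms.intro complex_algebra_axioms.intro)
      (auto simp: carrier_L L_add L_mult L_scale mult.assoc distrib_left distrib_right pscale_add
        pscale_add_left pscale_pscale pscale_mult_left pscale_mult_right)
qed

end

end

theory Submission
  imports Defs
begin

text \<open>
  Write \<open>L\<close> for the Leavitt path algebra, \<open>A\<close> for the graph C*-algebra and \<open>\<pi> : L \<rightarrow> A\<close> for the
  canonical map. Both gradings always exist, and both come from the degree on the free algebra that
  counts edges minus ghost edges: \<open>L\<^sub>n\<close> is the image of the polynomials of degree \<open>n\<close>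
  (\<open>leavitt_component_eq\<close>), and these polynomials have dense image in \<open>A\<^sub>n\<close> (\<open>homogeneous_dense\<close>).

  If \<open>L\<close> is strongly graded, then \<open>\<pi>(L\<^sub>m\<^sub>+\<^sub>n) = \<pi>(L\<^sub>m L\<^sub>n)\<close> is contained in the span of \<open>A\<^sub>m A\<^sub>n\<close> and dense
  in \<open>A\<^sub>m\<^sub>+\<^sub>n\<close>, so \<open>A\<close> is strongly graded.

  Conversely, \<open>L\<close> is strongly graded as soon as every vertex lies in \<open>L\<^sub>1 L\<^sub>-\<^sub>1\<close> and in \<open>L\<^sub>-\<^sub>1 L\<^sub>1\<close>
  (\<open>strongly_graded_leavitt_from_vertices\<close>). Density in \<open>A\<close> is
  turned into a combinatorial property of the graph, by means of the representation on
  \<open>\<ell>\<^sup>2\<close> of the boundary paths, that is, of the infinite paths and the finite paths which end in a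
  singular vertex. There a vertex \<open>v\<close> fixes the basis vector at a boundary path \<open>x\<close> with range \<open>v\<close>.
  A polynomial of degree \<open>d\<close> moves this vector into the span of the boundary paths \<open>\<mu>z\<close> where
  \<open>x = \<nu>z\<close> and \<open>|\<mu>| - |\<nu>| = d\<close>. If no such path exists, then every element of the span of
  \<open>A\<^sub>-\<^sub>d A\<^sub>d\<close> has distance at least \<open>1\<close> from \<open>p\<^sub>v\<close>. Hence strong grading of \<open>A\<close> yields such paths for all
  boundary paths \<open>x\<close> and all \<open>d\<close> (\<open>lag_exists\<close>). The cases \<open>d = -1\<close> and \<open>d = 1\<close> give the two required
  factorizations of vertices by purely algebraic arguments (\<open>vertices_factorable\<close>): the first one excludes
  singular vertices, and the second one is applied to an infinite path built from a vertex that is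
  assumed to have no factorization.
\<close>

section \<open>Finite sums in rings and algebras\<close>

text \<open>
  Spans and sums of products are both families of finite sums indexed by \<open>{..<n}\<close>. As additive hulls
  they come with an induction rule.
\<close>
inductive_set additive_hull :: "('a, 'm) ring_scheme \<Rightarrow> 'a set \<Rightarrow> 'a set"
  for R :: "('a, 'm) ring_scheme" and S :: "'a set" where
  hull_zero: "\<zero>\<^bsub>R\<^esub> \<in> additive_hull R S"
| hull_add: "s \<in> S \<Longrightarrow> x \<in> additive_hull R S \<Longrightarrow> s \<oplus>\<^bsub>R\<^esub> x \<in> additive_hull R S"

lemma additive_hull_eq_finsum:
  assumes "abelian_monoid R" and S: "S \<subseteq> carrier R"
  shows "{(\<Oplus>\<^bsub>R\<^esub>i\<in>{..<n}. f i) | (n::nat) f. \<forall>i<n. f i \<in> S} = additive_hull R S"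
proof -
  interpret abelian_monoid R by fact
  have "(\<Oplus>\<^bsub>R\<^esub>i\<in>{..<n}. f i) \<in> additive_hull R S" if "\<forall>i<n. f i \<in> S" for n and f :: "nat \<Rightarrow> 'a"
    using that
  proof (induction n)
    case (Suc n)
    have "(\<Oplus>\<^bsub>R\<^esub>i\<in>{..<Suc n}. f i) = f n \<oplus>\<^bsub>R\<^esub> (\<Oplus>\<^bsub>R\<^esub>i\<in>{..<n}. f i)"
      unfolding lessThan_Suc using Suc.prems S by (subst finsum_insert) auto
    then show ?case using Suc hull_add[of "f n" S] by simp
  qed (simp add: hull_zero)
  moreover have "\<exists>n f. x = (\<Oplus>\<^bsub>R\<^esub>i\<in>{..<n::nat}. f i) \<and> (\<forall>i<n. f i \<in> S)" if "x \<in> additive_hull R S" for x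
    using that
  proof (induction rule: additive_hull.induct)
    case hull_zero
    show ?case by (rule exI[of _ 0]) simp
  next
    case (hull_add s x)
    then obtain n f where x: "x = (\<Oplus>\<^bsub>R\<^esub>i\<in>{..<n::nat}. f i)" and f: "\<And>i. i < n \<Longrightarrow> f i \<in> S" by blast
    have "(\<Oplus>\<^bsub>R\<^esub>i\<in>{..<Suc n}. (f(n := s)) i) = s \<oplus>\<^bsub>R\<^esub> (\<Oplus>\<^bsub>R\<^esub>i\<in>{..<n}. (f(n := s)) i)"
      unfolding lessThan_Suc using f S \<open>s \<in> S\<close> by (subst finsum_insert) auto
    also have "(\<Oplus>\<^bsub>R\<^esub>i\<in>{..<n}. (f(n := s)) i) = x"
      unfolding x using f S by (intro finsum_cong') auto
    finally show ?case
      using f \<open>s \<in> S\<close> by (intro exI[of _ "Suc n"] exI[of _ "f(n := s)"]) auto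
  qed
  ultimately show ?thesis by blast
qed

lemma additive_hull_closed:
  assumes "abelian_monoid R" "S \<subseteq> carrier R" "x \<in> additive_hull R S"
  shows "x \<in> carrier R"
proof -
  interpret abelian_monoid R by fact
  show ?thesis using assms(3) by induction (use assms(2) in auto)
qed

lemma additive_hull_add:
  assumes "abelian_monoid R" "S \<subseteq> carrier R" "x \<in> additive_hull R S" "y \<in> additive_hull R S"
  shows "x \<oplus>\<^bsub>R\<^esub> y \<in> additive_hull R S"
proof -
  interpret abelian_monoid R by fact
  note closed = additive_hull_closed[OF assms(1,2)]
  show ?thesis using assms(3)
  proof induction
    case hull_zero
    then show ?case using assms(4) closed[OF assms(4)] by simp
  next
    case (hull_add s x)
    have "s \<oplus>\<^bsub>R\<^esub> x \<oplus>\<^bsub>R\<^esub> y = s \<oplus>\<^bsub>R\<^esub> (x \<oplus>\<^bsub>R\<^esub> y)"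
      using hull_add(1) assms(2) closed[OF hull_add(2)] closed[OF assms(4)] by (auto intro: a_assoc)
    then show ?case using additive_hull.hull_add[OF hull_add(1,3)] by simp
  qed
qed

lemma additive_hull_base:
  assumes "abelian_monoid R" "S \<subseteq> carrier R" "s \<in> S"
  shows "s \<in> additive_hull R S"
proof -
  interpret abelian_monoid R by fact
  show ?thesis using hull_add[OF assms(3) hull_zero[of R]] assms(2,3) by auto
qed

lemma sums_of_products_eq_hull:
  assumes "nonunital_ring R" "X \<subseteq> carrier R" "Y \<subseteq> carrier R"
  shows "sums_of_products R X Y = additive_hull R {x \<otimes>\<^bsub>R\<^esub> y | x y. x \<in> X \<and> y \<in> Y}"
proof -
  interpret nonunital_ring R by fact
  let ?S = "{x \<otimes>\<^bsub>R\<^esub> y | x y. x \<in> X \<and> y \<in> Y}"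
  have "?S \<subseteq> carrier R" using assms(2,3) mult_closed by auto
  note hull = additive_hull_eq_finsum[OF abelian_monoid_axioms this, symmetric]
  have "\<exists>x y. (\<forall>i<n. x i \<in> X \<and> y i \<in> Y) \<and> (\<Oplus>\<^bsub>R\<^esub>i\<in>{..<n}. f i) = (\<Oplus>\<^bsub>R\<^esub>i\<in>{..<n}. x i \<otimes>\<^bsub>R\<^esub> y i)"
    if "\<forall>i<n. f i \<in> ?S" for n :: nat and f
  proof -
    from that have "\<forall>i. \<exists>x y. i < n \<longrightarrow> x \<in> X \<and> y \<in> Y \<and> f i = x \<otimes>\<^bsub>R\<^esub> y" by blast
    then obtain x y where xy: "\<And>i. i < n \<Longrightarrow> x i \<in> X \<and> y i \<in> Y \<and> f i = x i \<otimes>\<^bsub>R\<^esub> y i" by metis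
    have "(\<Oplus>\<^bsub>R\<^esub>i\<in>{..<n}. f i) = (\<Oplus>\<^bsub>R\<^esub>i\<in>{..<n}. x i \<otimes>\<^bsub>R\<^esub> y i)"
      using xy assms(2,3) by (intro finsum_cong') (auto intro!: mult_closed)
    then show ?thesis using xy by blast
  qed
  note factor = this
  show ?thesis unfolding hull sums_of_products_def
  proof (intro equalityI subsetI)
    fix z assume "z \<in> {(\<Oplus>\<^bsub>R\<^esub>i\<in>{..<n}. x i \<otimes>\<^bsub>R\<^esub> y i) | (n::nat) x y. \<forall>i<n. x i \<in> X \<and> y i \<in> Y}"
    then obtain n :: nat and x y
      where "z = (\<Oplus>\<^bsub>R\<^esub>i\<in>{..<n}. x i \<otimes>\<^bsub>R\<^esub> y i)" "\<forall>i<n. x i \<in> X \<and> y i \<in> Y" by blast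
    then show "z \<in> {(\<Oplus>\<^bsub>R\<^esub>i\<in>{..<n}. f i) | (n::nat) f. \<forall>i<n. f i \<in> ?S}"
      by (intro CollectI exI[of _ n] exI[of _ "\<lambda>i. x i \<otimes>\<^bsub>R\<^esub> y i"]) auto
  next
    fix z assume "z \<in> {(\<Oplus>\<^bsub>R\<^esub>i\<in>{..<n}. f i) | (n::nat) f. \<forall>i<n. f i \<in> ?S}"
    then obtain n :: nat and f where z: "z = (\<Oplus>\<^bsub>R\<^esub>i\<in>{..<n}. f i)" and f: "\<forall>i<n. f i \<in> ?S" by blast
    show "z \<in> {(\<Oplus>\<^bsub>R\<^esub>i\<in>{..<n}. x i \<otimes>\<^bsub>R\<^esub> y i) | (n::nat) x y. \<forall>i<n. x i \<in> X \<and> y i \<in> Y}"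
      unfolding z using factor[OF f] by blast
  qed
qed

lemma cspan_eq_hull:
  assumes "complex_algebra A" "X \<subseteq> carrier A"
  shows "cspan A X = additive_hull A {c \<odot>\<^bsub>A\<^esub> x | c x. x \<in> X}"
proof -
  interpret complex_algebra A by fact
  let ?S = "{c \<odot>\<^bsub>A\<^esub> x | c x. x \<in> X}"
  have "?S \<subseteq> carrier A" using assms(2) smult_closed by auto
  note hull = additive_hull_eq_finsum[OF abelian_monoid_axioms this, symmetric]
  have "\<exists>c x. (\<forall>i<n. x i \<in> X) \<and> (\<Oplus>\<^bsub>A\<^esub>i\<in>{..<n}. f i) = (\<Oplus>\<^bsub>A\<^esub>i\<in>{..<n}. c i \<odot>\<^bsub>A\<^esub> x i)"
    if "\<forall>i<n. f i \<in> ?S" for n :: nat and f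
  proof -
    from that have "\<forall>i. \<exists>c x. i < n \<longrightarrow> x \<in> X \<and> f i = c \<odot>\<^bsub>A\<^esub> x" by blast
    then obtain c x where cx: "\<And>i. i < n \<Longrightarrow> x i \<in> X \<and> f i = c i \<odot>\<^bsub>A\<^esub> x i" by metis
    have "(\<Oplus>\<^bsub>A\<^esub>i\<in>{..<n}. f i) = (\<Oplus>\<^bsub>A\<^esub>i\<in>{..<n}. c i \<odot>\<^bsub>A\<^esub> x i)"
      using cx assms(2) smult_closed by (intro finsum_cong') auto
    then show ?thesis using cx by blast
  qed
  note factor = this
  show ?thesis unfolding hull cspan_def
  proof (intro equalityI subsetI)
    fix z assume "z \<in> {(\<Oplus>\<^bsub>A\<^esub>i\<in>{..<n}. c i \<odot>\<^bsub>A\<^esub> x i) | (n::nat) c x. \<forall>i<n. x i \<in> X}"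
    then obtain n :: nat and c x
      where "z = (\<Oplus>\<^bsub>A\<^esub>i\<in>{..<n}. c i \<odot>\<^bsub>A\<^esub> x i)" "\<forall>i<n. x i \<in> X" by blast
    then show "z \<in> {(\<Oplus>\<^bsub>A\<^esub>i\<in>{..<n}. f i) | (n::nat) f. \<forall>i<n. f i \<in> ?S}"
      by (intro CollectI exI[of _ n] exI[of _ "\<lambda>i. c i \<odot>\<^bsub>A\<^esub> x i"]) auto
  next
    fix z assume "z \<in> {(\<Oplus>\<^bsub>A\<^esub>i\<in>{..<n}. f i) | (n::nat) f. \<forall>i<n. f i \<in> ?S}"
    then obtain n :: nat and f where z: "z = (\<Oplus>\<^bsub>A\<^esub>i\<in>{..<n}. f i)" and f: "\<forall>i<n. f i \<in> ?S" by blast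
    show "z \<in> {(\<Oplus>\<^bsub>A\<^esub>i\<in>{..<n}. c i \<odot>\<^bsub>A\<^esub> x i) | (n::nat) c x. \<forall>i<n. x i \<in> X}"
      unfolding z using factor[OF f] by blast
  qed
qed

lemma additive_subgroup_from_closure:
  assumes "abelian_group R" "H \<subseteq> carrier R" "\<zero>\<^bsub>R\<^esub> \<in> H"
    and add: "\<And>x y. x \<in> H \<Longrightarrow> y \<in> H \<Longrightarrow> x \<oplus>\<^bsub>R\<^esub> y \<in> H" and inv: "\<And>x. x \<in> H \<Longrightarrow> \<ominus>\<^bsub>R\<^esub> x \<in> H"
  shows "additive_subgroup H R"
proof -
  interpret abelian_group R by fact
  show ?thesis
    by (intro additive_subgroupI group.subgroupI[OF a_group])
      (use assms in \<open>auto simp flip: a_inv_def\<close>)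
qed

section \<open>Homogeneous noncommutative polynomials\<close>

fun gen_degree :: "('v, 'e) gen \<Rightarrow> int" where
  "gen_degree (Vtx v) = 0"
| "gen_degree (Edge e) = 1"
| "gen_degree (Ghost e) = -1"

abbreviation word_degree :: "('v, 'e) gen list \<Rightarrow> int" where
  "word_degree w \<equiv> sum_list (map gen_degree w)"

text \<open>
  A polynomial is homogeneous if the number of edges minus the number of ghost edges is the same in all
  its words. The components of both gradings are described by such polynomials: exactly in the Leavitt
  path algebra, up to closure in the graph C*-algebra.
\<close>
definition homogeneous :: "('v, 'e) pre_digraph \<Rightarrow> int \<Rightarrow> ('v, 'e) ncpoly set" where
  "homogeneous E n = {x \<in> free_algebra E. \<forall>w\<in>Poly_Mapping.keys x. word_degree w = n}"

lemma homogeneous_iff: "x \<in> homogeneous E n \<longleftrightarrow>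
    x \<in> free_algebra E \<and> (\<forall>w. Poly_Mapping.lookup x w \<noteq> 0 \<longrightarrow> word_degree w = n)"
  by (auto simp: homogeneous_def in_keys_iff)

lemma homogeneous_free: "x \<in> homogeneous E n \<Longrightarrow> x \<in> free_algebra E"
  by (simp add: homogeneous_def)

lemma homogeneous_0 [simp]: "0 \<in> homogeneous E n"
  by (simp add: homogeneous_iff)

lemma homogeneous_add: "x \<in> homogeneous E n \<Longrightarrow> y \<in> homogeneous E n \<Longrightarrow> x + y \<in> homogeneous E n"
  unfolding homogeneous_iff by (metis free_algebra_add lookup_add add.right_neutral)

lemma homogeneous_scale: "x \<in> homogeneous E n \<Longrightarrow> pscale c x \<in> homogeneous E n"
  by (auto simp: homogeneous_iff lookup_pscale)

lemma homogeneous_diff: "x \<in> homogeneous E n \<Longrightarrow> y \<in> homogeneous E n \<Longrightarrow> x - y \<in> homogeneous E n"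
  using homogeneous_add[of x E n "pscale (-1) y"] homogeneous_scale[of y E n "-1"]
  by (simp add: pscale_minus_one)

lemma homogeneous_sum: "(\<And>i. i \<in> I \<Longrightarrow> f i \<in> homogeneous E n) \<Longrightarrow> sum f I \<in> homogeneous E n"
  by (induction I rule: infinite_finite_induct) (auto intro: homogeneous_add)

lemma homogeneous_mult:
  assumes x: "x \<in> homogeneous E m" and y: "y \<in> homogeneous E n"
  shows "x * y \<in> homogeneous E (m + n)"
  using keys_mult[of x y] x y by (fastforce simp: homogeneous_def plus_list_def)

lemma homogeneous_single:
  "set w \<subseteq> generators E \<Longrightarrow> w \<noteq> [] \<Longrightarrow> word_degree w = n \<Longrightarrow> Poly_Mapping.single w c \<in> homogeneous E n"
  by (auto simp: homogeneous_iff free_algebra_single lookup_single when_def)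

lemma homogeneous_gens:
  "v \<in> verts E \<Longrightarrow> vtx v \<in> homogeneous E 0"
  "e \<in> arcs E \<Longrightarrow> edge e \<in> homogeneous E 1"
  "e \<in> arcs E \<Longrightarrow> ghost e \<in> homogeneous E (-1)"
  by (auto intro!: homogeneous_single simp: generators_def)

lemma homogeneous_induct [consumes 1, case_names zero single add]:
  assumes "x \<in> homogeneous E n"
    and "P 0"
    and single: "\<And>w c. set w \<subseteq> generators E \<Longrightarrow> w \<noteq> [] \<Longrightarrow> word_degree w = n \<Longrightarrow> P (Poly_Mapping.single w c)"
    and add: "\<And>x y. x \<in> homogeneous E n \<Longrightarrow> y \<in> homogeneous E n \<Longrightarrow> P x \<Longrightarrow> P y \<Longrightarrow> P (x + y)"
  shows "P x"
proof -
  let ?f = "\<lambda>w. Poly_Mapping.single w (Poly_Mapping.lookup x w)"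
  have sub: "set w \<subseteq> generators E \<and> w \<noteq> [] \<and> word_degree w = n" if "w \<in> Poly_Mapping.keys x" for w
    using that assms(1) by (auto simp: free_algebra_iff homogeneous_iff in_keys_iff)
  have "sum ?f W \<in> homogeneous E n \<and> P (sum ?f W)" if "finite W" "W \<subseteq> Poly_Mapping.keys x" for W
    using that
  proof (induction W rule: finite_induct)
    case (insert w W)
    then show ?case using sub[of w] by (auto intro!: single add homogeneous_single homogeneous_add)
  qed (use \<open>P 0\<close> in auto)
  then show ?thesis using ncpoly_sum[of x] finite_keys by (metis subset_refl)
qed

definition component :: "int \<Rightarrow> ('v, 'e) ncpoly \<Rightarrow> ('v, 'e) ncpoly" where
  "component n x = Poly_Mapping.mapp (\<lambda>w c. c when word_degree w = n) x"

lemma lookup_component: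
  "Poly_Mapping.lookup (component n x) w = (if word_degree w = n then Poly_Mapping.lookup x w else 0)"
  by (simp add: component_def lookup_mapp when_def in_keys_iff)

lemma component_0 [simp]: "component n 0 = 0"
  by (rule poly_mapping_eqI) (simp add: lookup_component)
lemma component_add: "component n (x + y) = component n x + component n y"
  by (rule poly_mapping_eqI) (simp add: lookup_component lookup_add)
lemma component_diff: "component n (x - y) = component n x - component n y"
  by (rule poly_mapping_eqI) (simp add: lookup_component lookup_minus)
lemma component_scale: "component n (pscale c x) = pscale c (component n x)"
  by (rule poly_mapping_eqI) (simp add: lookup_component lookup_pscale)
lemma component_sum: "component n (sum f I) = (\<Sum>i\<in>I. component n (f i))"
  by (induction I rule: infinite_finite_induct) (auto simp: component_add)
lemma component_homogeneous: "x \<in> free_algebra E \<Longrightarrow> component n x \<in> homogeneous E n"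
  by (auto simp: homogeneous_iff free_algebra_iff lookup_component split: if_splits)
lemma component_of_homogeneous:
  "x \<in> homogeneous E n \<Longrightarrow> component m x = (if m = n then x else 0)"
  by (rule poly_mapping_eqI) (auto simp: lookup_component homogeneous_iff)

lemma component_single:
  "component n (Poly_Mapping.single w c) = (if word_degree w = n then Poly_Mapping.single w c else 0)"
  by (rule poly_mapping_eqI) (auto simp: lookup_component lookup_single when_def)

lemma component_single_mult:
  "component n (Poly_Mapping.single w c * x) = Poly_Mapping.single w c * component (n - word_degree w) x"
  by (induction x rule: ncpoly_induct)
    (auto simp: distrib_left component_add component_single single_mult)

lemma component_mult_single:
  "component n (x * Poly_Mapping.single w c) = component (n - word_degree w) x * Poly_Mapping.single w c"
  by (induction x rule: ncpoly_induct)
    (auto simp: distrib_right component_add component_single single_mult)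

lemma sum_components:
  assumes "finite I" "word_degree ` Poly_Mapping.keys x \<subseteq> I" shows "(\<Sum>n\<in>I. component n x) = x"
  by (rule poly_mapping_eqI) (use assms in \<open>auto simp: lookup_sum lookup_component sum.delta in_keys_iff image_subset_iff\<close>)

section \<open>Homogeneity of the Leavitt ideal\<close>

lemma leavitt_relations_homogeneous:
  assumes wf: "wf_digraph E" and x: "x \<in> leavitt_relations E"
  shows "\<exists>n. x \<in> homogeneous E n"
proof -
  have e: "tail E e \<in> verts E" "head E e \<in> verts E" if "e \<in> arcs E" for e
    using wf that by (auto simp: wf_digraph_def)
  note H = homogeneous_gens homogeneous_diff homogeneous_mult
  have 1: "vtx v * vtx w - (if v = w then vtx v else 0) \<in> homogeneous E 0" if "v \<in> verts E" "w \<in> verts E" for v w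
  proof -
    have "(if v = w then vtx v else 0) \<in> homogeneous E 0" using H(1)[OF that(1)] by auto
    then show ?thesis using H(4)[OF H(5)[OF H(1)[OF that(1)] H(1)[OF that(2)]]] by auto
  qed
  have 2: "vtx (head E f) * edge f - edge f \<in> homogeneous E 1" if "f \<in> arcs E" for f
    using H(4)[OF H(5)[OF H(1)[OF e(2)[OF that]] H(2)[OF that]], of "edge f"] H(2)[OF that] by simp
  have 3: "edge f * vtx (tail E f) - edge f \<in> homogeneous E 1" if "f \<in> arcs E" for f
    using H(4)[OF H(5)[OF H(2)[OF that] H(1)[OF e(1)[OF that]]], of "edge f"] H(2)[OF that] by simp
  have 4: "vtx (tail E f) * ghost f - ghost f \<in> homogeneous E (-1)" if "f \<in> arcs E" for f
    using H(4)[OF H(5)[OF H(1)[OF e(1)[OF that]] H(3)[OF that]], of "ghost f"] H(3)[OF that] by simp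
  have 5: "ghost f * vtx (head E f) - ghost f \<in> homogeneous E (-1)" if "f \<in> arcs E" for f
    using H(4)[OF H(5)[OF H(3)[OF that] H(1)[OF e(2)[OF that]]], of "ghost f"] H(3)[OF that] by simp
  have 6: "ghost f * edge g - (if f = g then vtx (tail E f) else 0) \<in> homogeneous E 0"
    if "f \<in> arcs E" "g \<in> arcs E" for f g
  proof -
    have "(if f = g then vtx (tail E f) else 0) \<in> homogeneous E 0" using H(1)[OF e(1)[OF that(1)]] by auto
    then show ?thesis using H(4)[OF H(5)[OF H(3)[OF that(1)] H(2)[OF that(2)]]] by auto
  qed
  have 7: "vtx v - (\<Sum>f\<in>edges_into E v. edge f * ghost f) \<in> homogeneous E 0" if "regular_vertex E v" for v
  proof (intro homogeneous_diff homogeneous_sum H(1))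
    show "v \<in> verts E" using that by (simp add: regular_vertex_def)
    show "edge f * ghost f \<in> homogeneous E 0" if "f \<in> edges_into E v" for f
      using H(5)[OF H(2,3), of f E f] that by (simp add: edges_into_def)
  qed
  show ?thesis
    using x unfolding leavitt_relations_def Un_iff mem_Collect_eq
    by (elim disjE exE conjE; hypsubst) (blast intro: 1 2 3 4 5 6 7)+
qed

lemma leavitt_relations_free: "wf_digraph E \<Longrightarrow> leavitt_relations E \<subseteq> free_algebra E"
  using leavitt_relations_homogeneous homogeneous_free by blast

lemma leavitt_ideal_free:
  assumes "wf_digraph E" "x \<in> leavitt_ideal E" shows "x \<in> free_algebra E"
  using assms(2) by induction (use leavitt_relations_free[OF assms(1)] in auto)

text \<open>
  The ideal is generated by homogeneous relations. This is what makes the decomposition of an element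
  of the Leavitt path algebra into homogeneous parts unique.
\<close>
lemma component_leavitt_ideal:
  assumes wf: "wf_digraph E" and "x \<in> leavitt_ideal E"
  shows "component n x \<in> leavitt_ideal E"
  using assms(2)
proof (induction arbitrary: n)
  case (relation x)
  then show ?case
    using leavitt_relations_homogeneous[OF wf relation] component_of_homogeneous leavitt_ideal.intros(1,2)
    by (metis (full_types))
next
  case (mult_left x y)
  show ?case using mult_left(2)
  proof (induction rule: free_algebra_induct)
    case (single w c)
    then show ?case
      using leavitt_ideal.mult_left[OF mult_left.IH] free_algebra_single[of w E c] by (simp add: component_single_mult)
  qed (auto simp: distrib_right component_add intro: leavitt_ideal.intros)
next
  case (mult_right x y)
  show ?case using mult_right(2)
  proof (induction rule: free_algebra_induct)
    case (single w c)
    then show ?case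
      using leavitt_ideal.mult_right[OF mult_right.IH] free_algebra_single[of w E c] by (simp add: component_mult_single)
  qed (auto simp: distrib_left component_add intro: leavitt_ideal.intros)
qed (auto simp: component_add component_scale intro: leavitt_ideal.intros)

section \<open>Calculating with words modulo the Leavitt relations\<close>

abbreviation leavitt_eq :: "('v, 'e) pre_digraph \<Rightarrow> ('v, 'e) ncpoly \<Rightarrow> ('v, 'e) ncpoly \<Rightarrow> bool" where
  "leavitt_eq E x y \<equiv> (x, y) \<in> leavitt_rel E"

lemma leavitt_eq_refl: "x \<in> free_algebra E \<Longrightarrow> leavitt_eq E x x"
  by (simp add: leavitt_rel_def leavitt_ideal.zero)

lemma leavitt_eq_sym: "leavitt_eq E x y \<Longrightarrow> leavitt_eq E y x"
  using equiv_leavitt_rel by (meson equivE symD)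

lemma leavitt_eq_trans [trans]: "leavitt_eq E x y \<Longrightarrow> leavitt_eq E y z \<Longrightarrow> leavitt_eq E x z"
  using equiv_leavitt_rel by (meson equivE transD)

lemma leavitt_eq_add: "leavitt_eq E x x' \<Longrightarrow> leavitt_eq E y y' \<Longrightarrow> leavitt_eq E (x + y) (x' + y')"
  using leavitt_ideal.add[of "x - x'" E "y - y'"] by (auto simp: leavitt_rel_def algebra_simps)

lemma leavitt_eq_scale: "leavitt_eq E x x' \<Longrightarrow> leavitt_eq E (pscale c x) (pscale c x')"
  using leavitt_ideal.scale[of "x - x'" E c] by (auto simp: leavitt_rel_def pscale_diff)

lemma leavitt_eq_mult:
  assumes "leavitt_eq E x x'" "leavitt_eq E y y'" shows "leavitt_eq E (x * y) (x' * y')"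
proof -
  have "x * y - x' * y' = x * (y - y') + (x - x') * y'" by (simp add: algebra_simps)
  then show ?thesis
    using assms leavitt_ideal.add[OF leavitt_ideal.mult_left leavitt_ideal.mult_right, of "y - y'" E x "x - x'" y']
    by (simp add: leavitt_rel_def)
qed

lemma leavitt_eq_relation:
  "x - y \<in> leavitt_relations E \<Longrightarrow> x \<in> free_algebra E \<Longrightarrow> y \<in> free_algebra E \<Longrightarrow> leavitt_eq E x y"
  by (simp add: leavitt_rel_def leavitt_ideal.relation)

abbreviation generator_word :: "('v, 'e) pre_digraph \<Rightarrow> ('v, 'e) gen list \<Rightarrow> bool" where
  "generator_word E w \<equiv> set w \<subseteq> generators E \<and> w \<noteq> []"

lemma monomial_append: "monomial (u @ v) = (monomial u * monomial v :: ('v, 'e) ncpoly)"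
  by (simp add: single_mult)

lemma word_eq_append_left:
  assumes "leavitt_eq E (monomial u) (monomial v)" "set a \<subseteq> generators E"
  shows "leavitt_eq E (monomial (a @ u)) (monomial (a @ v))"
proof (cases "a = []")
  case False
  have "leavitt_eq E (monomial a) (monomial a)"
    using assms(2) False by (intro leavitt_eq_refl free_algebra_single) auto
  from leavitt_eq_mult[OF this assms(1)] show ?thesis by (simp only: monomial_append)
qed (use assms in simp)

lemma word_eq_append_right:
  assumes "leavitt_eq E (monomial u) (monomial v)" "set b \<subseteq> generators E"
  shows "leavitt_eq E (monomial (u @ b)) (monomial (v @ b))"
proof (cases "b = []")
  case False
  have "leavitt_eq E (monomial b) (monomial b)"
    using assms(2) False by (intro leavitt_eq_refl free_algebra_single) auto
  from leavitt_eq_mult[OF assms(1) this] show ?thesis by (simp only: monomial_append)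
qed (use assms in simp)

lemma word_zero_append_right:
  assumes "leavitt_eq E (monomial u) 0" "set b \<subseteq> generators E"
  shows "leavitt_eq E (monomial (u @ b)) 0"
proof (cases "b = []")
  case False
  have "leavitt_eq E (monomial b) (monomial b)"
    using assms(2) False by (intro leavitt_eq_refl free_algebra_single) auto
  from leavitt_eq_mult[OF assms(1) this] show ?thesis by (simp only: monomial_append mult_zero_left)
qed (use assms in simp)

text \<open>
  In both algebras a generator \<open>g\<close> is fixed by one vertex on its left and one on its right; they
  make most of the defining relations instances of one rule.
\<close>
fun left_vertex :: "('v, 'e) pre_digraph \<Rightarrow> ('v, 'e) gen \<Rightarrow> 'v" where
  "left_vertex E (Vtx v) = v"
| "left_vertex E (Edge e) = head E e"
| "left_vertex E (Ghost e) = tail E e"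

abbreviation right_vertex :: "('v, 'e) pre_digraph \<Rightarrow> ('v, 'e) gen \<Rightarrow> 'v" where
  "right_vertex E g \<equiv> left_vertex E (gen_star g)"

lemma generator_ends:
  assumes "wf_digraph E" "g \<in> generators E"
  shows "left_vertex E g \<in> verts E" "right_vertex E g \<in> verts E"
  using assms by (auto simp: generators_def wf_digraph_def)

lemma word_pair: "monomial [g, h] = (monomial [g] * monomial [h] :: ('v, 'e) ncpoly)"
  by (simp add: single_mult)

lemma vertex_words:
  assumes "v \<in> verts E" "w \<in> verts E"
  shows "leavitt_eq E (monomial [Vtx v, Vtx w]) (if v = w then vtx v else 0)"
  unfolding word_pair
  by (rule leavitt_eq_relation) (use assms in \<open>auto simp: leavitt_relations_def simp del: mult_single\<close>)

lemma word_left_vertex: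
  assumes "wf_digraph E" "g \<in> generators E"
  shows "leavitt_eq E (monomial [Vtx (left_vertex E g), g]) (monomial [g])"
proof (cases g)
  case (Vtx v)
  then show ?thesis using vertex_words[of v E v] assms by (auto simp: generators_def)
next
  case (Edge e)
  show ?thesis
    unfolding word_pair
    by (rule leavitt_eq_relation)
      (use assms generator_ends[OF assms] Edge in \<open>auto simp: leavitt_relations_def generators_def simp del: mult_single\<close>)
next
  case (Ghost e)
  show ?thesis
    unfolding word_pair
    by (rule leavitt_eq_relation)
      (use assms generator_ends[OF assms] Ghost in \<open>auto simp: leavitt_relations_def generators_def simp del: mult_single\<close>)
qed

lemma word_right_vertex:
  assumes "wf_digraph E" "g \<in> generators E"
  shows "leavitt_eq E (monomial [g, Vtx (right_vertex E g)]) (monomial [g])"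
proof (cases g)
  case (Vtx v)
  then show ?thesis using vertex_words[of v E v] assms by (auto simp: generators_def)
next
  case (Edge e)
  show ?thesis
    unfolding word_pair
    by (rule leavitt_eq_relation)
      (use assms generator_ends[OF assms] Edge in \<open>auto simp: leavitt_relations_def generators_def simp del: mult_single\<close>)
next
  case (Ghost e)
  show ?thesis
    unfolding word_pair
    by (rule leavitt_eq_relation)
      (use assms generator_ends[OF assms] Ghost in \<open>auto simp: leavitt_relations_def generators_def simp del: mult_single\<close>)
qed

lemma ghost_edge_word:
  assumes wf: "wf_digraph E" and "e \<in> arcs E" "f \<in> arcs E"
  shows "leavitt_eq E (monomial [Ghost e, Edge f]) (if e = f then vtx (tail E e) else 0)"
  unfolding word_pair
  by (rule leavitt_eq_relation)
    (use assms generator_ends(1)[OF wf, of "Ghost e"] in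
      \<open>auto simp: leavitt_relations_def generators_def simp del: mult_single\<close>)

text \<open>
  Between two letters one may insert the right vertex of the first and the left vertex of the second,
  and distinct vertices are orthogonal.
\<close>
lemma mismatched_word:
  assumes wf: "wf_digraph E" and g: "g \<in> generators E" and h: "h \<in> generators E"
    and ne: "right_vertex E g \<noteq> left_vertex E h"
  shows "leavitt_eq E (monomial [g, h]) 0"
proof -
  let ?r = "right_vertex E g" and ?l = "left_vertex E h"
  note v = generator_ends[OF wf g] generator_ends[OF wf h]
  have "leavitt_eq E (monomial [g] * monomial [h]) (monomial [g, Vtx ?r] * monomial [Vtx ?l, h])"
    by (rule leavitt_eq_mult) (use word_right_vertex[OF wf g] word_left_vertex[OF wf h] leavitt_eq_sym in blast)+
  also have "monomial [g, Vtx ?r] * monomial [Vtx ?l, h] = monomial [g] * monomial [Vtx ?r, Vtx ?l] * monomial [h]"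
    by (simp add: single_mult)
  also have "leavitt_eq E \<dots> (monomial [g] * 0 * monomial [h])"
    using vertex_words[OF v(2,3)] ne g h
    by (intro leavitt_eq_mult leavitt_eq_refl free_algebra_single) auto
  finally show ?thesis by (simp only: word_pair mult_zero_left mult_zero_right)
qed

lemma leavitt_classI:
  "x - y \<in> leavitt_ideal E \<Longrightarrow> x \<in> free_algebra E \<Longrightarrow> y \<in> free_algebra E \<Longrightarrow> leavitt_class E x = leavitt_class E y"
  by (simp add: lc_eq_iff)

section \<open>Homogeneous components of the Leavitt path algebra\<close>

definition path_monomials :: "('v, 'e) pre_digraph \<Rightarrow> int \<Rightarrow> ('v, 'e) gen list set" where
  "path_monomials E n = {path_word \<alpha> @ ghost_word \<beta> | \<alpha> \<beta>.
      is_path E \<alpha> \<and> is_path E \<beta> \<and> path_source E \<alpha> = path_source E \<beta> \<and>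
      int (path_length \<alpha>) - int (path_length \<beta>) = n}"

lemma is_path_Edges:
  "is_path E (Edges es) \<longleftrightarrow> es \<noteq> [] \<and> set es \<subseteq> arcs E \<and> successively (\<lambda>e f. tail E e = head E f) es"
  by (simp add: successively_conv_nth)

declare is_path.simps(2) [simp del]

lemma path_words:
  assumes "is_path E \<alpha>"
  shows "generator_word E (path_word \<alpha>)" "generator_word E (ghost_word \<alpha>)"
    "word_degree (path_word \<alpha>) = int (path_length \<alpha>)" "word_degree (ghost_word \<alpha>) = - int (path_length \<alpha>)"
  using assms by (cases \<alpha>; auto simp: is_path_Edges generators_def sum_list_triv comp_def)+

lemma path_monomials_D:
  assumes "w \<in> path_monomials E n" shows "generator_word E w" "word_degree w = n"
  using assms path_words by (fastforce simp: path_monomials_def)+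

text \<open>
  Multiplying \<open>\<alpha>\<beta>*\<close> by a generator on the left gives zero or again a monomial of this shape: a
  vertex is absorbed, an edge extends \<open>\<alpha>\<close>, and a ghost edge cancels the first edge of \<open>\<alpha>\<close> or,
  when \<open>\<alpha>\<close> is a vertex, extends \<open>\<beta>\<close>. The product vanishes if the adjacent vertices differ, or if a ghost edge meets a
  different edge.
\<close>
lemma cons_path_monomial:
  assumes wf: "wf_digraph E" and g: "g \<in> generators E" and w: "w \<in> path_monomials E n"
  shows "leavitt_eq E (monomial (g # w)) 0 \<or>
    (\<exists>w'\<in>path_monomials E (gen_degree g + n). leavitt_eq E (monomial (g # w)) (monomial w'))"
proof -
  obtain \<alpha> \<beta> where w': "w = path_word \<alpha> @ ghost_word \<beta>" and p: "is_path E \<alpha>" "is_path E \<beta>"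
    and s: "path_source E \<alpha> = path_source E \<beta>" and n: "int (path_length \<alpha>) - int (path_length \<beta>) = n"
    using w by (auto simp: path_monomials_def)
  note gw = path_monomials_D(1)[OF w]
  obtain h t where ht: "w = h # t" using gw by (cases w) auto
  have gens: "h \<in> generators E" "set t \<subseteq> generators E" using gw ht by auto
  have gfree: "leavitt_eq E (monomial (g # w)) (monomial (g # w))"
    using g gw by (intro leavitt_eq_refl free_algebra_single) auto
  note PI = path_monomials_def[of E, THEN equalityD2, THEN subsetD, OF CollectI]
  show ?thesis
  proof (cases "right_vertex E g = left_vertex E h")
    case False
    then show ?thesis
      using word_zero_append_right[OF mismatched_word[OF wf g gens(1)] gens(2)] ht by simp
  next
    case True
    show ?thesis
    proof (cases g)
      case (Vtx v)
      then have "leavitt_eq E (monomial (g # w)) (monomial w)"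
        using word_eq_append_right[OF word_left_vertex[OF wf gens(1)] gens(2)] True ht by simp
      then show ?thesis using w Vtx by auto
    next
      case (Edge e)
      then have e: "e \<in> arcs E" using g by (auto simp: generators_def)
      show ?thesis
      proof (cases \<alpha>)
        case (Trivial v)
        then have "leavitt_eq E (monomial (g # w)) (monomial (Edge e # ghost_word \<beta>))"
          using word_eq_append_right[OF word_right_vertex[OF wf g], of "ghost_word \<beta>"] True ht w' Edge
            path_words(2)[OF p(2)] by auto
        moreover have "Edge e # ghost_word \<beta> \<in> path_monomials E (gen_degree g + n)"
          by (rule PI, rule exI[of _ "Edges [e]"], rule exI[of _ \<beta>])
            (use e p s n Trivial True Edge w' ht in \<open>auto simp: is_path_Edges\<close>)
        ultimately show ?thesis by blast
      next
        case (Edges es)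
        then have "g # w \<in> path_monomials E (gen_degree g + n)"
          by (intro PI exI[of _ "Edges (e # es)"] exI[of _ \<beta>])
            (use e p s n Edges True Edge w' ht in \<open>cases es; auto simp: is_path_Edges\<close>)
        then show ?thesis using gfree by blast
      qed
    next
      case (Ghost e)
      then have e: "e \<in> arcs E" using g by (auto simp: generators_def)
      have te: "tail E e \<in> verts E" using generator_ends(1)[OF wf g] Ghost by simp
      show ?thesis
      proof (cases \<alpha>)
        case (Trivial v)
        then have v: "v = head E e" using True Ghost w' ht by simp
        have ge: "leavitt_eq E (monomial [Ghost e, Vtx v]) (monomial [Ghost e])"
          using word_right_vertex[OF wf g] v Ghost by simp
        have et: "leavitt_eq E (monomial [Ghost e]) (monomial [Vtx (tail E e), Ghost e])"
          using leavitt_eq_sym[OF word_left_vertex[OF wf g]] Ghost by simp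
        show ?thesis
        proof (cases \<beta>)
          case b: (Trivial u)
          have "leavitt_eq E (monomial [Ghost e, Vtx v, Vtx v]) (monomial [Ghost e, Vtx v])"
            using word_eq_append_right[OF ge, of "[Vtx v]"] p Trivial by (simp add: generators_def)
          moreover have "u = v" using s Trivial b by simp
          ultimately have "leavitt_eq E (monomial (g # w)) (monomial [Vtx (tail E e), Ghost e])"
            using Trivial b Ghost w' ge et leavitt_eq_trans by (metis append_Cons append_Nil path_word.simps(1) ghost_word.simps(1))
          moreover have "[Vtx (tail E e), Ghost e] \<in> path_monomials E (gen_degree g + n)"
            by (rule PI, rule exI[of _ "Trivial (tail E e)"], rule exI[of _ "Edges [e]"])
              (use e te n Ghost Trivial b in \<open>auto simp: is_path_Edges\<close>)
          ultimately show ?thesis by blast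
        next
          case b: (Edges es)
          let ?q = "map Ghost (rev es)"
          have q: "set ?q \<subseteq> generators E" using p b by (auto simp: is_path_Edges generators_def)
          have "leavitt_eq E (monomial (Ghost e # Vtx v # ?q)) (monomial (Ghost e # ?q))"
            using word_eq_append_right[OF ge q] by simp
          also have "leavitt_eq E (monomial (Ghost e # ?q)) (monomial (Vtx (tail E e) # Ghost e # ?q))"
            using word_eq_append_right[OF et q] by simp
          finally have "leavitt_eq E (monomial (g # w)) (monomial (Vtx (tail E e) # Ghost e # ?q))"
            using Trivial b Ghost w' by simp
          moreover have "Vtx (tail E e) # Ghost e # ?q \<in> path_monomials E (gen_degree g + n)"
            by (rule PI, rule exI[of _ "Trivial (tail E e)"], rule exI[of _ "Edges (es @ [e])"])
              (use e te n s p v Ghost Trivial b in \<open>auto simp: is_path_Edges successively_append_iff\<close>)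
          ultimately show ?thesis by blast
        qed
      next
        case (Edges es')
        then obtain f es where es: "es' = f # es" using p by (cases es') (auto simp: is_path_Edges)
        have f: "f \<in> arcs E" using p Edges es by (simp add: is_path_Edges)
        let ?t = "map Edge es @ ghost_word \<beta>"
        have t: "set ?t \<subseteq> generators E"
          using p Edges es path_words(2)[OF p(2)] by (auto simp: is_path_Edges generators_def)
        have gw_eq: "g # w = [Ghost e, Edge f] @ ?t" using Ghost Edges es w' by simp
        show ?thesis
        proof (cases "e = f")
          case False
          then show ?thesis
            using word_zero_append_right[OF _ t, of "[Ghost e, Edge f]"] ghost_edge_word[OF wf e f] gw_eq by simp
        next
          case ef: True
          have 1: "leavitt_eq E (monomial (g # w)) (monomial (Vtx (tail E e) # ?t))"
            using word_eq_append_right[OF _ t, of "[Ghost e, Edge f]" "[Vtx (tail E e)]"]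
              ghost_edge_word[OF wf e f] gw_eq ef by simp
          show ?thesis
          proof (cases es)
            case Nil
            then have "Vtx (tail E e) # ?t \<in> path_monomials E (gen_degree g + n)"
              by (intro PI exI[of _ "Trivial (tail E e)"] exI[of _ \<beta>])
                (use te p s n Ghost Edges es ef in auto)
            then show ?thesis using 1 by blast
          next
            case (Cons f' es'')
            have "leavitt_eq E (monomial [Vtx (tail E e), Edge f']) (monomial [Edge f'])"
              using word_left_vertex[OF wf, of "Edge f'"] p Edges es Cons ef
              by (simp add: is_path_Edges generators_def)
            from word_eq_append_right[OF this, of "map Edge es'' @ ghost_word \<beta>"]
            have 2: "leavitt_eq E (monomial (Vtx (tail E e) # ?t)) (monomial ?t)"
              using t Cons by simp
            have "?t \<in> path_monomials E (gen_degree g + n)"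
              by (rule PI, rule exI[of _ "Edges es"], rule exI[of _ \<beta>])
                (use p s n Ghost Edges es ef Cons in \<open>auto simp: is_path_Edges\<close>)
            then show ?thesis using leavitt_eq_trans[OF 1 2] by blast
          qed
        qed
      qed
    qed
  qed
qed

lemma word_normal_form:
  assumes wf: "wf_digraph E" and "generator_word E w"
  shows "leavitt_eq E (monomial w) 0 \<or> (\<exists>u\<in>path_monomials E (word_degree w). leavitt_eq E (monomial w) (monomial u))"
  using assms(2)
proof (induction w)
  case (Cons g w)
  then have g: "g \<in> generators E" by simp
  show ?case
  proof (cases "w = []")
    case True
    note P = path_monomials_def[of E, THEN equalityD2, THEN subsetD, OF CollectI]
    note lr = generator_ends[OF wf g]
    have "\<exists>u\<in>path_monomials E (gen_degree g). leavitt_eq E (monomial [g]) (monomial u)"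
    proof (cases g)
      case (Vtx v)
      then have "[Vtx v, Vtx v] \<in> path_monomials E (gen_degree g)"
        using lr by (intro P exI[of _ "Trivial v"]) auto
      moreover have "leavitt_eq E (monomial [g]) (monomial [Vtx v, Vtx v])"
        using leavitt_eq_sym[OF vertex_words[of v E v]] lr Vtx by simp
      ultimately show ?thesis by blast
    next
      case (Edge e)
      then have "[Edge e, Vtx (tail E e)] \<in> path_monomials E (gen_degree g)"
        using g lr by (intro P exI[of _ "Edges [e]"] exI[of _ "Trivial (tail E e)"])
          (auto simp: generators_def is_path_Edges)
      then show ?thesis using leavitt_eq_sym[OF word_right_vertex[OF wf g]] Edge by auto
    next
      case (Ghost e)
      then have "[Vtx (tail E e), Ghost e] \<in> path_monomials E (gen_degree g)"
        using g lr by (intro P exI[of _ "Edges [e]"] exI[of _ "Trivial (tail E e)"])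
          (auto simp: generators_def is_path_Edges)
      then show ?thesis using leavitt_eq_sym[OF word_left_vertex[OF wf g]] Ghost by auto
    qed
    then show ?thesis using True by simp
  next
    case False
    have F: "monomial [g] \<in> free_algebra E" using g by (simp add: free_algebra_single)
    have eq: "monomial (g # u) = (monomial [g] * monomial u :: ('a, 'b) ncpoly)" for u
      by (simp add: single_mult)
    from Cons False consider "leavitt_eq E (monomial w) 0"
      | u where "u \<in> path_monomials E (word_degree w)" "leavitt_eq E (monomial w) (monomial u)" by auto
    then show ?thesis
    proof cases
      case 1
      then show ?thesis
        using leavitt_eq_mult[OF leavitt_eq_refl[OF F] 1] unfolding eq[of w] by simp
    next
      case 2
      have "leavitt_eq E (monomial (g # w)) (monomial (g # u))"
        using leavitt_eq_mult[OF leavitt_eq_refl[OF F] 2(2)] unfolding eq[of w] eq[of u] .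
      then show ?thesis using cons_path_monomial[OF wf g 2(1)] leavitt_eq_trans[of "monomial (g # w)" "monomial (g # u)"] by auto
    qed
  qed
qed simp

lemma leavitt_component_hull:
  assumes wf: "wf_digraph E"
  shows "leavitt_component E n = additive_hull (leavitt_path_algebra E)
    {leavitt_class E (Poly_Mapping.single w c) | w c. w \<in> path_monomials E n}"
proof -
  let ?L = "leavitt_path_algebra E"
  let ?G = "{leavitt_class E (monomial (path_word \<alpha>)) \<otimes>\<^bsub>?L\<^esub> leavitt_class E (monomial (ghost_word \<beta>)) | \<alpha> \<beta>.
      is_path E \<alpha> \<and> is_path E \<beta> \<and> path_source E \<alpha> = path_source E \<beta> \<and>
      int (path_length \<alpha>) - int (path_length \<beta>) = n}"
  have 1: "leavitt_class E (monomial (path_word \<alpha>)) \<otimes>\<^bsub>?L\<^esub> leavitt_class E (monomial (ghost_word \<beta>)) =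
      leavitt_class E (monomial (path_word \<alpha> @ ghost_word \<beta>))" if "is_path E \<alpha>" "is_path E \<beta>" for \<alpha> \<beta>
    unfolding monomial_append by (rule L_mult) (use path_words(1)[OF that(1)] path_words(2)[OF that(2)] in \<open>auto intro!: free_algebra_single\<close>)
  have G: "?G = {leavitt_class E (monomial w) | w. w \<in> path_monomials E n}"
  proof (intro equalityI subsetI)
    fix x assume "x \<in> ?G"
    then obtain \<alpha> \<beta> where
      x: "x = leavitt_class E (monomial (path_word \<alpha>)) \<otimes>\<^bsub>?L\<^esub> leavitt_class E (monomial (ghost_word \<beta>))"
      and p: "is_path E \<alpha>" "is_path E \<beta>" "path_source E \<alpha> = path_source E \<beta>"
        "int (path_length \<alpha>) - int (path_length \<beta>) = n" by blast
    then have "path_word \<alpha> @ ghost_word \<beta> \<in> path_monomials E n" unfolding path_monomials_def by blast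
    then show "x \<in> {leavitt_class E (monomial w) | w. w \<in> path_monomials E n}"
      unfolding x 1[OF p(1,2)] by blast
  next
    fix x assume "x \<in> {leavitt_class E (monomial w) | w. w \<in> path_monomials E n}"
    then obtain \<alpha> \<beta> where
      x: "x = leavitt_class E (monomial (path_word \<alpha> @ ghost_word \<beta>))"
      and p: "is_path E \<alpha>" "is_path E \<beta>" "path_source E \<alpha> = path_source E \<beta>"
        "int (path_length \<alpha>) - int (path_length \<beta>) = n" unfolding path_monomials_def by blast
    then show "x \<in> ?G" using 1[OF p(1,2)] by blast
  qed
  have free: "monomial w \<in> free_algebra E" if "w \<in> path_monomials E n" for w
    using path_monomials_D(1)[OF that] by (simp add: free_algebra_single)
  have "{c \<odot>\<^bsub>?L\<^esub> x | c x. x \<in> ?G} = {leavitt_class E (Poly_Mapping.single w c) | w c. w \<in> path_monomials E n}"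
  proof -
    have "c \<odot>\<^bsub>?L\<^esub> leavitt_class E (monomial w) = leavitt_class E (Poly_Mapping.single w c)"
      if "w \<in> path_monomials E n" for w c
      using L_scale[OF free[OF that], of c] by simp
    then show ?thesis unfolding G by (intro equalityI subsetI) (clarsimp, metis)+
  qed
  moreover have "?G \<subseteq> carrier ?L" unfolding G using free by (auto intro: lc_carrier)
  ultimately show ?thesis
    unfolding leavitt_component_def by (simp only: cspan_eq_hull[OF complex_algebra_leavitt])
qed

text \<open>
  The components are defined as spans of the monomials \<open>\<alpha>\<beta>*\<close>. Since every word reduces to such a
  monomial of its own degree, or to zero, all words of degree \<open>n\<close> may be used instead.
\<close>
lemma leavitt_component_eq:
  assumes wf: "wf_digraph E"
  shows "leavitt_component E n = leavitt_class E ` homogeneous E n"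
proof -
  let ?L = "leavitt_path_algebra E"
  let ?S = "{leavitt_class E (Poly_Mapping.single w c) | w c. w \<in> path_monomials E n}"
  interpret L: complex_algebra ?L by (rule complex_algebra_leavitt)
  have single: "Poly_Mapping.single w c \<in> homogeneous E n" if "w \<in> path_monomials E n" for w c
    using path_monomials_D[OF that] by (simp add: homogeneous_single)
  have S: "?S \<subseteq> carrier ?L" using single by (auto intro!: lc_carrier homogeneous_free)
  have "x \<in> leavitt_class E ` homogeneous E n" if "x \<in> additive_hull ?L ?S" for x
    using that
  proof induction
    case hull_zero
    then show ?case by (simp add: L_zero)
  next
    case (hull_add s x)
    then obtain w c y where "w \<in> path_monomials E n" "s = leavitt_class E (Poly_Mapping.single w c)"
      "y \<in> homogeneous E n" "x = leavitt_class E y" by blast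
    then show ?case
      using homogeneous_add[OF single] L_add[OF homogeneous_free[OF single] homogeneous_free] by auto
  qed
  moreover have "leavitt_class E x \<in> additive_hull ?L ?S" if "x \<in> homogeneous E n" for x
    using that
  proof (induction rule: homogeneous_induct)
    case zero
    show ?case using additive_hull.hull_zero[of ?L ?S] by (simp add: L_zero)
  next
    case (single w c)
    have sc: "Poly_Mapping.single u c = pscale c (monomial u)" for u :: "('a, 'b) gen list" by simp
    from word_normal_form[OF wf, of w] single(1,2) consider "leavitt_eq E (monomial w) 0"
      | u where "u \<in> path_monomials E n" "leavitt_eq E (monomial w) (monomial u)" using single(3) by blast
    then show ?case
    proof cases
      case 1
      have "leavitt_eq E (Poly_Mapping.single w c) 0"
        unfolding sc using leavitt_eq_scale[OF 1, of c] by simp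
      then have "leavitt_class E (Poly_Mapping.single w c) = \<zero>\<^bsub>?L\<^esub>"
        unfolding L_zero by (intro leavitt_classI) (auto simp: leavitt_rel_def)
      then show ?thesis by (simp add: additive_hull.hull_zero)
    next
      case 2
      have "leavitt_eq E (Poly_Mapping.single w c) (Poly_Mapping.single u c)"
        unfolding sc by (rule leavitt_eq_scale[OF 2(2)])
      then have "leavitt_class E (Poly_Mapping.single w c) = leavitt_class E (Poly_Mapping.single u c)"
        by (intro leavitt_classI) (auto simp: leavitt_rel_def)
      then show ?thesis using 2(1) additive_hull_base[OF L.abelian_monoid_axioms S] by auto
    qed
  next
    case (add x y)
    then show ?case
      using additive_hull_add[OF L.abelian_monoid_axioms S add(3,4)] L_add[OF add(1,2)[THEN homogeneous_free]] by simp
  qed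
  ultimately show ?thesis unfolding leavitt_component_hull[OF wf] by blast
qed

section \<open>The grading of the Leavitt path algebra\<close>

lemma leavitt_class_uminus:
  assumes "x \<in> free_algebra E"
  shows "\<ominus>\<^bsub>leavitt_path_algebra E\<^esub> leavitt_class E x = leavitt_class E (- x)"
proof -
  interpret L: complex_algebra "leavitt_path_algebra E" by (rule complex_algebra_leavitt)
  show ?thesis
    by (rule L.minus_equality) (use assms L_add[of "- x" E x] in \<open>auto simp: L_zero lc_carrier\<close>)
qed

lemma leavitt_class_sum:
  assumes "finite I" "\<And>i. i \<in> I \<Longrightarrow> f i \<in> free_algebra E"
  shows "(\<Oplus>\<^bsub>leavitt_path_algebra E\<^esub>i\<in>I. leavitt_class E (f i)) = leavitt_class E (\<Sum>i\<in>I. f i)"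
proof -
  interpret L: complex_algebra "leavitt_path_algebra E" by (rule complex_algebra_leavitt)
  show ?thesis using assms
  proof (induction I rule: finite_induct)
    case (insert i I)
    then show ?case
      by (subst L.finsum_insert) (auto simp: lc_carrier L_add free_algebra_sum)
  qed (simp add: L_zero)
qed

text \<open>
  These finite sums represent the elements of \<open>L\<^sub>a L\<^sub>b\<close>, and their images in \<open>C*(E)\<close> are dense in the
  closed span of \<open>A\<^sub>a A\<^sub>b\<close>. They are the link between the two strong gradings.
\<close>
inductive_set products :: "('v, 'e) pre_digraph \<Rightarrow> int \<Rightarrow> int \<Rightarrow> ('v, 'e) ncpoly set"
  for E :: "('v, 'e) pre_digraph" and a b :: int where
  products_0: "0 \<in> products E a b"
| products_step: "x \<in> homogeneous E a \<Longrightarrow> y \<in> homogeneous E b \<Longrightarrow> p \<in> products E a b \<Longrightarrow> x * y + p \<in> products E a b"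

lemma products_homogeneous: "p \<in> products E a b \<Longrightarrow> p \<in> homogeneous E (a + b)"
  by (induction rule: products.induct) (auto intro: homogeneous_add homogeneous_mult)

lemma products_free: "p \<in> products E a b \<Longrightarrow> p \<in> free_algebra E"
  by (rule homogeneous_free[OF products_homogeneous])

lemma products_base: "x \<in> homogeneous E a \<Longrightarrow> y \<in> homogeneous E b \<Longrightarrow> x * y \<in> products E a b"
  using products_step[OF _ _ products_0] by fastforce

lemma products_add: "p \<in> products E a b \<Longrightarrow> q \<in> products E a b \<Longrightarrow> p + q \<in> products E a b"
  by (induction rule: products.induct) (auto simp: add.assoc intro: products_step)

lemma products_mult_left:
  "p \<in> products E a b \<Longrightarrow> x \<in> homogeneous E c \<Longrightarrow> x * p \<in> products E (c + a) b"
proof (induction rule: products.induct)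
  case (products_step y z p)
  have "x * (y * z + p) = (x * y) * z + x * p" by (simp add: algebra_simps)
  then show ?case using products_step by (auto intro: products.products_step homogeneous_mult)
qed (simp add: products_0)

lemma products_mult_right:
  "p \<in> products E a b \<Longrightarrow> x \<in> homogeneous E c \<Longrightarrow> p * x \<in> products E a (b + c)"
proof (induction rule: products.induct)
  case (products_step y z p)
  have "(y * z + p) * x = y * (z * x) + p * x" by (simp add: algebra_simps)
  then show ?case using products_step by (auto intro: products.products_step homogeneous_mult)
qed (simp add: products_0)

lemma sums_of_products_leavitt:
  assumes wf: "wf_digraph E"
  shows "sums_of_products (leavitt_path_algebra E) (leavitt_component E a) (leavitt_component E b) =
    leavitt_class E ` products E a b"
proof -
  let ?L = "leavitt_path_algebra E"
  interpret L: complex_algebra ?L by (rule complex_algebra_leavitt)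
  note C = leavitt_component_eq[OF wf]
  have sub: "leavitt_component E n \<subseteq> carrier ?L" for n
    unfolding C by (auto intro: lc_carrier homogeneous_free)
  let ?S = "{x \<otimes>\<^bsub>?L\<^esub> y | x y. x \<in> leavitt_component E a \<and> y \<in> leavitt_component E b}"
  have hull: "sums_of_products ?L (leavitt_component E a) (leavitt_component E b) = additive_hull ?L ?S"
    by (rule sums_of_products_eq_hull[OF L.nonunital_ring_axioms sub sub])
  have "x \<in> leavitt_class E ` products E a b" if "x \<in> additive_hull ?L ?S" for x
    using that
  proof induction
    case hull_zero
    show ?case by (auto simp: L_zero intro: products_0)
  next
    case (hull_add s x)
    then obtain y z p where yz: "y \<in> homogeneous E a" "z \<in> homogeneous E b" "p \<in> products E a b"
      and "s = leavitt_class E y \<otimes>\<^bsub>?L\<^esub> leavitt_class E z" "x = leavitt_class E p" unfolding C by blast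
    then have "s \<oplus>\<^bsub>?L\<^esub> x = leavitt_class E (y * z + p)"
      using yz(1,2)[THEN homogeneous_free] products_free[OF yz(3)] by (simp add: L_mult L_add)
    then show ?case using products_step[OF yz] by blast
  qed
  moreover have "leavitt_class E p \<in> additive_hull ?L ?S" if "p \<in> products E a b" for p
    using that
  proof induction
    case products_0
    show ?case using hull_zero[of ?L ?S] by (simp add: L_zero)
  next
    case (products_step y z p)
    have "leavitt_class E (y * z + p) = leavitt_class E y \<otimes>\<^bsub>?L\<^esub> leavitt_class E z \<oplus>\<^bsub>?L\<^esub> leavitt_class E p"
      using products_step(1,2)[THEN homogeneous_free] products_free[OF products_step(3)]
      by (simp add: L_mult L_add)
    moreover have "leavitt_class E y \<otimes>\<^bsub>?L\<^esub> leavitt_class E z \<in> ?S" using products_step(1,2) unfolding C by blast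
    ultimately show ?case using products_step(4) by (simp add: hull_add)
  qed
  ultimately show ?thesis unfolding hull by blast
qed

theorem graded_ring_leavitt:
  assumes wf: "wf_digraph E"
  shows "graded_ring (leavitt_path_algebra E) (leavitt_component E)"
proof -
  let ?L = "leavitt_path_algebra E"
  interpret L: complex_algebra ?L by (rule complex_algebra_leavitt)
  note C = leavitt_component_eq[OF wf]
  note hf = homogeneous_free
  have sub: "leavitt_component E n \<subseteq> carrier ?L" for n
    unfolding C by (auto intro: lc_carrier hf)
  have subgroup: "additive_subgroup (leavitt_component E n) ?L" for n
  proof (rule additive_subgroup_from_closure[OF L.abelian_group_axioms sub])
    show "\<zero>\<^bsub>?L\<^esub> \<in> leavitt_component E n" unfolding C by (simp add: L_zero)
    show "x \<oplus>\<^bsub>?L\<^esub> y \<in> leavitt_component E n"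
      if "x \<in> leavitt_component E n" "y \<in> leavitt_component E n" for x y
      using that unfolding C by (auto simp: L_add hf homogeneous_add)
    show "\<ominus>\<^bsub>?L\<^esub> x \<in> leavitt_component E n" if x: "x \<in> leavitt_component E n" for x
    proof -
      obtain y where y: "y \<in> homogeneous E n" "x = leavitt_class E y" using x unfolding C by blast
      have "- y \<in> homogeneous E n" using homogeneous_diff[OF homogeneous_0 y(1)] by simp
      then show ?thesis unfolding y(2) leavitt_class_uminus[OF hf[OF y(1)]] C by blast
    qed
  qed
  have prod: "sums_of_products ?L (leavitt_component E a) (leavitt_component E b) \<subseteq> leavitt_component E (a + b)" for a b
    unfolding sums_of_products_leavitt[OF wf] unfolding C by (auto intro: products_homogeneous)
  have ex: "\<exists>f. (\<forall>n. f n \<in> leavitt_component E n) \<and> finite {n. f n \<noteq> \<zero>\<^bsub>?L\<^esub>} \<and>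
      x = (\<Oplus>\<^bsub>?L\<^esub>n\<in>{n. f n \<noteq> \<zero>\<^bsub>?L\<^esub>}. f n)" if x: "x \<in> carrier ?L" for x
  proof -
    obtain y where y: "y \<in> free_algebra E" "x = leavitt_class E y" using x by (auto simp: carrier_L)
    define f where "f n = leavitt_class E (component n y)" for n
    define I where "I = word_degree ` Poly_Mapping.keys y"
    have I: "finite I" by (simp add: I_def)
    have cf: "component n y \<in> free_algebra E" for n using component_homogeneous[OF y(1)] by (rule hf)
    have "component n y = 0" if "n \<notin> I" for n
      using that by (intro poly_mapping_eqI) (auto simp: lookup_component I_def in_keys_iff)
    then have supp: "{n. f n \<noteq> \<zero>\<^bsub>?L\<^esub>} \<subseteq> I" by (auto simp: f_def L_zero)
    have "(\<Oplus>\<^bsub>?L\<^esub>n\<in>{n. f n \<noteq> \<zero>\<^bsub>?L\<^esub>}. f n) = (\<Oplus>\<^bsub>?L\<^esub>n\<in>I. f n)"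
      using supp I cf by (intro L.add.finprod_mono_neutral_cong_left) (auto simp: f_def lc_carrier)
    also have "\<dots> = x"
      unfolding f_def y(2) using leavitt_class_sum[OF I cf] sum_components[OF I, of y] by (simp add: I_def)
    finally have "x = (\<Oplus>\<^bsub>?L\<^esub>n\<in>{n. f n \<noteq> \<zero>\<^bsub>?L\<^esub>}. f n)" by simp
    moreover have "f n \<in> leavitt_component E n" for n
      unfolding f_def C using component_homogeneous[OF y(1)] by blast
    ultimately show ?thesis using finite_subset[OF supp I] by blast
  qed
  have uniq: "f = g"
    if f: "\<forall>n. f n \<in> leavitt_component E n" "finite {n. f n \<noteq> \<zero>\<^bsub>?L\<^esub>}"
      and g: "\<forall>n. g n \<in> leavitt_component E n" "finite {n. g n \<noteq> \<zero>\<^bsub>?L\<^esub>}"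
      and eq: "(\<Oplus>\<^bsub>?L\<^esub>n\<in>{n. f n \<noteq> \<zero>\<^bsub>?L\<^esub>}. f n) = (\<Oplus>\<^bsub>?L\<^esub>n\<in>{n. g n \<noteq> \<zero>\<^bsub>?L\<^esub>}. g n)" for f g
  proof
    fix n
    define I where "I = {n. f n \<noteq> \<zero>\<^bsub>?L\<^esub>} \<union> {n. g n \<noteq> \<zero>\<^bsub>?L\<^esub>}"
    have I: "finite I" using f g by (simp add: I_def)
    have "\<forall>n. \<exists>y\<in>homogeneous E n. f n = leavitt_class E y" "\<forall>n. \<exists>y\<in>homogeneous E n. g n = leavitt_class E y"
      using f(1) g(1) unfolding C by blast+
    then obtain y z where y: "\<And>n. y n \<in> homogeneous E n" "\<And>n. f n = leavitt_class E (y n)"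
      and z: "\<And>n. z n \<in> homogeneous E n" "\<And>n. g n = leavitt_class E (z n)" by metis
    note yf = hf[OF y(1)] and zf = hf[OF z(1)]
    have "(\<Oplus>\<^bsub>?L\<^esub>n\<in>I. f n) = (\<Oplus>\<^bsub>?L\<^esub>n\<in>{n. f n \<noteq> \<zero>\<^bsub>?L\<^esub>}. f n)"
      using I yf by (intro L.add.finprod_mono_neutral_cong_right) (auto simp: I_def y lc_carrier)
    moreover have "(\<Oplus>\<^bsub>?L\<^esub>n\<in>I. g n) = (\<Oplus>\<^bsub>?L\<^esub>n\<in>{n. g n \<noteq> \<zero>\<^bsub>?L\<^esub>}. g n)"
      using I zf by (intro L.add.finprod_mono_neutral_cong_right) (auto simp: I_def z lc_carrier)
    ultimately have "leavitt_class E (\<Sum>n\<in>I. y n) = leavitt_class E (\<Sum>n\<in>I. z n)"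
      using eq leavitt_class_sum[OF I, of y E] leavitt_class_sum[OF I, of z E] yf zf by (simp add: y z)
    then have "(\<Sum>n\<in>I. y n) - (\<Sum>n\<in>I. z n) \<in> leavitt_ideal E"
      using yf zf by (simp add: lc_eq_iff free_algebra_sum)
    then have *: "component n ((\<Sum>n\<in>I. y n) - (\<Sum>n\<in>I. z n)) \<in> leavitt_ideal E"
      by (rule component_leavitt_ideal[OF wf])
    show "f n = g n"
    proof (cases "n \<in> I")
      case True
      then have "component n ((\<Sum>n\<in>I. y n) - (\<Sum>n\<in>I. z n)) = y n - z n"
        using I by (simp add: component_diff component_sum component_of_homogeneous[OF y(1)]
            component_of_homogeneous[OF z(1)] sum.delta)
      then show ?thesis using * yf zf by (simp add: y z lc_eq_iff)
    qed (auto simp: I_def)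
  qed
  have "\<exists>!f. (\<forall>n. f n \<in> leavitt_component E n) \<and> finite {n. f n \<noteq> \<zero>\<^bsub>?L\<^esub>} \<and>
      x = (\<Oplus>\<^bsub>?L\<^esub>n\<in>{n. f n \<noteq> \<zero>\<^bsub>?L\<^esub>}. f n)" if x: "x \<in> carrier ?L" for x
  proof (rule ex_ex1I[OF ex[OF x]], elim conjE)
    show "f = g" if "\<forall>n. f n \<in> leavitt_component E n" "finite {n. f n \<noteq> \<zero>\<^bsub>?L\<^esub>}"
      "x = (\<Oplus>\<^bsub>?L\<^esub>n\<in>{n. f n \<noteq> \<zero>\<^bsub>?L\<^esub>}. f n)"
      "\<forall>n. g n \<in> leavitt_component E n" "finite {n. g n \<noteq> \<zero>\<^bsub>?L\<^esub>}"
      "x = (\<Oplus>\<^bsub>?L\<^esub>n\<in>{n. g n \<noteq> \<zero>\<^bsub>?L\<^esub>}. g n)" for f g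
      using uniq[of f g] that by simp
  qed
  then show ?thesis
    unfolding graded_ring_def using L.nonunital_ring_axioms subgroup prod by blast
qed

section \<open>Strong grading of the Leavitt path algebra\<close>

text \<open>
  The preimage of \<open>L\<^sub>a L\<^sub>b\<close> in the free algebra.
\<close>
definition factorable :: "('v, 'e) pre_digraph \<Rightarrow> int \<Rightarrow> int \<Rightarrow> ('v, 'e) ncpoly set" where
  "factorable E a b = {x. \<exists>p\<in>products E a b. leavitt_eq E x p}"

lemma strongly_graded_leavitt_iff:
  assumes wf: "wf_digraph E"
  shows "strongly_graded_ring (leavitt_path_algebra E) (leavitt_component E) \<longleftrightarrow>
    (\<forall>a b. homogeneous E (a + b) \<subseteq> factorable E a b)"
proof -
  have "leavitt_component E (a + b) = leavitt_class E ` products E a b \<longleftrightarrow>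
      homogeneous E (a + b) \<subseteq> factorable E a b" for a b
  proof
    assume eq: "leavitt_component E (a + b) = leavitt_class E ` products E a b"
    show "homogeneous E (a + b) \<subseteq> factorable E a b"
    proof
      fix x assume x: "x \<in> homogeneous E (a + b)"
      then obtain p where "p \<in> products E a b" "leavitt_class E x = leavitt_class E p"
        using eq unfolding leavitt_component_eq[OF wf] by blast
      then show "x \<in> factorable E a b"
        using homogeneous_free[OF x] products_free[of p E a b] lc_eq_iff[of x E p]
        by (auto simp: factorable_def leavitt_rel_def)
    qed
  next
    assume sub: "homogeneous E (a + b) \<subseteq> factorable E a b"
    have "leavitt_class E x \<in> leavitt_class E ` products E a b" if x: "x \<in> homogeneous E (a + b)" for x
    proof -
      obtain p where p: "p \<in> products E a b" "leavitt_eq E x p" using sub x by (auto simp: factorable_def)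
      then have "leavitt_class E x = leavitt_class E p" by (auto simp: leavitt_rel_def lc_eq_iff)
      then show ?thesis using p by blast
    qed
    then show "leavitt_component E (a + b) = leavitt_class E ` products E a b"
      unfolding leavitt_component_eq[OF wf] using products_homogeneous by blast
  qed
  then show ?thesis
    unfolding strongly_graded_ring_def sums_of_products_leavitt[OF wf]
    using graded_ring_leavitt[OF wf] by metis
qed

lemma factorable_0: "0 \<in> factorable E a b"
  by (auto simp: factorable_def intro!: bexI[OF _ products_0] leavitt_eq_refl)

lemma factorable_add: "x \<in> factorable E a b \<Longrightarrow> y \<in> factorable E a b \<Longrightarrow> x + y \<in> factorable E a b"
  unfolding factorable_def using products_add leavitt_eq_add by blast

lemma factorable_sum: "(\<And>i. i \<in> I \<Longrightarrow> f i \<in> factorable E a b) \<Longrightarrow> sum f I \<in> factorable E a b"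
  by (induction I rule: infinite_finite_induct) (auto intro: factorable_0 factorable_add)

lemma factorable_cong: "leavitt_eq E x y \<Longrightarrow> y \<in> factorable E a b \<Longrightarrow> x \<in> factorable E a b"
  unfolding factorable_def using leavitt_eq_trans by blast

lemma factorable_mult_left:
  "x \<in> factorable E a b \<Longrightarrow> y \<in> homogeneous E c \<Longrightarrow> y * x \<in> factorable E (c + a) b"
  unfolding factorable_def using products_mult_left leavitt_eq_mult[OF leavitt_eq_refl[OF homogeneous_free]] by blast

lemma factorable_mult_right:
  "x \<in> factorable E a b \<Longrightarrow> y \<in> homogeneous E c \<Longrightarrow> x * y \<in> factorable E a (b + c)"
  unfolding factorable_def using products_mult_right leavitt_eq_mult[OF _ leavitt_eq_refl[OF homogeneous_free]] by blast

lemma factorable_base: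
  assumes "x \<in> homogeneous E a" "y \<in> homogeneous E b" shows "x * y \<in> factorable E a b"
  using products_base[OF assms] leavitt_eq_refl[OF products_free[OF products_base[OF assms]]]
  unfolding factorable_def by blast

text \<open>
  A monomial equals its left vertex times itself, so a factorization of the vertex in degrees \<open>n\<close> and
  \<open>- n\<close> gives one of the monomial: the second factor is multiplied by the monomial.
\<close>
lemma homogeneous_factorable_from_vertices:
  assumes wf: "wf_digraph E" and v: "\<And>v. v \<in> verts E \<Longrightarrow> vtx v \<in> factorable E n (- n)"
  shows "homogeneous E (n + m) \<subseteq> factorable E n m"
proof
  fix x assume "x \<in> homogeneous E (n + m)"
  then show "x \<in> factorable E n m"
  proof (induction rule: homogeneous_induct)
    case (single w c)
    then obtain g t where w: "w = g # t" by (cases w) auto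
    have g: "g \<in> generators E" "set t \<subseteq> generators E" using single w by auto
    let ?v = "left_vertex E g"
    have "leavitt_eq E (pscale c (monomial w)) (pscale c (monomial (Vtx ?v # w)))"
      using leavitt_eq_scale[OF leavitt_eq_sym[OF word_eq_append_right[OF word_left_vertex[OF wf g(1)] g(2)]], of c]
      by (simp add: w)
    moreover have "pscale c (monomial (Vtx ?v # w)) = vtx ?v * Poly_Mapping.single w c"
      by (simp add: single_mult)
    ultimately have eq: "leavitt_eq E (Poly_Mapping.single w c) (vtx ?v * Poly_Mapping.single w c)" by simp
    have "vtx ?v * Poly_Mapping.single w c \<in> factorable E n (- n + (n + m))"
      by (rule factorable_mult_right[OF v homogeneous_single])
        (use generator_ends(1)[OF wf g(1)] single in auto)
    then show ?case using factorable_cong[OF eq] by simp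
  qed (auto intro: factorable_0 factorable_add)
qed

lemma homogeneous_factorable_compose:
  assumes a: "\<And>m. homogeneous E (a + m) \<subseteq> factorable E a m" and b: "\<And>m. homogeneous E (b + m) \<subseteq> factorable E b m"
  shows "homogeneous E (a + b + m) \<subseteq> factorable E (a + b) m"
proof
  fix x assume "x \<in> homogeneous E (a + b + m)"
  then obtain p where p: "p \<in> products E a (b + m)" "leavitt_eq E x p"
    using a[of "b + m"] by (auto simp: factorable_def add.assoc)
  from p(1) have "p \<in> factorable E (a + b) m"
  proof induction
    case (products_step y z p)
    then show ?case using b[of m] by (auto intro!: factorable_add factorable_mult_left)
  qed (rule factorable_0)
  then show "x \<in> factorable E (a + b) m" by (rule factorable_cong[OF p(2)])
qed

text \<open>
  The degrees \<open>a\<close> with \<open>L\<^sub>a\<^sub>+\<^sub>m \<subseteq> L\<^sub>a L\<^sub>m\<close> for all \<open>m\<close> are closed under addition, and the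
  hypotheses put the two generators \<open>1\<close> and \<open>- 1\<close> of the integers among them.
\<close>
theorem strongly_graded_leavitt_from_vertices:
  assumes wf: "wf_digraph E"
    and pos: "\<And>v. v \<in> verts E \<Longrightarrow> vtx v \<in> factorable E 1 (- 1)"
    and neg: "\<And>v. v \<in> verts E \<Longrightarrow> vtx v \<in> factorable E (- 1) 1"
  shows "strongly_graded_ring (leavitt_path_algebra E) (leavitt_component E)"
proof -
  note V = homogeneous_factorable_from_vertices[OF wf]
  have zero: "homogeneous E (0 + m) \<subseteq> factorable E 0 m" for m
  proof (rule V)
    fix v assume v: "v \<in> verts E"
    have "vtx v * vtx v \<in> factorable E 0 (- 0)"
      using factorable_base[OF homogeneous_gens(1)[OF v] homogeneous_gens(1)[OF v]] by simp
    moreover have "leavitt_eq E (vtx v) (vtx v * vtx v)"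
      using leavitt_eq_sym[OF vertex_words[OF v v]] by (simp add: single_mult)
    ultimately show "vtx v \<in> factorable E 0 (- 0)" using factorable_cong by blast
  qed
  have pos': "homogeneous E (1 + m) \<subseteq> factorable E 1 m" for m by (rule V) (rule pos)
  have neg': "homogeneous E (- 1 + m) \<subseteq> factorable E (- 1) m" for m by (rule V) (simp add: neg)
  have "homogeneous E (a + m) \<subseteq> factorable E a m" for a m
  proof (induction a arbitrary: m rule: int_induct[where k = 0])
    case base
    show ?case by (rule zero)
  next
    case (step1 i)
    show ?case by (rule homogeneous_factorable_compose[OF step1(2) pos'])
  next
    case (step2 i)
    show ?case using homogeneous_factorable_compose[OF step2(2) neg', of m] by simp
  qed
  then show ?thesis unfolding strongly_graded_leavitt_iff[OF wf] by blast
qed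

section \<open>Seminorms from partial injections\<close>

text \<open>
  The norm and inner product of \<open>\<ell>\<^sup>2\<close>, restricted to functions of finite support, where the sums
  below are the true ones. The norm of a bounded operator is determined by this dense subspace.
\<close>
definition supp :: "('p \<Rightarrow> complex) \<Rightarrow> 'p set" where
  "supp \<xi> = {a. \<xi> a \<noteq> 0}"

definition vnorm :: "('p \<Rightarrow> complex) \<Rightarrow> real" where
  "vnorm \<xi> = L2_set (\<lambda>a. cmod (\<xi> a)) (supp \<xi>)"

definition vinner :: "('p \<Rightarrow> complex) \<Rightarrow> ('p \<Rightarrow> complex) \<Rightarrow> complex" where
  "vinner \<xi> \<eta> = (\<Sum>a\<in>supp \<xi>. \<xi> a * cnj (\<eta> a))"

lemma vnorm_superset:
  assumes "finite S" "supp \<xi> \<subseteq> S" shows "vnorm \<xi> = L2_set (\<lambda>a. cmod (\<xi> a)) S"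
  unfolding vnorm_def L2_set_def
  by (rule arg_cong[where f = sqrt], rule sum.mono_neutral_left) (use assms in \<open>auto simp: supp_def\<close>)

lemma vinner_superset:
  assumes "finite S" "supp \<xi> \<subseteq> S" shows "vinner \<xi> \<eta> = (\<Sum>a\<in>S. \<xi> a * cnj (\<eta> a))"
  unfolding vinner_def by (rule sum.mono_neutral_left) (use assms in \<open>auto simp: supp_def\<close>)

lemma vnorm_nonneg: "0 \<le> vnorm \<xi>"
  by (simp add: vnorm_def)

lemma vnorm_zero [simp]: "vnorm (\<lambda>a. 0) = 0"
  by (simp add: vnorm_def supp_def)

lemma finite_supp_add: "finite (supp \<xi>) \<Longrightarrow> finite (supp \<eta>) \<Longrightarrow> finite (supp (\<lambda>a. \<xi> a + \<eta> a))"
  by (rule finite_subset[of _ "supp \<xi> \<union> supp \<eta>"]) (auto simp: supp_def)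

lemma finite_supp_scale: "finite (supp \<xi>) \<Longrightarrow> finite (supp (\<lambda>a. c * \<xi> a))"
  by (rule finite_subset[of _ "supp \<xi>"]) (auto simp: supp_def)

lemma vnorm_scale: "vnorm (\<lambda>a. c * \<xi> a) = cmod c * vnorm \<xi>"
proof (cases "c = 0")
  case False
  then have "supp (\<lambda>a. c * \<xi> a) = supp \<xi>" by (auto simp: supp_def)
  then show ?thesis
    unfolding vnorm_def by (simp add: norm_mult L2_set_right_distrib)
qed simp

lemma vnorm_triangle:
  assumes "finite (supp \<xi>)" "finite (supp \<eta>)"
  shows "vnorm (\<lambda>a. \<xi> a + \<eta> a) \<le> vnorm \<xi> + vnorm \<eta>"
proof -
  let ?S = "supp \<xi> \<union> supp \<eta>"
  have "vnorm (\<lambda>a. \<xi> a + \<eta> a) = L2_set (\<lambda>a. cmod (\<xi> a + \<eta> a)) ?S"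
    by (rule vnorm_superset) (use assms in \<open>auto simp: supp_def\<close>)
  also have "\<dots> \<le> L2_set (\<lambda>a. cmod (\<xi> a) + cmod (\<eta> a)) ?S"
    by (rule L2_set_mono) (auto simp: norm_triangle_ineq)
  also have "\<dots> \<le> L2_set (\<lambda>a. cmod (\<xi> a)) ?S + L2_set (\<lambda>a. cmod (\<eta> a)) ?S"
    by (rule L2_set_triangle_ineq)
  also have "\<dots> = vnorm \<xi> + vnorm \<eta>"
    using assms vnorm_superset[of ?S \<xi>] vnorm_superset[of ?S \<eta>] by simp
  finally show ?thesis .
qed

lemma vinner_self: "vinner \<xi> \<xi> = of_real ((vnorm \<xi>)\<^sup>2)"
  unfolding vinner_def vnorm_def L2_set_def
  by (simp add: sum_nonneg flip: complex_norm_square)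

lemma vinner_bound:
  assumes "finite (supp \<xi>)" "finite (supp \<eta>)"
  shows "cmod (vinner \<xi> \<eta>) \<le> vnorm \<xi> * vnorm \<eta>"
proof -
  let ?S = "supp \<xi> \<union> supp \<eta>"
  have "vinner \<xi> \<eta> = (\<Sum>a\<in>?S. \<xi> a * cnj (\<eta> a))" by (rule vinner_superset) (use assms in auto)
  also have "cmod \<dots> \<le> (\<Sum>a\<in>?S. cmod (\<xi> a) * cmod (\<eta> a))"
    by (rule order_trans[OF norm_sum]) (simp add: norm_mult)
  also have "\<dots> \<le> L2_set (\<lambda>a. cmod (\<xi> a)) ?S * L2_set (\<lambda>a. cmod (\<eta> a)) ?S"
    using L2_set_mult_ineq[of "\<lambda>a. cmod (\<xi> a)" "\<lambda>a. cmod (\<eta> a)" ?S] by simp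
  also have "\<dots> = vnorm \<xi> * vnorm \<eta>"
    using assms vnorm_superset[of ?S \<xi>] vnorm_superset[of ?S \<eta>] by simp
  finally show ?thesis .
qed

text \<open>
  Generators act by partial injections of a set, with \<open>gen_star\<close> as inversion. On \<open>\<ell>\<^sup>2\<close> of the set
  they become partial isometries, and an element of the free algebra becomes a bounded operator whose
  norm is a C*-seminorm.
\<close>
locale partial_injections =
  fixes act :: "('v, 'e) gen \<Rightarrow> 'p \<Rightarrow> 'p option"
  assumes act_star: "act g x = Some y \<longleftrightarrow> act (gen_star g) y = Some x"
begin

text \<open>
  The basis vector at \<open>x\<close> is moved to the one at \<open>act g x\<close>. The value at a point is therefore found
  with the inverse partial injection, that of \<open>gen_star g\<close>.
\<close>
definition gen_op :: "('v, 'e) gen \<Rightarrow> ('p \<Rightarrow> complex) \<Rightarrow> 'p \<Rightarrow> complex" where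
  "gen_op g \<xi> = (\<lambda>a. case act (gen_star g) a of None \<Rightarrow> 0 | Some b \<Rightarrow> \<xi> b)"

definition word_op :: "('v, 'e) gen list \<Rightarrow> ('p \<Rightarrow> complex) \<Rightarrow> 'p \<Rightarrow> complex" where
  "word_op w \<xi> = foldr gen_op w \<xi>"

definition poly_op :: "('v, 'e) ncpoly \<Rightarrow> ('p \<Rightarrow> complex) \<Rightarrow> 'p \<Rightarrow> complex" where
  "poly_op x \<xi> = (\<lambda>a. \<Sum>w\<in>Poly_Mapping.keys x. Poly_Mapping.lookup x w * word_op w \<xi> a)"

lemma word_op_simps [simp]:
  "word_op [] \<xi> = \<xi>" "word_op (g # w) \<xi> = gen_op g (word_op w \<xi>)"
  "word_op (u @ w) \<xi> = word_op u (word_op w \<xi>)"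
  by (simp_all add: word_op_def)

lemma gen_op_add: "gen_op g (\<lambda>a. \<xi> a + \<eta> a) = (\<lambda>a. gen_op g \<xi> a + gen_op g \<eta> a)"
  by (auto simp: gen_op_def split: option.split)

lemma gen_op_scale: "gen_op g (\<lambda>a. c * \<xi> a) = (\<lambda>a. c * gen_op g \<xi> a)"
  by (auto simp: gen_op_def split: option.split)

lemma word_op_add: "word_op w (\<lambda>a. \<xi> a + \<eta> a) = (\<lambda>a. word_op w \<xi> a + word_op w \<eta> a)"
  by (induction w) (simp_all add: gen_op_add)

lemma word_op_scale: "word_op w (\<lambda>a. c * \<xi> a) = (\<lambda>a. c * word_op w \<xi> a)"
  by (induction w) (simp_all add: gen_op_scale)

lemma word_op_zero: "word_op w (\<lambda>a. 0) = (\<lambda>a. 0)"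
  using word_op_scale[of w 0 "\<lambda>a. 0"] by simp

lemma poly_op_superset:
  "finite W \<Longrightarrow> Poly_Mapping.keys x \<subseteq> W \<Longrightarrow>
    poly_op x \<xi> = (\<lambda>a. \<Sum>w\<in>W. Poly_Mapping.lookup x w * word_op w \<xi> a)"
  unfolding poly_op_def by (intro ext sum.mono_neutral_left) (auto simp: in_keys_iff)

lemma poly_op_0 [simp]: "poly_op 0 \<xi> = (\<lambda>a. 0)"
  by (simp add: poly_op_def)

lemma poly_op_single [simp]: "poly_op (Poly_Mapping.single w c) \<xi> = (\<lambda>a. c * word_op w \<xi> a)"
  by (cases "c = 0") (simp_all add: poly_op_def)

lemma poly_op_add: "poly_op (x + y) \<xi> = (\<lambda>a. poly_op x \<xi> a + poly_op y \<xi> a)"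
proof -
  let ?W = "Poly_Mapping.keys x \<union> Poly_Mapping.keys y"
  have "Poly_Mapping.keys (x + y) \<subseteq> ?W" by (rule Poly_Mapping.keys_add)
  then show ?thesis
    using poly_op_superset[of ?W "x + y" \<xi>] poly_op_superset[of ?W x \<xi>] poly_op_superset[of ?W y \<xi>]
    by (simp add: lookup_add distrib_right sum.distrib)
qed

lemma poly_op_scale: "poly_op (pscale c x) \<xi> = (\<lambda>a. c * poly_op x \<xi> a)"
  by (induction x rule: ncpoly_induct) (simp_all add: pscale_add poly_op_add distrib_left mult.assoc)

lemma poly_op_diff: "poly_op (x - y) \<xi> = (\<lambda>a. poly_op x \<xi> a - poly_op y \<xi> a)"
  using poly_op_add[of x "pscale (-1) y" \<xi>] poly_op_scale[of "-1" y \<xi>] by (simp add: pscale_minus_one)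

lemma poly_op_sum: "poly_op (sum f I) \<xi> = (\<lambda>a. \<Sum>i\<in>I. poly_op (f i) \<xi> a)"
  by (induction I rule: infinite_finite_induct) (simp_all add: poly_op_add)

lemma poly_op_mult: "poly_op (x * y) \<xi> = poly_op x (poly_op y \<xi>)"
proof (induction x rule: ncpoly_induct)
  case (single w c)
  show ?case
    by (induction y rule: ncpoly_induct)
      (simp_all add: word_op_zero single_mult poly_op_add distrib_left word_op_add word_op_scale mult.assoc
        del: mult_single)
qed (simp_all add: distrib_right poly_op_add)

lemma supp_gen_op: "supp (gen_op g \<xi>) \<subseteq> {a. \<exists>b\<in>supp \<xi>. act g b = Some a}"
proof
  fix a assume "a \<in> supp (gen_op g \<xi>)"
  then obtain b where "act (gen_star g) a = Some b" "\<xi> b \<noteq> 0"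
    by (auto simp: supp_def gen_op_def split: option.splits)
  then show "a \<in> {a. \<exists>b\<in>supp \<xi>. act g b = Some a}"
    using act_star[of g b a] by (auto simp: supp_def)
qed

lemma finite_supp_gen_op:
  assumes "finite (supp \<xi>)" shows "finite (supp (gen_op g \<xi>))"
  by (rule finite_subset[OF _ finite_imageI[OF assms, of "\<lambda>b. the (act g b)"]])
    (use supp_gen_op[of g \<xi>] in force)

lemma finite_supp_word_op: "finite (supp \<xi>) \<Longrightarrow> finite (supp (word_op w \<xi>))"
  by (induction w) (simp_all add: finite_supp_gen_op)

lemma finite_supp_poly_op: "finite (supp \<xi>) \<Longrightarrow> finite (supp (poly_op x \<xi>))"
proof (induction x rule: ncpoly_induct)
  case zero
  then show ?case by (simp add: supp_def)
qed (simp_all add: poly_op_add finite_supp_add finite_supp_scale finite_supp_word_op)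

lemma vnorm_gen_op:
  assumes "finite (supp \<xi>)" shows "vnorm (gen_op g \<xi>) \<le> vnorm \<xi>"
proof -
  let ?S = "supp (gen_op g \<xi>)" and ?f = "\<lambda>a. the (act (gen_star g) a)"
  have f: "act (gen_star g) a = Some (?f a)" "gen_op g \<xi> a = \<xi> (?f a)" if "a \<in> ?S" for a
    using that by (auto simp: supp_def gen_op_def split: option.splits)
  have inj: "inj_on ?f ?S"
  proof (rule inj_onI)
    fix a b assume ab: "a \<in> ?S" "b \<in> ?S" "?f a = ?f b"
    have "act g (?f a) = Some a" "act g (?f b) = Some b"
      by (rule act_star[THEN iffD2], rule f(1), rule ab)+
    moreover have "act g (?f a) = act g (?f b)" by (rule arg_cong[OF ab(3)])
    ultimately have "Some a = Some b" by (simp only:)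
    then show "a = b" by (rule option.inject[THEN iffD1])
  qed
  have "?f ` ?S \<subseteq> supp \<xi>" using f(2) by (auto simp: supp_def)
  then have "(\<Sum>a\<in>?f ` ?S. (cmod (\<xi> a))\<^sup>2) \<le> (\<Sum>a\<in>supp \<xi>. (cmod (\<xi> a))\<^sup>2)"
    using assms by (intro sum_mono2) auto
  then have "(\<Sum>a\<in>?S. (cmod (gen_op g \<xi> a))\<^sup>2) \<le> (\<Sum>a\<in>supp \<xi>. (cmod (\<xi> a))\<^sup>2)"
    using f(2) by (simp add: sum.reindex[OF inj])
  then show ?thesis by (simp add: vnorm_def L2_set_def)
qed

lemma vnorm_word_op: "finite (supp \<xi>) \<Longrightarrow> vnorm (word_op w \<xi>) \<le> vnorm \<xi>"
  by (induction w) (auto intro: order_trans[OF vnorm_gen_op] finite_supp_word_op)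

lemma poly_op_bounded: "\<exists>C. \<forall>\<xi>. finite (supp \<xi>) \<longrightarrow> vnorm (poly_op x \<xi>) \<le> C * vnorm \<xi>"
proof (induction x rule: ncpoly_induct)
  case zero
  show ?case by (rule exI[of _ 0]) simp
next
  case (single w c)
  show ?case
    by (rule exI[of _ "cmod c"]) (auto simp: vnorm_scale intro: mult_left_mono vnorm_word_op)
next
  case (add x y)
  then obtain C D where "\<And>\<xi>. finite (supp \<xi>) \<Longrightarrow> vnorm (poly_op x \<xi>) \<le> C * vnorm \<xi>"
    "\<And>\<xi>. finite (supp \<xi>) \<Longrightarrow> vnorm (poly_op y \<xi>) \<le> D * vnorm \<xi>" by blast
  then have "vnorm (poly_op (x + y) \<xi>) \<le> (C + D) * vnorm \<xi>" if "finite (supp \<xi>)" for \<xi>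
    using vnorm_triangle[OF finite_supp_poly_op[OF that] finite_supp_poly_op[OF that], of x y] that
    unfolding poly_op_add distrib_right by (meson add_mono order_trans)
  then show ?case by blast
qed

lemma vinner_gen_op:
  assumes "finite (supp \<xi>)" "finite (supp \<eta>)"
  shows "vinner (gen_op g \<xi>) \<eta> = vinner \<xi> (gen_op (gen_star g) \<eta>)"
proof -
  let ?S = "{a \<in> supp \<xi>. act g a \<noteq> None}" and ?f = "\<lambda>a. the (act g a)"
  have f: "act g a = Some (?f a)" "act (gen_star g) (?f a) = Some a" if "a \<in> ?S" for a
    using that by (auto dest: act_star[THEN iffD1])
  have inj: "inj_on ?f ?S"
    by (rule inj_onI) (metis f(2) option.inject)
  have "vinner (gen_op g \<xi>) \<eta> = (\<Sum>a\<in>?f ` ?S. gen_op g \<xi> a * cnj (\<eta> a))"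
  proof (rule vinner_superset)
    show "supp (gen_op g \<xi>) \<subseteq> ?f ` ?S" using supp_gen_op[of g \<xi>] by force
  qed (use assms in auto)
  also have "\<dots> = (\<Sum>a\<in>?S. gen_op g \<xi> (?f a) * cnj (\<eta> (?f a)))" by (rule sum.reindex[OF inj, unfolded o_def])
  also have "\<dots> = (\<Sum>a\<in>?S. \<xi> a * cnj (gen_op (gen_star g) \<eta> a))"
    using f(2) by (intro sum.cong) (auto simp: gen_op_def)
  also have "\<dots> = vinner \<xi> (gen_op (gen_star g) \<eta>)"
    unfolding vinner_def by (rule sum.mono_neutral_left) (use assms in \<open>auto simp: gen_op_def\<close>)
  finally show ?thesis .
qed

lemma vinner_word_op:
  "finite (supp \<xi>) \<Longrightarrow> finite (supp \<eta>) \<Longrightarrow> vinner (word_op w \<xi>) \<eta> = vinner \<xi> (word_op (rev (map gen_star w)) \<eta>)"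
  by (induction w arbitrary: \<eta>) (simp_all add: vinner_gen_op finite_supp_word_op finite_supp_gen_op)

lemma vinner_add_left:
  assumes "finite (supp \<xi>)" "finite (supp \<xi>')"
  shows "vinner (\<lambda>a. \<xi> a + \<xi>' a) \<eta> = vinner \<xi> \<eta> + vinner \<xi>' \<eta>"
proof -
  let ?S = "supp \<xi> \<union> supp \<xi>'"
  have "vinner (\<lambda>a. \<xi> a + \<xi>' a) \<eta> = (\<Sum>a\<in>?S. (\<xi> a + \<xi>' a) * cnj (\<eta> a))"
    by (rule vinner_superset) (use assms in \<open>auto simp: supp_def\<close>)
  then show ?thesis
    using assms vinner_superset[of ?S \<xi> \<eta>] vinner_superset[of ?S \<xi>' \<eta>] by (simp add: distrib_right sum.distrib)
qed

lemma vinner_add_right: "vinner \<xi> (\<lambda>a. \<eta> a + \<eta>' a) = vinner \<xi> \<eta> + vinner \<xi> \<eta>'"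
  by (simp add: vinner_def distrib_left sum.distrib)

lemma vinner_scale_left:
  assumes "finite (supp \<xi>)" shows "vinner (\<lambda>a. c * \<xi> a) \<eta> = c * vinner \<xi> \<eta>"
proof -
  have "vinner (\<lambda>a. c * \<xi> a) \<eta> = (\<Sum>a\<in>supp \<xi>. c * \<xi> a * cnj (\<eta> a))"
    by (rule vinner_superset) (use assms in \<open>auto simp: supp_def\<close>)
  then show ?thesis by (simp add: vinner_def sum_distrib_left mult.assoc)
qed

lemma vinner_scale_right: "vinner \<xi> (\<lambda>a. c * \<eta> a) = cnj c * vinner \<xi> \<eta>"
  by (simp add: vinner_def sum_distrib_left algebra_simps)

lemma vinner_poly_op:
  assumes "finite (supp \<xi>)" "finite (supp \<eta>)"
  shows "vinner (poly_op x \<xi>) \<eta> = vinner \<xi> (poly_op (pstar x) \<eta>)"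
proof (induction x rule: ncpoly_induct)
  case zero
  show ?case by (simp add: vinner_def supp_def)
next
  case (single w c)
  show ?case
    using assms by (simp add: pstar_single vinner_scale_left vinner_scale_right vinner_word_op finite_supp_word_op)
next
  case (add x y)
  then show ?case
    using assms by (simp add: pstar_add poly_op_add vinner_add_left vinner_add_right finite_supp_poly_op)
qed

definition opnorm :: "('v, 'e) ncpoly \<Rightarrow> real" where
  "opnorm x = (SUP \<xi>\<in>{\<xi>. finite (supp \<xi>) \<and> vnorm \<xi> \<le> 1}. vnorm (poly_op x \<xi>))"

lemma opnorm_upper:
  assumes "finite (supp \<xi>)" "vnorm \<xi> \<le> 1" shows "vnorm (poly_op x \<xi>) \<le> opnorm x"
  unfolding opnorm_def
proof (rule cSUP_upper)
  obtain C where C: "\<And>\<xi>. finite (supp \<xi>) \<Longrightarrow> vnorm (poly_op x \<xi>) \<le> C * vnorm \<xi>"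
    using poly_op_bounded[of x] by blast
  have "vnorm (poly_op x \<xi>) \<le> \<bar>C\<bar>" if "finite (supp \<xi>)" "vnorm \<xi> \<le> 1" for \<xi>
  proof -
    have "C * vnorm \<xi> \<le> \<bar>C\<bar> * 1"
      using that vnorm_nonneg[of \<xi>] by (intro mult_mono) auto
    then show ?thesis using C[OF that(1)] by simp
  qed
  then show "bdd_above ((\<lambda>\<xi>. vnorm (poly_op x \<xi>)) ` {\<xi>. finite (supp \<xi>) \<and> vnorm \<xi> \<le> 1})"
    by (auto simp: bdd_above_def)
qed (use assms in auto)

lemma opnorm_least:
  assumes "\<And>\<xi>. finite (supp \<xi>) \<Longrightarrow> vnorm \<xi> \<le> 1 \<Longrightarrow> vnorm (poly_op x \<xi>) \<le> C"
  shows "opnorm x \<le> C"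
  unfolding opnorm_def
proof (rule cSUP_least)
  have "(\<lambda>a. 0) \<in> {\<xi> :: 'p \<Rightarrow> complex. finite (supp \<xi>) \<and> vnorm \<xi> \<le> 1}" by (simp add: supp_def)
  then show "{\<xi> :: 'p \<Rightarrow> complex. finite (supp \<xi>) \<and> vnorm \<xi> \<le> 1} \<noteq> {}" by blast
qed (use assms in auto)

lemma opnorm_nonneg: "0 \<le> opnorm x"
  using opnorm_upper[of "\<lambda>a. 0" x] vnorm_nonneg[of "poly_op x (\<lambda>a. 0)"] by (simp add: supp_def)

lemma vnorm_poly_op:
  assumes "finite (supp \<xi>)" shows "vnorm (poly_op x \<xi>) \<le> opnorm x * vnorm \<xi>"
proof (cases "vnorm \<xi> = 0")
  case True
  obtain C where "\<And>\<xi>. finite (supp \<xi>) \<Longrightarrow> vnorm (poly_op x \<xi>) \<le> C * vnorm \<xi>"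
    using poly_op_bounded[of x] by blast
  from this[OF assms] True show ?thesis by simp
next
  case False
  then have pos: "0 < vnorm \<xi>" using vnorm_nonneg[of \<xi>] by simp
  define c :: complex where "c = of_real (1 / vnorm \<xi>)"
  have c: "cmod c = 1 / vnorm \<xi>" using pos by (simp add: c_def norm_divide)
  have "vnorm (poly_op x (\<lambda>a. c * \<xi> a)) \<le> opnorm x"
    by (rule opnorm_upper) (use assms pos in \<open>auto simp: finite_supp_scale vnorm_scale c\<close>)
  moreover have "poly_op x (\<lambda>a. c * \<xi> a) = (\<lambda>a. c * poly_op x \<xi> a)"
    by (auto simp: poly_op_def word_op_scale sum_distrib_left algebra_simps)
  ultimately have "vnorm (poly_op x \<xi>) / vnorm \<xi> \<le> opnorm x"
    using pos by (simp add: vnorm_scale c)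
  then show ?thesis using pos by (simp add: field_simps)
qed

text \<open>
  From \<open>\<parallel>x*\<xi>\<parallel>\<^sup>2 = \<langle>x x*\<xi>, \<xi>\<rangle> \<le> \<parallel>x\<parallel> \<parallel>x*\<xi>\<parallel> \<parallel>\<xi>\<parallel>\<close>.
\<close>
lemma opnorm_star_le: "opnorm (pstar x) \<le> opnorm x"
proof (rule opnorm_least)
  fix \<xi> :: "'p \<Rightarrow> complex" assume \<xi>: "finite (supp \<xi>)" "vnorm \<xi> \<le> 1"
  let ?\<eta> = "poly_op (pstar x) \<xi>"
  have \<eta>: "finite (supp ?\<eta>)" by (rule finite_supp_poly_op[OF \<xi>(1)])
  have "(vnorm ?\<eta>)\<^sup>2 = cmod (vinner ?\<eta> ?\<eta>)" by (simp add: vinner_self norm_power)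
  also have "\<dots> = cmod (vinner (poly_op x ?\<eta>) \<xi>)" by (simp add: vinner_poly_op[OF \<eta> \<xi>(1)])
  also have "\<dots> \<le> vnorm (poly_op x ?\<eta>) * vnorm \<xi>" by (rule vinner_bound[OF finite_supp_poly_op[OF \<eta>] \<xi>(1)])
  also have "\<dots> \<le> (opnorm x * vnorm ?\<eta>) * 1"
    using \<xi> vnorm_poly_op[OF \<eta>] vnorm_nonneg opnorm_nonneg by (intro mult_mono) auto
  finally have "vnorm ?\<eta> * vnorm ?\<eta> \<le> opnorm x * vnorm ?\<eta>" by (simp add: power2_eq_square)
  then show "vnorm ?\<eta> \<le> opnorm x"
    using vnorm_nonneg[of ?\<eta>] opnorm_nonneg[of x] by (cases "vnorm ?\<eta> = 0") auto
qed

text \<open>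
  The C*-identity rests on \<open>\<parallel>x\<xi>\<parallel>\<^sup>2 = \<langle>x*x\<xi>, \<xi>\<rangle>\<close>; apart from the relations, which enter as
  an assumption, the other properties hold for every operator norm.
\<close>
lemma opnorm_ck_seminorm:
  assumes rel: "\<And>x \<xi>. x \<in> ck_relations E \<Longrightarrow> poly_op x \<xi> = (\<lambda>a. 0)"
  shows "ck_seminorm E opnorm"
proof -
  have add: "opnorm (x + y) \<le> opnorm x + opnorm y" for x y
  proof (rule opnorm_least)
    fix \<xi> :: "'p \<Rightarrow> complex" assume \<xi>: "finite (supp \<xi>)" "vnorm \<xi> \<le> 1"
    show "vnorm (poly_op (x + y) \<xi>) \<le> opnorm x + opnorm y"
      using vnorm_triangle[OF finite_supp_poly_op[OF \<xi>(1)] finite_supp_poly_op[OF \<xi>(1)], of x y]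
        opnorm_upper[OF \<xi>, of x] opnorm_upper[OF \<xi>, of y] by (simp add: poly_op_add)
  qed
  have le: "opnorm (pscale c x) \<le> cmod c * opnorm x" for c x
    by (rule opnorm_least) (simp add: poly_op_scale vnorm_scale mult_left_mono opnorm_upper)
  have scale: "opnorm (pscale c x) = cmod c * opnorm x" for c x
  proof (cases "c = 0")
    case False
    have "opnorm x \<le> cmod (1 / c) * opnorm (pscale c x)"
      using le[of "1 / c" "pscale c x"] False by (simp add: pscale_pscale)
    then have "cmod c * opnorm x \<le> opnorm (pscale c x)" using False by (simp add: norm_divide field_simps)
    then show ?thesis using le[of c x] by simp
  next
    case True
    then show ?thesis using le[of 0 x] opnorm_nonneg[of 0] by simp
  qed
  have mult: "opnorm (x * y) \<le> opnorm x * opnorm y" for x y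
  proof (rule opnorm_least)
    fix \<xi> :: "'p \<Rightarrow> complex" assume \<xi>: "finite (supp \<xi>)" "vnorm \<xi> \<le> 1"
    have "vnorm (poly_op (x * y) \<xi>) \<le> opnorm x * vnorm (poly_op y \<xi>)"
      unfolding poly_op_mult by (rule vnorm_poly_op[OF finite_supp_poly_op[OF \<xi>(1)]])
    also have "\<dots> \<le> opnorm x * opnorm y"
      by (intro mult_left_mono opnorm_upper opnorm_nonneg \<xi>)
    finally show "vnorm (poly_op (x * y) \<xi>) \<le> opnorm x * opnorm y" .
  qed
  have star: "opnorm (pstar x * x) = (opnorm x)\<^sup>2" for x
  proof (rule antisym)
    have "opnorm (pstar x * x) \<le> opnorm (pstar x) * opnorm x" by (rule mult)
    also have "\<dots> \<le> opnorm x * opnorm x" by (intro mult_right_mono opnorm_star_le opnorm_nonneg)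
    finally show "opnorm (pstar x * x) \<le> (opnorm x)\<^sup>2" by (simp add: power2_eq_square)
    have "opnorm x \<le> sqrt (opnorm (pstar x * x))"
    proof (rule opnorm_least, rule real_le_rsqrt)
      fix \<xi> :: "'p \<Rightarrow> complex" assume \<xi>: "finite (supp \<xi>)" "vnorm \<xi> \<le> 1"
      note fin = finite_supp_poly_op[OF \<xi>(1)]
      have "(vnorm (poly_op x \<xi>))\<^sup>2 = cmod (vinner (poly_op x \<xi>) (poly_op x \<xi>))"
        by (simp add: vinner_self norm_power)
      also have "\<dots> = cmod (vinner (poly_op (pstar x * x) \<xi>) \<xi>)"
        using vinner_poly_op[OF fin \<xi>(1), of "pstar x" x] by (simp add: poly_op_mult)
      also have "\<dots> \<le> vnorm (poly_op (pstar x * x) \<xi>) * vnorm \<xi>" by (rule vinner_bound[OF fin \<xi>(1)])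
      also have "\<dots> \<le> opnorm (pstar x * x) * 1"
        by (intro mult_mono opnorm_upper \<xi> vnorm_nonneg opnorm_nonneg)
      finally show "(vnorm (poly_op x \<xi>))\<^sup>2 \<le> opnorm (pstar x * x)" by simp
    qed
    then have "(opnorm x)\<^sup>2 \<le> (sqrt (opnorm (pstar x * x)))\<^sup>2" by (intro power_mono opnorm_nonneg)
    then show "(opnorm x)\<^sup>2 \<le> opnorm (pstar x * x)" using opnorm_nonneg[of "pstar x * x"] by simp
  qed
  have "opnorm x = 0" if "x \<in> ck_relations E" for x
    using opnorm_least[of x 0] rel[OF that] opnorm_nonneg[of x] by simp
  then show ?thesis unfolding ck_seminorm_def using opnorm_nonneg add scale mult star by blast
qed

end

section \<open>The boundary path representation\<close>

text \<open>
  Infinite paths, together with finite paths that record the vertex in which they end.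
\<close>
codatatype ('v, 'e) bpath = Stop 'v | Step 'e "('v, 'e) bpath"

definition bpath_range :: "('v, 'e) pre_digraph \<Rightarrow> ('v, 'e) bpath \<Rightarrow> 'v" where
  "bpath_range E x = (case x of Stop v \<Rightarrow> v | Step e _ \<Rightarrow> head E e)"

lemma bpath_range_simps [simp]: "bpath_range E (Stop v) = v" "bpath_range E (Step e x) = head E e"
  by (simp_all add: bpath_range_def)

text \<open>
  A boundary path may end only in a vertex at which no Cuntz-Krieger sum is imposed. At a regular
  vertex \<open>v\<close> every boundary path with range \<open>v\<close> then has a first edge, which is why the relation
  \<open>p\<^sub>v = \<Sum> s\<^sub>e s\<^sub>e*\<close> holds in the representation below.
\<close>
coinductive boundary :: "('v, 'e) pre_digraph \<Rightarrow> ('v, 'e) bpath \<Rightarrow> bool"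
  for E :: "('v, 'e) pre_digraph" where
  boundary_Stop: "v \<in> verts E \<Longrightarrow> \<not> regular_vertex E v \<Longrightarrow> boundary E (Stop v)"
| boundary_Step: "e \<in> arcs E \<Longrightarrow> bpath_range E x = tail E e \<Longrightarrow> boundary E x \<Longrightarrow> boundary E (Step e x)"

inductive_simps boundary_simps: "boundary E (Stop v)" "boundary E (Step e x)"

fun boundary_act :: "('v, 'e) pre_digraph \<Rightarrow> ('v, 'e) gen \<Rightarrow> ('v, 'e) bpath \<Rightarrow> ('v, 'e) bpath option" where
  "boundary_act E (Vtx v) x = (if boundary E x \<and> bpath_range E x = v then Some x else None)"
| "boundary_act E (Edge e) x = (if boundary E (Step e x) then Some (Step e x) else None)"
| "boundary_act E (Ghost e) x =
     (case x of Step f y \<Rightarrow> if f = e \<and> boundary E x then Some y else None | Stop v \<Rightarrow> None)"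

interpretation boundary_rep: partial_injections "boundary_act E" for E :: "('v, 'e) pre_digraph"
proof
  show "boundary_act E g x = Some y \<longleftrightarrow> boundary_act E (gen_star g) y = Some x" for g x y
    by (cases g) (auto split: bpath.split)
qed

lemma boundary_ops:
  "boundary_rep.poly_op E (vtx v) \<xi> = (\<lambda>x. if boundary E x \<and> bpath_range E x = v then \<xi> x else 0)"
  "boundary_rep.poly_op E (edge e) \<xi> =
     (\<lambda>x. case x of Step f y \<Rightarrow> if f = e \<and> boundary E x then \<xi> y else 0 | Stop v \<Rightarrow> 0)"
  "boundary_rep.poly_op E (ghost e) \<xi> = (\<lambda>x. if boundary E (Step e x) then \<xi> (Step e x) else 0)"
  by (auto simp: boundary_rep.gen_op_def split: bpath.split)

lemma boundary_rep_relations: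
  assumes x: "x \<in> ck_relations E" shows "boundary_rep.poly_op E x \<xi> = (\<lambda>a. 0)"
proof -
  note S = boundary_rep.poly_op_mult boundary_rep.poly_op_diff boundary_rep.poly_op_sum boundary_ops boundary_simps
  have 1: "boundary_rep.poly_op E (vtx v * vtx w - (if v = w then vtx v else 0)) \<xi> = (\<lambda>a. 0)" for v w
    by (cases "v = w") (auto simp: S simp del: boundary_rep.poly_op_single mult_single)
  have 2: "boundary_rep.poly_op E (edge e * ghost e * edge e - edge e) \<xi> = (\<lambda>a. 0)" for e
    by (auto simp: S fun_eq_iff split: bpath.split simp del: boundary_rep.poly_op_single mult_single)
  have 3: "boundary_rep.poly_op E ((edge e * ghost e) * (edge f * ghost f)) \<xi> = (\<lambda>a. 0)" if "e \<noteq> f" for e f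
    using that by (auto simp: S fun_eq_iff split: bpath.split simp del: boundary_rep.poly_op_single mult_single)
  have 4: "boundary_rep.poly_op E (ghost e * edge e - vtx (tail E e)) \<xi> = (\<lambda>a. 0)" if "e \<in> arcs E" for e
    using that by (auto simp: S fun_eq_iff split: bpath.split simp del: boundary_rep.poly_op_single mult_single)
  have 5: "boundary_rep.poly_op E (vtx (head E e) * (edge e * ghost e) - edge e * ghost e) \<xi> = (\<lambda>a. 0)" for e
    by (auto simp: S fun_eq_iff split: bpath.split simp del: boundary_rep.poly_op_single mult_single)
  have 6: "boundary_rep.poly_op E (vtx v - (\<Sum>e\<in>edges_into E v. edge e * ghost e)) \<xi> = (\<lambda>a. 0)"
    if v: "regular_vertex E v" for v
  proof
    fix a
    have fin: "finite (edges_into E v)" using v by (simp add: regular_vertex_def)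
    show "boundary_rep.poly_op E (vtx v - (\<Sum>e\<in>edges_into E v. edge e * ghost e)) \<xi> a = 0"
    proof (cases a)
      case (Stop u)
      then show ?thesis using v by (auto simp: S simp del: boundary_rep.poly_op_single mult_single)
    next
      case (Step f y)
      have "(\<Sum>e\<in>edges_into E v. if f = e \<and> boundary E a then \<xi> a else 0) =
          (if boundary E a \<and> head E f = v then \<xi> a else 0)"
      proof (cases "head E f = v")
        case True
        then have "f \<in> edges_into E v" if "boundary E a" using that by (auto simp: edges_into_def Step boundary_simps)
        then show ?thesis using fin True by (cases "boundary E a") (auto simp: sum.delta')
      next
        case False
        then show ?thesis by (auto simp: edges_into_def intro!: sum.neutral)
      qed
      moreover have "boundary_rep.poly_op E (edge e * ghost e) \<xi> a = (if f = e \<and> boundary E a then \<xi> a else 0)" for e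
        using Step by (auto simp: S simp del: boundary_rep.poly_op_single mult_single)
      moreover have "boundary_rep.poly_op E (vtx v) \<xi> a = (if boundary E a \<and> head E f = v then \<xi> a else 0)"
        using Step by (auto simp: boundary_ops simp del: boundary_rep.poly_op_single)
      ultimately show ?thesis
        by (simp add: boundary_rep.poly_op_diff boundary_rep.poly_op_sum
            del: boundary_rep.poly_op_single mult_single)
    qed
  qed
  show ?thesis
    using x unfolding ck_relations_def Un_iff mem_Collect_eq
    by (elim disjE exE conjE; hypsubst) (blast intro: 1 2 3 4 5 6)+
qed

lemma boundary_seminorm_le:
  assumes wf: "wf_digraph E" and x: "x \<in> free_algebra E"
  shows "boundary_rep.opnorm E x \<le> universal_seminorm E x"
  by (rule universal_seminorm_upper[OF wf x boundary_rep.opnorm_ck_seminorm[OF boundary_rep_relations]])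

section \<open>Degrees along boundary paths\<close>

fun steps :: "'e list \<Rightarrow> ('v, 'e) bpath \<Rightarrow> ('v, 'e) bpath" where
  "steps [] x = x"
| "steps (e # es) x = Step e (steps es x)"

text \<open>
  The boundary paths \<open>x\<close> and \<open>a\<close> have a common tail, reached after discarding \<open>d\<close> more edges from
  \<open>a\<close> than from \<open>x\<close>. Words of degree \<open>d\<close> move \<open>x\<close> only to such paths \<open>a\<close>.
\<close>
definition lag_related :: "('v, 'e) pre_digraph \<Rightarrow> int \<Rightarrow> ('v, 'e) bpath \<Rightarrow> ('v, 'e) bpath \<Rightarrow> bool" where
  "lag_related E d x a \<longleftrightarrow> (\<exists>\<mu> \<nu> z. boundary E x \<and> boundary E a \<and> x = steps \<nu> z \<and> a = steps \<mu> z \<and>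
     int (length \<mu>) - int (length \<nu>) = d)"

lemma steps_append: "steps (u @ w) x = steps u (steps w x)"
  by (induction u) auto

lemma lag_related_act:
  assumes lag: "lag_related E d x a" and act: "boundary_act E g a = Some b"
  shows "lag_related E (d + gen_degree g) x b"
proof -
  obtain \<mu> \<nu> z where L: "boundary E x" "boundary E a" "x = steps \<nu> z" "a = steps \<mu> z"
    "int (length \<mu>) - int (length \<nu>) = d" using lag by (auto simp: lag_related_def)
  show ?thesis
  proof (cases g)
    case (Vtx v)
    then show ?thesis using lag act by (auto split: if_splits)
  next
    case (Edge e)
    then have "b = steps (e # \<mu>) z" "boundary E b" using act L by (auto split: if_splits)
    then show ?thesis unfolding lag_related_def using L Edge
      by (intro exI[of _ "e # \<mu>"] exI[of _ \<nu>] exI[of _ z]) auto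
  next
    case (Ghost e)
    then have a: "a = Step e b" using act by (auto split: bpath.splits if_splits)
    then have b: "boundary E b" using L(2) by (simp add: boundary_simps)
    show ?thesis
    proof (cases \<mu>)
      case Nil
      then have "x = steps (\<nu> @ [e]) b" using L a by (simp add: steps_append)
      then show ?thesis unfolding lag_related_def using L b Ghost Nil
        by (intro exI[of _ "[]"] exI[of _ "\<nu> @ [e]"] exI[of _ b]) auto
    next
      case (Cons f \<mu>')
      then have "b = steps \<mu>' z" using L a by simp
      then show ?thesis unfolding lag_related_def using L b Ghost Cons
        by (intro exI[of _ \<mu>'] exI[of _ \<nu>] exI[of _ z]) auto
    qed
  qed
qed

definition point_mass :: "'p \<Rightarrow> 'p \<Rightarrow> complex" where
  "point_mass x = (\<lambda>a. if a = x then 1 else 0)"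

lemma supp_point_mass [simp]: "supp (point_mass x) = {x}"
  by (auto simp: supp_def point_mass_def)

lemma vnorm_point_mass [simp]: "vnorm (point_mass x) = 1"
  by (simp add: vnorm_def) (simp add: point_mass_def)

lemma word_op_point_mass:
  assumes x: "boundary E x" and "boundary_rep.word_op E w (point_mass x) a \<noteq> 0"
  shows "lag_related E (word_degree w) x a"
  using assms(2)
proof (induction w arbitrary: a)
  case Nil
  then have "a = x" by (simp add: point_mass_def split: if_splits)
  then show ?case using x unfolding lag_related_def
    by (intro exI[of _ "[]"] exI[of _ "[]"] exI[of _ x]) auto
next
  case (Cons g w)
  then obtain b where b: "boundary_act E (gen_star g) a = Some b" "boundary_rep.word_op E w (point_mass x) b \<noteq> 0"
    by (auto simp: boundary_rep.gen_op_def split: option.splits)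
  have "boundary_act E g b = Some a" by (rule boundary_rep.act_star[THEN iffD2, OF b(1)])
  from lag_related_act[OF Cons.IH[OF b(2)] this] show ?case by (simp add: add.commute)
qed

lemma homogeneous_op_point_mass:
  assumes x: "boundary E x" and p: "p \<in> homogeneous E d" and no: "\<And>a. \<not> lag_related E d x a"
  shows "boundary_rep.poly_op E p (point_mass x) = (\<lambda>a. 0)"
proof
  fix a
  have "boundary_rep.word_op E w (point_mass x) a = 0" if "w \<in> Poly_Mapping.keys p" for w
    using word_op_point_mass[OF x, of w a] no p that by (auto simp: homogeneous_def)
  then show "boundary_rep.poly_op E p (point_mass x) a = 0"
    by (simp add: boundary_rep.poly_op_def)
qed

text \<open>
  Without a path of lag \<open>d\<close>, every polynomial of degree \<open>d\<close> annihilates the basis vector at \<open>x\<close>.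
  So does then every sum of products with right factors of degree \<open>d\<close>, while the vertex fixes this
  unit vector; the two are at distance at least \<open>1\<close> in the norm of \<open>C*(E)\<close>.
\<close>
lemma lag_exists:
  assumes wf: "wf_digraph E" and x: "boundary E x" and v: "bpath_range E x = v" "v \<in> verts E"
    and p: "p \<in> products E (- d) d" and close: "universal_seminorm E (vtx v - p) < 1"
  shows "\<exists>a. lag_related E d x a"
proof (rule ccontr)
  assume "\<nexists>a. lag_related E d x a"
  then have no: "\<not> lag_related E d x a" for a by blast
  let ?T = "boundary_rep.poly_op E"
  have z: "?T y (\<lambda>a. 0) = (\<lambda>a. 0)" for y
    by (simp add: boundary_rep.poly_op_def boundary_rep.word_op_zero)
  have "?T p (point_mass x) = (\<lambda>a. 0)"
    using p
  proof induction
    case (products_step y y' p)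
    then show ?case
      by (simp add: boundary_rep.poly_op_add boundary_rep.poly_op_mult homogeneous_op_point_mass[OF x _ no] z)
  qed simp
  moreover have "?T (vtx v) (point_mass x) = point_mass x"
    using x v by (auto simp: boundary_ops point_mass_def fun_eq_iff simp del: boundary_rep.poly_op_single)
  ultimately have "?T (vtx v - p) (point_mass x) = point_mass x"
    by (simp add: boundary_rep.poly_op_diff del: boundary_rep.poly_op_single)
  then have "1 \<le> boundary_rep.opnorm E (vtx v - p)"
    using boundary_rep.opnorm_upper[of "point_mass x" E "vtx v - p"] by simp
  also have "\<dots> \<le> universal_seminorm E (vtx v - p)"
    by (rule boundary_seminorm_le[OF wf]) (use v products_free[OF p] in simp)
  finally show False using close by simp
qed

section \<open>Factorizations of vertices\<close>

lemma boundary_steps_arcs: "boundary E (steps \<mu> z) \<Longrightarrow> set \<mu> \<subseteq> arcs E"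
  by (induction \<mu>) (auto simp: boundary_simps)

lemma ghost_path_path:
  assumes wf: "wf_digraph E" and "boundary E (steps \<mu> z)" "\<mu> \<noteq> []"
  shows "leavitt_eq E (monomial (map Ghost (rev \<mu>) @ map Edge \<mu>)) (vtx (bpath_range E z))"
  using assms(2,3)
proof (induction \<mu>)
  case (Cons e \<mu>)
  then have e: "e \<in> arcs E" and t: "bpath_range E (steps \<mu> z) = tail E e" and b: "boundary E (steps \<mu> z)"
    by (auto simp: boundary_simps)
  have ge: "leavitt_eq E (monomial [Ghost e, Edge e]) (monomial [Vtx (tail E e)])"
    using ghost_edge_word[OF wf e e] by simp
  show ?case
  proof (cases \<mu>)
    case Nil
    then show ?thesis using ge t by simp
  next
    case (Cons f \<mu>')
    have f: "f \<in> arcs E" "head E f = tail E e" using b t Cons by (auto simp: boundary_simps)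
    have gens: "set (map Ghost (rev \<mu>)) \<subseteq> generators E" "set (map Edge \<mu>) \<subseteq> generators E"
      "set (map Edge \<mu>') \<subseteq> generators E"
      using boundary_steps_arcs[OF b] Cons by (auto simp: generators_def)
    have vf: "leavitt_eq E (monomial [Vtx (tail E e), Edge f]) (monomial [Edge f])"
      using word_left_vertex[OF wf, of "Edge f"] f by (simp add: generators_def)
    have "leavitt_eq E (monomial (map Ghost (rev \<mu>) @ ([Ghost e, Edge e] @ map Edge \<mu>)))
        (monomial (map Ghost (rev \<mu>) @ ([Vtx (tail E e)] @ map Edge \<mu>)))"
      by (rule word_eq_append_left[OF word_eq_append_right[OF ge gens(2)] gens(1)])
    also have "leavitt_eq E (monomial (map Ghost (rev \<mu>) @ ([Vtx (tail E e)] @ map Edge \<mu>)))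
        (monomial (map Ghost (rev \<mu>) @ map Edge \<mu>))"
      using word_eq_append_left[OF word_eq_append_right[OF vf gens(3)] gens(1)] Cons by simp
    also have "leavitt_eq E (monomial (map Ghost (rev \<mu>) @ map Edge \<mu>)) (vtx (bpath_range E z))" using Cons.IH b Cons by simp
    finally show ?thesis by simp
  qed
qed simp

text \<open>
  The factorization is \<open>s(\<mu>) = \<mu>*\<mu>\<close>.
\<close>
lemma path_source_factorable:
  assumes wf: "wf_digraph E" and b: "boundary E (steps \<mu> z)" and ne: "\<mu> \<noteq> []"
  shows "vtx (bpath_range E z) \<in> factorable E (- int (length \<mu>)) (int (length \<mu>))"
proof (rule factorable_cong[OF leavitt_eq_sym[OF ghost_path_path[OF assms]]])
  have "monomial (map Ghost (rev \<mu>)) * monomial (map Edge \<mu>)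
      \<in> factorable E (- int (length \<mu>)) (int (length \<mu>))"
    using boundary_steps_arcs[OF b] ne
    by (intro factorable_base homogeneous_single) (auto simp: generators_def comp_def sum_list_triv)
  then show "monomial (map Ghost (rev \<mu>) @ map Edge \<mu>) \<in> factorable E (- int (length \<mu>)) (int (length \<mu>))"
    by (simp add: single_mult del: mult_single)
qed

lemma regular_vertex_word:
  assumes "regular_vertex E v"
  shows "leavitt_eq E (vtx v) (\<Sum>e\<in>edges_into E v. edge e * ghost e)"
proof (rule leavitt_eq_relation)
  show "vtx v - (\<Sum>e\<in>edges_into E v. edge e * ghost e) \<in> leavitt_relations E"
    using assms unfolding leavitt_relations_def by blast
qed (use assms in \<open>auto simp: regular_vertex_def edges_into_def simp del: mult_single intro!: free_algebra_sum\<close>)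

text \<open>
  The infinite path along which \<open>c\<close> chooses each edge from the number of edges already chosen and
  the vertex reached; \<open>t\<close> plays the part of the source map.
\<close>
primcorec walk :: "(nat \<Rightarrow> 'v \<Rightarrow> 'e) \<Rightarrow> ('e \<Rightarrow> 'v) \<Rightarrow> nat \<Rightarrow> 'v \<Rightarrow> ('v, 'e) bpath" where
  "walk c t k u = Step (c k u) (walk c t (Suc k) (t (c k u)))"

text \<open>
  By \<open>lag_exists\<close> and the assumed approximations, every boundary path has, for every \<open>d\<close>, a
  boundary path of lag \<open>d\<close> from it.
  A singular vertex \<open>v\<close> would be a boundary path of length zero, from which no path of lag \<open>-1\<close>
  arises; hence all vertices are regular and \<open>v = \<Sum> ee*\<close> lies in \<open>L\<^sub>1 L\<^sub>-\<^sub>1\<close>.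

  For \<open>L\<^sub>-\<^sub>1 L\<^sub>1\<close>, a vertex \<open>u\<close> is called bad at stage \<open>k\<close> if it is outside \<open>L\<^sub>-\<^sub>(\<^sub>k\<^sub>+\<^sub>1\<^sub>) L\<^sub>k\<^sub>+\<^sub>1\<close>. If
  the sources of all edges \<open>e\<close> into \<open>u\<close> were good at stage \<open>k + 1\<close>, then \<open>u = \<Sum> e s(e) e*\<close> would be
  good at stage \<open>k\<close>. A vertex that is bad at stage \<open>0\<close> is therefore the range of an infinite path
  which after \<open>k\<close> edges sits in a vertex bad at stage \<open>k\<close>. A path of lag \<open>1\<close> supplies, for some
  \<open>k\<close>, a path \<open>\<mu>\<close> of length \<open>k + 1\<close> whose source \<open>u\<close> is the vertex reached after \<open>k\<close> edges, and then
  \<open>u = \<mu>*\<mu>\<close> is good at stage \<open>k\<close>.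
\<close>
lemma vertices_factorable:
  assumes wf: "wf_digraph E"
    and approx: "\<And>v d. v \<in> verts E \<Longrightarrow> \<exists>p\<in>products E (- d) d. universal_seminorm E (vtx v - p) < 1"
    and v: "v \<in> verts E"
  shows "vtx v \<in> factorable E 1 (- 1)" "vtx v \<in> factorable E (- 1) 1"
proof -
  have lag: "\<exists>a. lag_related E d x a" if "boundary E x" "bpath_range E x \<in> verts E" for x d
    using approx[OF that(2), of d] lag_exists[OF wf that(1) refl that(2)] by blast
  have regular: "regular_vertex E u" if u: "u \<in> verts E" for u
  proof (rule ccontr)
    assume "\<not> regular_vertex E u"
    then have "boundary E (Stop u)" using u by (simp add: boundary_simps)
    from lag[OF this, of "-1"] u obtain a where "lag_related E (- 1) (Stop u) a" by auto
    then obtain \<mu> \<nu> z where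
      "Stop u = steps \<nu> z" "a = steps \<mu> z" "int (length \<mu>) - int (length \<nu>) = - 1" unfolding lag_related_def by blast
    then show False by (cases \<nu>) auto
  qed
  have into: "e \<in> arcs E" "head E e = u" if "e \<in> edges_into E u" for e u
    using that by (auto simp: edges_into_def)
  show "vtx v \<in> factorable E 1 (- 1)"
    by (rule factorable_cong[OF regular_vertex_word[OF regular[OF v]] factorable_sum], rule factorable_base)
      (auto intro!: homogeneous_gens dest: into)
  define bad where "bad k u \<longleftrightarrow> u \<in> verts E \<and> vtx u \<notin> factorable E (- int (Suc k)) (int (Suc k))" for k u
  have step: "\<exists>e. e \<in> arcs E \<and> head E e = u \<and> bad (Suc k) (tail E e)" if bad: "bad k u" for k u
  proof (rule ccontr)
    assume no: "\<nexists>e. e \<in> arcs E \<and> head E e = u \<and> bad (Suc k) (tail E e)"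
    have u: "u \<in> verts E" using bad by (simp add: bad_def)
    have "edge e * ghost e \<in> factorable E (- int (Suc k)) (int (Suc k))" if e: "e \<in> edges_into E u" for e
    proof -
      note ea = into[OF e]
      have t: "tail E e \<in> verts E" using wf ea by (simp add: wf_digraph_def)
      have "vtx (tail E e) \<in> factorable E (- int (Suc (Suc k))) (int (Suc (Suc k)))"
        using no ea t unfolding bad_def by blast
      from factorable_mult_right[OF factorable_mult_left[OF this homogeneous_gens(2)[OF ea(1)]] homogeneous_gens(3)[OF ea(1)]]
      have "edge e * vtx (tail E e) * ghost e \<in> factorable E (- int (Suc k)) (int (Suc k))"
        by (simp del: mult_single)
      moreover have "leavitt_eq E (edge e * ghost e) (edge e * vtx (tail E e) * ghost e)"
        using leavitt_eq_sym[OF word_eq_append_right[OF word_right_vertex[OF wf, of "Edge e"], of "[Ghost e]"]] ea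
        by (simp add: generators_def single_mult del: mult_single)
      ultimately show ?thesis by (rule factorable_cong[rotated])
    qed
    then have "vtx u \<in> factorable E (- int (Suc k)) (int (Suc k))"
      by (intro factorable_cong[OF regular_vertex_word[OF regular[OF u]]] factorable_sum)
    then show False using bad by (simp add: bad_def)
  qed
  then obtain c where c: "\<And>k u. bad k u \<Longrightarrow> c k u \<in> arcs E \<and> head E (c k u) = u \<and> bad (Suc k) (tail E (c k u))"
    by metis
  let ?w = "walk c (tail E)"
  have range_walk: "bpath_range E (?w k u) = u" if "bad k u" for k u
    using c[OF that] by (subst walk.code) simp
  have boundary_walk: "boundary E (?w k u)" if "bad k u" for k u
    using that
  proof (coinduction arbitrary: k u)
    case boundary
    note C = c[OF boundary]
    have "?w k u = Step (c k u) (?w (Suc k) (tail E (c k u)))" by (rule walk.code)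
    then show ?case using C range_walk[of "Suc k" "tail E (c k u)"] by blast
  qed
  have tail_walk: "\<exists>u'. bad (k + length \<nu>) u' \<and> z = ?w (k + length \<nu>) u'" if "bad k u" "?w k u = steps \<nu> z" for k u \<nu> z
    using that
  proof (induction \<nu> arbitrary: k u)
    case (Cons e \<nu>)
    have "?w k u = Step (c k u) (?w (Suc k) (tail E (c k u)))" by (rule walk.code)
    then have "?w (Suc k) (tail E (c k u)) = steps \<nu> z" using Cons.prems by simp
    from Cons.IH[OF _ this] show ?case using c[OF Cons.prems(1)] by simp
  qed auto
  show "vtx v \<in> factorable E (- 1) 1"
  proof (rule ccontr)
    assume "vtx v \<notin> factorable E (- 1) 1"
    then have bad: "bad 0 v" using v by (simp add: bad_def)
    have "\<exists>a. lag_related E 1 (?w 0 v) a"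
      by (rule lag[OF boundary_walk[OF bad]]) (simp add: range_walk[OF bad] v)
    then obtain \<mu> \<nu> z where L: "boundary E (steps \<mu> z)" "?w 0 v = steps \<nu> z"
      "int (length \<mu>) - int (length \<nu>) = 1" unfolding lag_related_def by blast
    from tail_walk[OF bad L(2)] obtain u where u: "bad (length \<nu>) u" "z = ?w (length \<nu>) u" by auto
    have len: "length \<mu> = Suc (length \<nu>)" using L(3) by simp
    then have "vtx (bpath_range E z) \<in> factorable E (- int (length \<mu>)) (int (length \<mu>))"
      by (intro path_source_factorable[OF wf L(1)]) auto
    then show False using u range_walk[OF u(1)] len by (simp add: bad_def)
  qed
qed

section \<open>The grading of the graph C*-algebra\<close>

text \<open>
  The gauge action on the free algebra.
\<close>
definition rotate_poly :: "complex \<Rightarrow> ('v, 'e) ncpoly \<Rightarrow> ('v, 'e) ncpoly" where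
  "rotate_poly z x = Poly_Mapping.mapp (\<lambda>w c. z powi word_degree w * c) x"

lemma lookup_rotate:
  "Poly_Mapping.lookup (rotate_poly z x) w = z powi word_degree w * Poly_Mapping.lookup x w"
  by (simp add: rotate_poly_def lookup_mapp when_def in_keys_iff)

lemma rotate_0 [simp]: "rotate_poly z 0 = 0"
  by (rule poly_mapping_eqI) (simp add: lookup_rotate)

lemma rotate_add: "rotate_poly z (x + y) = rotate_poly z x + rotate_poly z y"
  by (rule poly_mapping_eqI) (simp add: lookup_rotate lookup_add distrib_left)

lemma rotate_single: "rotate_poly z (Poly_Mapping.single w c) = pscale (z powi word_degree w * c) (monomial w)"
  by (rule poly_mapping_eqI) (simp add: lookup_rotate lookup_pscale lookup_single when_def)

lemma rotate_free [simp]: "x \<in> free_algebra E \<Longrightarrow> rotate_poly z x \<in> free_algebra E"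
  by (auto simp: free_algebra_iff lookup_rotate)

lemma rotate_homogeneous: "x \<in> homogeneous E n \<Longrightarrow> rotate_poly z x = pscale (z powi n) x"
  by (rule poly_mapping_eqI) (auto simp: lookup_rotate lookup_pscale homogeneous_iff)

lemma (in abelian_group) finsum_additive:
  assumes "finite I" "f \<in> I \<rightarrow> carrier G" and h: "h \<in> carrier G \<rightarrow> carrier G" "h \<zero> = \<zero>"
    "\<And>x y. x \<in> carrier G \<Longrightarrow> y \<in> carrier G \<Longrightarrow> h (x \<oplus> y) = h x \<oplus> h y"
  shows "h (\<Oplus>i\<in>I. f i) = (\<Oplus>i\<in>I. h (f i))"
  using assms(1,2)
proof (induction I rule: finite_induct)
  case (insert i I)
  have "h (\<Oplus>i\<in>insert i I. f i) = h (f i \<oplus> (\<Oplus>i\<in>I. f i))"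
    using insert by (subst finsum_insert) auto
  also have "\<dots> = h (f i) \<oplus> h (\<Oplus>i\<in>I. f i)"
    by (rule h(3)) (use insert in auto)
  also have "\<dots> = h (f i) \<oplus> (\<Oplus>i\<in>I. h (f i))" using insert by auto
  also have "\<dots> = (\<Oplus>i\<in>insert i I. h (f i))"
    using insert h(1) by (subst finsum_insert) auto
  finally show ?case .
qed (simp add: h)

lemma (in cstar_algebra) closure_of_iff:
  "a \<in> norm_topology A closure_of S \<longleftrightarrow>
     a \<in> carrier A \<and> (\<forall>\<epsilon>>0. \<exists>b\<in>S. b \<in> carrier A \<and> nrm A (a \<ominus> b) < \<epsilon>)"
  unfolding Metric_space.metric_closure_of[OF metric]
  by (auto simp: Metric_space.in_mball[OF metric] norm_dist_def Bex_def)

context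
  fixes E :: "('v, 'e) pre_digraph"
  assumes wf: "wf_digraph E"
begin

private abbreviation (input) "F \<equiv> free_algebra E"
private abbreviation (input) "A \<equiv> graph_cstar E"
private abbreviation (input) "U \<equiv> universal_seminorm E"
private abbreviation (input) "\<gamma> \<equiv> gauge_action E"
private abbreviation (input) "G \<equiv> gauge_component E"
private abbreviation (input) "\<pi> \<equiv> (\<lambda>x. cauchy_class E (\<lambda>n. x))"

interpretation A: cstar_algebra A by (rule cstar_algebra_graph_cstar[OF wf])

lemma image_closed: "x \<in> F \<Longrightarrow> \<pi> x \<in> carrier A"
  by (rule cl_carrier[OF wf CS_const[OF wf]])

lemma image_ops:
  "x \<in> F \<Longrightarrow> y \<in> F \<Longrightarrow> \<pi> (x + y) = \<pi> x \<oplus>\<^bsub>A\<^esub> \<pi> y"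
  "x \<in> F \<Longrightarrow> y \<in> F \<Longrightarrow> \<pi> (x * y) = \<pi> x \<otimes>\<^bsub>A\<^esub> \<pi> y"
  "x \<in> F \<Longrightarrow> y \<in> F \<Longrightarrow> \<pi> (x - y) = \<pi> x \<ominus>\<^bsub>A\<^esub> \<pi> y"
  "x \<in> F \<Longrightarrow> \<pi> (pscale c x) = c \<odot>\<^bsub>A\<^esub> \<pi> x"
  "x \<in> F \<Longrightarrow> \<pi> (pstar x) = adj A (\<pi> x)"
  "\<pi> 0 = \<zero>\<^bsub>A\<^esub>"
  "x \<in> F \<Longrightarrow> nrm A (\<pi> x) = U x"
  using CS_const[OF wf] A_norm_eqI[OF wf CS_const[OF wf], of x "U x"]
  by (simp_all add: A_add[OF wf] A_mult[OF wf] A_minus[OF wf] A_scale[OF wf] A_star[OF wf] A_zero[OF wf])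

lemma image_dense:
  assumes a: "a \<in> carrier A" and \<epsilon>: "0 < \<epsilon>"
  shows "\<exists>x\<in>F. nrm A (a \<ominus>\<^bsub>A\<^esub> \<pi> x) < \<epsilon>"
proof -
  obtain X where X: "X \<in> cauchy_seqs E" "a = cauchy_class E X" using a by (rule carrier_cases[OF wf])
  note XF = CS_F[OF wf X(1)]
  obtain N where N: "\<And>m n. m \<ge> N \<Longrightarrow> n \<ge> N \<Longrightarrow> U (X m - X n) < \<epsilon> / 2"
    using CS_D[OF wf X(1), of "\<epsilon> / 2"] \<epsilon> by (metis half_gt_zero)
  have "norm_dist A (cauchy_class E X) (\<pi> (X N)) \<le> \<epsilon> / 2"
    by (rule A_dist_le[OF wf X(1) CS_const[OF wf XF], of N]) (use N in \<open>auto simp: less_imp_le\<close>)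
  then have "nrm A (a \<ominus>\<^bsub>A\<^esub> \<pi> (X N)) < \<epsilon>"
    using a image_closed[OF XF, of N] \<epsilon> X(2) by (simp add: norm_dist_def)
  then show ?thesis using XF by blast
qed

text \<open>
  The Cuntz-Krieger relations speak of projections and partial isometries only, as usual for
  C*-algebras. The algebraic relations of the Leavitt path algebra follow from them by means of
  \<open>s = s s* s\<close>.
\<close>
lemma image_leavitt_relation:
  assumes x: "x \<in> leavitt_relations E" shows "\<pi> x = \<zero>\<^bsub>A\<^esub>"
proof -
  note D = cuntz_krieger_familyD[OF graph_cstar_cuntz_krieger[OF wf], unfolded cstar_vertex_def cstar_edge_def]
  have ends: "tail E e \<in> verts E" "head E e \<in> verts E" if "e \<in> arcs E" for e
    using wf that by (auto simp: wf_digraph_def)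
  note closed = A.mult_closed A.adj_closed D(1) D(5) ends
  have gh: "\<pi> (ghost e) = adj A (\<pi> (edge e))" if "e \<in> arcs E" for e
    using image_ops(5)[of "edge e"] that by simp
  have sub: "\<pi> (y - y') = \<zero>\<^bsub>A\<^esub>" if "\<pi> y = \<pi> y'" "y \<in> F" "y' \<in> F" for y y'
    using that image_ops(3)[of y y'] image_closed[of y'] by (simp add: A.minus_eq A.r_neg)
  have head: "\<pi> (vtx (head E e)) \<otimes>\<^bsub>A\<^esub> \<pi> (edge e) = \<pi> (edge e)" if e: "e \<in> arcs E" for e
    using D(6)[OF e] D(9)[OF e] A.mult_assoc[of "\<pi> (vtx (head E e))" "\<pi> (edge e) \<otimes>\<^bsub>A\<^esub> adj A (\<pi> (edge e))" "\<pi> (edge e)"] e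
    by (simp add: closed)
  have tail: "\<pi> (edge e) \<otimes>\<^bsub>A\<^esub> \<pi> (vtx (tail E e)) = \<pi> (edge e)" if e: "e \<in> arcs E" for e
    using D(6)[OF e] D(8)[OF e] A.mult_assoc[of "\<pi> (edge e)" "adj A (\<pi> (edge e))" "\<pi> (edge e)"] e
    by (simp add: closed)
  have tail': "\<pi> (vtx (tail E e)) \<otimes>\<^bsub>A\<^esub> adj A (\<pi> (edge e)) = adj A (\<pi> (edge e))" if e: "e \<in> arcs E" for e
    using arg_cong[OF tail[OF e], of "adj A"] D(3)[OF ends(1)[OF e]] e by (simp add: closed A.adj_mult)
  have head': "adj A (\<pi> (edge e)) \<otimes>\<^bsub>A\<^esub> \<pi> (vtx (head E e)) = adj A (\<pi> (edge e))" if e: "e \<in> arcs E" for e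
    using arg_cong[OF head[OF e], of "adj A"] D(3)[OF ends(2)[OF e]] e by (simp add: closed A.adj_mult)
  have orth: "adj A (\<pi> (edge e)) \<otimes>\<^bsub>A\<^esub> \<pi> (edge f) = \<zero>\<^bsub>A\<^esub>" if e: "e \<in> arcs E" and f: "f \<in> arcs E" and ne: "e \<noteq> f" for e f
  proof -
    let ?s = "\<pi> (edge e)" and ?t = "\<pi> (edge f)"
    let ?s' = "adj A ?s" and ?t' = "adj A ?t"
    have "?s' = ?s' \<otimes>\<^bsub>A\<^esub> (?s \<otimes>\<^bsub>A\<^esub> ?s')"
      using tail'[OF e] D(8)[OF e] A.mult_assoc[of ?s' ?s ?s'] e by (simp add: closed)
    moreover have "?t = (?t \<otimes>\<^bsub>A\<^esub> ?t') \<otimes>\<^bsub>A\<^esub> ?t" using D(6)[OF f] by simp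
    ultimately have "?s' \<otimes>\<^bsub>A\<^esub> ?t = (?s' \<otimes>\<^bsub>A\<^esub> (?s \<otimes>\<^bsub>A\<^esub> ?s')) \<otimes>\<^bsub>A\<^esub> ((?t \<otimes>\<^bsub>A\<^esub> ?t') \<otimes>\<^bsub>A\<^esub> ?t)" by metis
    also have "\<dots> = ?s' \<otimes>\<^bsub>A\<^esub> (((?s \<otimes>\<^bsub>A\<^esub> ?s') \<otimes>\<^bsub>A\<^esub> (?t \<otimes>\<^bsub>A\<^esub> ?t')) \<otimes>\<^bsub>A\<^esub> ?t)"
      using e f by (simp add: closed A.mult_assoc)
    also have "\<dots> = \<zero>\<^bsub>A\<^esub>" using D(7)[OF e f ne] e f by (simp add: closed A.mult_zero)
    finally show ?thesis .
  qed
  have sum: "(\<Oplus>\<^bsub>A\<^esub>i\<in>I. \<pi> (f i)) = \<pi> (\<Sum>i\<in>I. f i)"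
    if "finite I" "\<And>i. i \<in> I \<Longrightarrow> f i \<in> F" for I :: "'e set" and f
    using that
  proof (induction I rule: finite_induct)
    case (insert i I)
    then show ?case by (subst A.finsum_insert) (auto simp: image_closed image_ops(1) free_algebra_sum)
  qed (simp add: image_ops(6))
  have 1: "\<pi> (vtx v * vtx w - (if v = w then vtx v else 0)) = \<zero>\<^bsub>A\<^esub>" if "v \<in> verts E" "w \<in> verts E" for v w
    by (rule sub) (use that D(2)[OF that(1)] D(4)[OF that] in \<open>auto simp: image_ops simp del: mult_single\<close>)
  have 2: "\<pi> (vtx (head E e) * edge e - edge e) = \<zero>\<^bsub>A\<^esub>" if "e \<in> arcs E" for e
    by (rule sub) (use that ends[OF that] head[OF that] in \<open>auto simp: image_ops simp del: mult_single\<close>)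
  have 3: "\<pi> (edge e * vtx (tail E e) - edge e) = \<zero>\<^bsub>A\<^esub>" if "e \<in> arcs E" for e
    by (rule sub) (use that ends[OF that] tail[OF that] in \<open>auto simp: image_ops simp del: mult_single\<close>)
  have 4: "\<pi> (vtx (tail E e) * ghost e - ghost e) = \<zero>\<^bsub>A\<^esub>" if "e \<in> arcs E" for e
    by (rule sub) (use that ends[OF that] tail'[OF that] in \<open>auto simp: image_ops gh simp del: mult_single\<close>)
  have 5: "\<pi> (ghost e * vtx (head E e) - ghost e) = \<zero>\<^bsub>A\<^esub>" if "e \<in> arcs E" for e
    by (rule sub) (use that ends[OF that] head'[OF that] in \<open>auto simp: image_ops gh simp del: mult_single\<close>)
  have 6: "\<pi> (ghost e * edge f - (if e = f then vtx (tail E e) else 0)) = \<zero>\<^bsub>A\<^esub>"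
    if "e \<in> arcs E" "f \<in> arcs E" for e f
    by (rule sub) (use that ends[OF that(1)] D(8)[OF that(1)] orth[OF that] in \<open>auto simp: image_ops gh simp del: mult_single\<close>)
  have 7: "\<pi> (vtx v - (\<Sum>e\<in>edges_into E v. edge e * ghost e)) = \<zero>\<^bsub>A\<^esub>" if v: "regular_vertex E v" for v
  proof (rule sub)
    have into: "e \<in> arcs E" if "e \<in> edges_into E v" for e using that by (simp add: edges_into_def)
    have "\<pi> (vtx v) = (\<Oplus>\<^bsub>A\<^esub>e\<in>edges_into E v. \<pi> (edge e * ghost e))"
      unfolding D(10)[OF v]
      by (rule A.finsum_cong') (auto dest!: into simp: gh image_ops(2) closed simp del: mult_single)
    also have "\<dots> = \<pi> (\<Sum>e\<in>edges_into E v. edge e * ghost e)"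
      by (rule sum) (use v into in \<open>auto simp: regular_vertex_def simp del: mult_single\<close>)
    finally show "\<pi> (vtx v) = \<pi> (\<Sum>e\<in>edges_into E v. edge e * ghost e)" .
  qed (use v in \<open>auto simp: regular_vertex_def edges_into_def simp del: mult_single intro!: free_algebra_sum\<close>)
  show ?thesis
    by (insert x[unfolded leavitt_relations_def Un_iff mem_Collect_eq], elim disjE exE conjE)
      (simp_all only: 1 2 3 4 5 6 7)
qed

lemma image_leavitt_ideal:
  assumes "x \<in> leavitt_ideal E" shows "\<pi> x = \<zero>\<^bsub>A\<^esub>"
proof -
  have "U x = 0" using assms
  proof induction
    case (relation x)
    then show ?case
      using image_leavitt_relation image_ops(7) leavitt_relations_free[OF wf] A.nrm_zero by (metis subsetD)
  next
    case (add x y)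
    then show ?case using leavitt_ideal_free[OF wf] U_add[OF wf, of x y] U_nonneg[OF wf, of "x + y"] by simp
  next
    case (scale x c)
    then show ?case using leavitt_ideal_free[OF wf] U_scale[OF wf, of x c] by simp
  next
    case (mult_left x y)
    then show ?case using leavitt_ideal_free[OF wf] U_mult[OF wf, of y x] U_nonneg[OF wf, of "y * x"] by simp
  next
    case (mult_right x y)
    then show ?case using leavitt_ideal_free[OF wf] U_mult[OF wf, of x y] U_nonneg[OF wf, of "x * y"] by simp
  qed (simp add: U_0[OF wf])
  then show ?thesis
    using image_ops(7)[of x] A.nrm_eq_0_iff image_closed[of x] leavitt_ideal_free[OF wf assms] by simp
qed

lemma image_leavitt_eq: "leavitt_eq E x y \<Longrightarrow> \<pi> x = \<pi> y"
  using image_leavitt_ideal[of "x - y"] image_ops(3)[of x y] image_closed[of x] image_closed[of y]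
    A.nrm_minus_eq_0[of "\<pi> x" "\<pi> y"] A.nrm_zero
  by (simp add: leavitt_rel_def)

lemma gauge_hom: assumes "cmod z = 1" shows "\<gamma> z \<in> star_hom A A"
  using gauge_action(1)[OF wf assms] by (simp add: star_aut_def)

lemma gauge_zero: assumes "cmod z = 1" shows "\<gamma> z \<zero>\<^bsub>A\<^esub> = \<zero>\<^bsub>A\<^esub>"
  using star_homD(5)[OF gauge_hom[OF assms], of "\<zero>\<^bsub>A\<^esub>" 0] star_homD(1)[OF gauge_hom[OF assms], of "\<zero>\<^bsub>A\<^esub>"]
  by (simp add: A.smult_zero_left)

lemma gauge_minus:
  assumes "cmod z = 1" "a \<in> carrier A" "b \<in> carrier A"
  shows "\<gamma> z (a \<ominus>\<^bsub>A\<^esub> b) = \<gamma> z a \<ominus>\<^bsub>A\<^esub> \<gamma> z b"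
  using star_homD[OF gauge_hom[OF assms(1)]] assms(2,3) by (simp add: A.minus_conv A.smult_closed)

lemma gauge_word:
  assumes z: "cmod z = 1"
  shows "generator_word E w \<Longrightarrow> \<gamma> z (\<pi> (monomial w)) = z powi word_degree w \<odot>\<^bsub>A\<^esub> \<pi> (monomial w)"
proof (induction w)
  case (Cons g w)
  have z0: "z \<noteq> 0" using z by auto
  have zc: "cnj z = z powi (-1)"
    using z z0 by (simp add: power_int_minus field_simps flip: complex_norm_square)
  have g: "\<gamma> z (\<pi> (monomial [g])) = z powi gen_degree g \<odot>\<^bsub>A\<^esub> \<pi> (monomial [g])"
  proof (cases g)
    case (Vtx v)
    then show ?thesis
      using gauge_action(3)[OF wf z, of v] Cons.prems image_closed[of "vtx v"]
      by (simp add: cstar_vertex_def A.smult_one generators_def image_iff)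
  next
    case (Edge e)
    then show ?thesis
      using gauge_action(2)[OF wf z, of e] Cons.prems by (simp add: cstar_edge_def generators_def image_iff)
  next
    case (Ghost e)
    then have e: "e \<in> arcs E" using Cons.prems by (auto simp: generators_def)
    have gh: "\<pi> (ghost e) = adj A (\<pi> (edge e))" using image_ops(5)[of "edge e"] e by simp
    have "\<gamma> z (\<pi> (ghost e)) = adj A (\<gamma> z (\<pi> (edge e)))"
      unfolding gh using star_homD(4)[OF gauge_hom[OF z]] image_closed[of "edge e"] e by simp
    also have "\<dots> = cnj z \<odot>\<^bsub>A\<^esub> \<pi> (ghost e)"
      using gauge_action(2)[OF wf z e] image_closed[of "edge e"] e by (simp add: cstar_edge_def A.adj_smult gh)
    finally show ?thesis using Ghost zc by simp
  qed
  show ?case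
  proof (cases "w = []")
    case False
    have FF: "monomial [g] \<in> F" "monomial w \<in> F" using Cons.prems False by (auto intro!: free_algebra_single)
    note C = image_closed[OF FF(1)] image_closed[OF FF(2)]
    have eq: "\<pi> (monomial (g # w)) = \<pi> (monomial [g]) \<otimes>\<^bsub>A\<^esub> \<pi> (monomial w)"
      using image_ops(2)[OF FF] by (simp add: single_mult)
    have "\<gamma> z (\<pi> (monomial (g # w))) = (z powi gen_degree g \<odot>\<^bsub>A\<^esub> \<pi> (monomial [g])) \<otimes>\<^bsub>A\<^esub>
        (z powi word_degree w \<odot>\<^bsub>A\<^esub> \<pi> (monomial w))"
      unfolding eq using star_homD(3)[OF gauge_hom[OF z] C] g Cons.IH Cons.prems False by simp
    also have "\<dots> = (z powi gen_degree g * z powi word_degree w) \<odot>\<^bsub>A\<^esub> \<pi> (monomial (g # w))"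
      unfolding eq using C
      by (simp add: A.smult_mult_left A.smult_mult_right A.smult_smult A.smult_closed A.mult_closed mult.commute)
    finally show ?thesis using z0 by (simp add: power_int_add)
  qed (use g in simp)
qed simp

lemma gauge_image:
  assumes z: "cmod z = 1" and x: "x \<in> F"
  shows "\<gamma> z (\<pi> x) = \<pi> (rotate_poly z x)"
  using x
proof (induction rule: free_algebra_induct)
  case zero
  show ?case using gauge_zero[OF z] by (simp add: image_ops(6))
next
  case (single w c)
  then have w: "monomial w \<in> F" by (simp add: free_algebra_single)
  have "\<pi> (Poly_Mapping.single w c) = c \<odot>\<^bsub>A\<^esub> \<pi> (monomial w)"
    using image_ops(4)[OF w, of c] by simp
  then have "\<gamma> z (\<pi> (Poly_Mapping.single w c)) = c \<odot>\<^bsub>A\<^esub> (z powi word_degree w \<odot>\<^bsub>A\<^esub> \<pi> (monomial w))"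
    using star_homD(5)[OF gauge_hom[OF z] image_closed[OF w]] gauge_word[OF z, of w] single by simp
  also have "\<dots> = \<pi> (rotate_poly z (Poly_Mapping.single w c))"
    unfolding rotate_single using image_ops(4)[OF w] image_closed[OF w]
    by (simp add: A.smult_smult mult.commute del: pscale_single)
  finally show ?case .
next
  case (add x y)
  then show ?case
    using star_homD(2)[OF gauge_hom[OF z] image_closed image_closed] by (simp add: image_ops(1) rotate_add)
qed

lemma gauge_component_D:
  assumes "a \<in> G n" shows "a \<in> carrier A" "\<And>z. cmod z = 1 \<Longrightarrow> \<gamma> z a = z powi n \<odot>\<^bsub>A\<^esub> a"
  using assms by (auto simp: gauge_component_def)

lemma gauge_component_I:
  "a \<in> carrier A \<Longrightarrow> (\<And>z. cmod z = 1 \<Longrightarrow> \<gamma> z a = z powi n \<odot>\<^bsub>A\<^esub> a) \<Longrightarrow> a \<in> G n"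
  by (simp add: gauge_component_def)

lemma image_homogeneous: "x \<in> homogeneous E n \<Longrightarrow> \<pi> x \<in> G n"
  using homogeneous_free[of x E n]
  by (auto intro!: gauge_component_I image_closed simp: gauge_image rotate_homogeneous image_ops(4))

text \<open>
  One unwanted degree \<open>d\<close> is removed at a time, by averaging
  an approximation \<open>x\<close> of \<open>a\<close> with \<open>z\<^sup>-\<^sup>n \<gamma>\<^sub>z(x)\<close>, where \<open>z\<^sup>d\<^sup>-\<^sup>n = -1\<close>. The average is as close to
  \<open>a\<close> as \<open>x\<close> is, because \<open>a\<close> is fixed by this averaging and \<open>\<gamma>\<^sub>z\<close> is norm-decreasing.
\<close>
lemma homogeneous_dense:
  assumes a: "a \<in> G n" and \<epsilon>: "0 < \<epsilon>"
  shows "\<exists>x\<in>homogeneous E n. nrm A (a \<ominus>\<^bsub>A\<^esub> \<pi> x) < \<epsilon>"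
proof -
  note aC = gauge_component_D(1)[OF a]
  have "\<exists>y\<in>homogeneous E n. nrm A (a \<ominus>\<^bsub>A\<^esub> \<pi> y) < \<epsilon>"
    if "finite D" "x \<in> F" "word_degree ` Poly_Mapping.keys x \<subseteq> insert n D" "nrm A (a \<ominus>\<^bsub>A\<^esub> \<pi> x) < \<epsilon>" for D x
    using that
  proof (induction D arbitrary: x rule: finite_induct)
    case empty
    then have "x \<in> homogeneous E n" by (auto simp: homogeneous_def)
    then show ?case using empty by blast
  next
    case (insert d D)
    show ?case
    proof (cases "d = n")
      case True
      then show ?thesis using insert by auto
    next
      case False
      \<comment> \<open>The average \<open>x'\<close> below multiplies the degree \<open>k\<close> part of \<open>x\<close> by \<open>(1 + z\<^sup>k\<^sup>-\<^sup>n) / 2\<close>, which is \<open>1\<close> for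
        \<open>k = n\<close> and \<open>0\<close> for \<open>k = d\<close>.\<close>
      define z where "z = cis (pi / of_int (d - n))"
      have z: "cmod z = 1" "z \<noteq> 0" by (simp_all add: z_def)
      have zz: "z powi (d - n) = -1" using False by (simp add: z_def cis_power_int)
      define y where "y = pscale (z powi (- n)) (rotate_poly z x)"
      define x' where "x' = pscale (1 / 2) (x + y)"
      have yF: "y \<in> F" and xF: "x' \<in> F" using insert.prems(1) by (simp_all add: y_def x'_def)
      have lk: "Poly_Mapping.lookup x' w = (1 + z powi (word_degree w - n)) / 2 * Poly_Mapping.lookup x w" for w
        using z(2) by (simp add: x'_def y_def lookup_pscale lookup_add lookup_rotate power_int_diff power_int_minus
            field_simps)
      have "word_degree w \<in> insert n D" if "w \<in> Poly_Mapping.keys x'" for w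
      proof -
        have "w \<in> Poly_Mapping.keys x" "word_degree w \<noteq> d"
          using that zz by (auto simp: in_keys_iff lk)
        moreover from this(1) have "word_degree w \<in> insert n (insert d D)" using insert.prems(2) by blast
        ultimately show ?thesis by blast
      qed
      then have deg: "word_degree ` Poly_Mapping.keys x' \<subseteq> insert n D" by blast
      let ?b = "a \<ominus>\<^bsub>A\<^esub> \<pi> x"
      note xC = image_closed[OF insert.prems(1)] and yC = image_closed[OF yF]
      have bC: "?b \<in> carrier A" using aC xC by simp
      have "z powi (- n) \<odot>\<^bsub>A\<^esub> \<gamma> z ?b = z powi (- n) \<odot>\<^bsub>A\<^esub> (z powi n \<odot>\<^bsub>A\<^esub> a) \<ominus>\<^bsub>A\<^esub> \<pi> y"
        using gauge_minus[OF z(1) aC xC] gauge_component_D(2)[OF a z(1)] gauge_image[OF z(1) insert.prems(1)]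
          aC insert.prems(1)
        by (simp add: y_def image_ops(4) A.minus_smult A.smult_closed image_closed)
      also have "z powi (- n) \<odot>\<^bsub>A\<^esub> (z powi n \<odot>\<^bsub>A\<^esub> a) = a"
        using z(2) aC by (simp add: A.smult_smult A.smult_one power_int_minus)
      finally have zb: "z powi (- n) \<odot>\<^bsub>A\<^esub> \<gamma> z ?b = a \<ominus>\<^bsub>A\<^esub> \<pi> y" .
      have half: "(1 / 2) \<odot>\<^bsub>A\<^esub> (a \<oplus>\<^bsub>A\<^esub> a) = a"
        using A.smult_distr_left[OF aC, of "1 / 2" "1 / 2"] aC by (simp add: A.smult_distr_right A.smult_one)
      have "a \<ominus>\<^bsub>A\<^esub> \<pi> x' = (1 / 2) \<odot>\<^bsub>A\<^esub> (a \<oplus>\<^bsub>A\<^esub> a) \<ominus>\<^bsub>A\<^esub> (1 / 2) \<odot>\<^bsub>A\<^esub> (\<pi> x \<oplus>\<^bsub>A\<^esub> \<pi> y)"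
        using insert.prems(1) yF by (simp add: half x'_def image_ops)
      also have "\<dots> = (1 / 2) \<odot>\<^bsub>A\<^esub> (?b \<oplus>\<^bsub>A\<^esub> (a \<ominus>\<^bsub>A\<^esub> \<pi> y))"
        using aC xC yC by (simp add: A.minus_smult A.minus_add_minus)
      finally have "nrm A (a \<ominus>\<^bsub>A\<^esub> \<pi> x') = 1 / 2 * nrm A (?b \<oplus>\<^bsub>A\<^esub> z powi (- n) \<odot>\<^bsub>A\<^esub> \<gamma> z ?b)"
        using bC aC yC by (simp add: A.nrm_smult zb)
      also have "\<dots> \<le> 1 / 2 * (nrm A ?b + nrm A (z powi (- n) \<odot>\<^bsub>A\<^esub> \<gamma> z ?b))"
        using bC star_homD(1)[OF gauge_hom[OF z(1)] bC] by (intro mult_left_mono A.nrm_triangle) (auto intro: A.smult_closed)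
      also have "nrm A (z powi (- n) \<odot>\<^bsub>A\<^esub> \<gamma> z ?b) \<le> nrm A ?b"
        using star_homD(1,6)[OF gauge_hom[OF z(1)] bC] z(1) by (simp add: A.nrm_smult norm_power_int)
      finally have "nrm A (a \<ominus>\<^bsub>A\<^esub> \<pi> x') < \<epsilon>" using insert.prems(3) by simp
      then show ?thesis using insert.IH[OF xF deg] by blast
    qed
  qed
  moreover obtain x where "x \<in> F" "nrm A (a \<ominus>\<^bsub>A\<^esub> \<pi> x) < \<epsilon>" using image_dense[OF aC \<epsilon>] by blast
  ultimately show ?thesis by (meson finite_imageI finite_keys subset_insertI)
qed

lemma gauge_component_subset: "G n \<subseteq> carrier A"
  using gauge_component_D(1) by blast

lemma gauge_component_zero: "\<zero>\<^bsub>A\<^esub> \<in> G n"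
  by (rule gauge_component_I) (simp_all add: gauge_zero A.smult_zero)

lemma gauge_component_add: "a \<in> G n \<Longrightarrow> b \<in> G n \<Longrightarrow> a \<oplus>\<^bsub>A\<^esub> b \<in> G n"
  by (rule gauge_component_I) (simp_all add: gauge_component_D A.smult_distr_right star_homD(2)[OF gauge_hom])

lemma gauge_component_scale: "a \<in> G n \<Longrightarrow> c \<odot>\<^bsub>A\<^esub> a \<in> G n"
  by (rule gauge_component_I)
    (simp_all add: gauge_component_D A.smult_closed A.smult_smult mult.commute star_homD(5)[OF gauge_hom])

lemma gauge_component_mult: "a \<in> G m \<Longrightarrow> b \<in> G n \<Longrightarrow> a \<otimes>\<^bsub>A\<^esub> b \<in> G (m + n)"
proof (rule gauge_component_I)
  fix z :: complex
  assume a: "a \<in> G m" and b: "b \<in> G n" and z: "cmod z = 1"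
  have z0: "z \<noteq> 0" using z by auto
  have "\<gamma> z (a \<otimes>\<^bsub>A\<^esub> b) = (z powi m \<odot>\<^bsub>A\<^esub> a) \<otimes>\<^bsub>A\<^esub> (z powi n \<odot>\<^bsub>A\<^esub> b)"
    using a b z by (simp add: gauge_component_D star_homD(3)[OF gauge_hom])
  also have "\<dots> = (z powi m * z powi n) \<odot>\<^bsub>A\<^esub> (a \<otimes>\<^bsub>A\<^esub> b)"
    using gauge_component_D(1)[OF a] gauge_component_D(1)[OF b]
    by (simp add: A.smult_mult_left A.smult_mult_right A.smult_smult A.smult_closed A.mult_closed mult.commute)
  finally show "\<gamma> z (a \<otimes>\<^bsub>A\<^esub> b) = z powi (m + n) \<odot>\<^bsub>A\<^esub> (a \<otimes>\<^bsub>A\<^esub> b)"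
    using z0 by (simp add: power_int_add)
qed (simp add: gauge_component_D A.mult_closed)

lemma gauge_component_adj: "a \<in> G n \<Longrightarrow> adj A a \<in> G (- n)"
proof (rule gauge_component_I)
  fix z :: complex
  assume a: "a \<in> G n" and z: "cmod z = 1"
  have z0: "z \<noteq> 0" using z by auto
  have "cnj z = inverse z"
    using z z0 by (simp add: field_simps flip: complex_norm_square)
  then have c: "cnj z powi n = z powi (- n)"
    by (simp add: power_int_def power_inverse)
  show "\<gamma> z (adj A a) = z powi (- n) \<odot>\<^bsub>A\<^esub> adj A a"
    using gauge_component_D(1)[OF a] gauge_component_D(2)[OF a z] star_homD(4)[OF gauge_hom[OF z]]
    by (simp add: A.adj_smult c)
qed (simp add: gauge_component_D A.adj_closed)

lemma gauge_component_closedin: "closedin (norm_topology A) (G n)"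
proof -
  interpret M: Metric_space "carrier A" "norm_dist A" by (rule A.metric)
  have "a \<in> G n" if a: "a \<in> M.mtopology closure_of G n" for a
  proof (rule gauge_component_I)
    show aC: "a \<in> carrier A" using a by (simp add: A.closure_of_iff)
    fix z :: complex assume z: "cmod z = 1"
    note ga = star_homD(1)[OF gauge_hom[OF z]]
    let ?c = "z powi n"
    have c1: "cmod ?c = 1" using z by (simp add: norm_power_int)
    have zC: "?c \<odot>\<^bsub>A\<^esub> a \<in> carrier A" using aC by (rule A.smult_closed)
    have "nrm A (\<gamma> z a \<ominus>\<^bsub>A\<^esub> ?c \<odot>\<^bsub>A\<^esub> a) \<le> 0 + \<epsilon>" if \<epsilon>: "0 < \<epsilon>" for \<epsilon>
    proof -
      obtain b where b: "b \<in> G n" "nrm A (a \<ominus>\<^bsub>A\<^esub> b) < \<epsilon> / 2"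
        using a \<epsilon> unfolding A.closure_of_iff by (meson half_gt_zero)
      note bC = gauge_component_D(1)[OF b(1)]
      have "nrm A (\<gamma> z a \<ominus>\<^bsub>A\<^esub> ?c \<odot>\<^bsub>A\<^esub> a) \<le> nrm A (\<gamma> z a \<ominus>\<^bsub>A\<^esub> \<gamma> z b) + nrm A (\<gamma> z b \<ominus>\<^bsub>A\<^esub> ?c \<odot>\<^bsub>A\<^esub> a)"
        by (rule A.nrm_minus_triangle[OF ga[OF aC] ga[OF bC] zC])
      also have "nrm A (\<gamma> z a \<ominus>\<^bsub>A\<^esub> \<gamma> z b) \<le> nrm A (a \<ominus>\<^bsub>A\<^esub> b)"
        using star_homD(6)[OF gauge_hom[OF z], of "a \<ominus>\<^bsub>A\<^esub> b"] gauge_minus[OF z aC bC] aC bC by simp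
      also have "nrm A (\<gamma> z b \<ominus>\<^bsub>A\<^esub> ?c \<odot>\<^bsub>A\<^esub> a) = nrm A (a \<ominus>\<^bsub>A\<^esub> b)"
        using gauge_component_D(2)[OF b(1) z] aC bC c1 by (simp add: A.minus_smult A.nrm_smult A.nrm_minus_commute)
      finally show ?thesis using b(2) by simp
    qed
    then have "nrm A (\<gamma> z a \<ominus>\<^bsub>A\<^esub> ?c \<odot>\<^bsub>A\<^esub> a) \<le> 0" by (rule field_le_epsilon)
    then have "nrm A (\<gamma> z a \<ominus>\<^bsub>A\<^esub> ?c \<odot>\<^bsub>A\<^esub> a) = 0"
      using A.nrm_nonneg[of "\<gamma> z a \<ominus>\<^bsub>A\<^esub> ?c \<odot>\<^bsub>A\<^esub> a"] ga[OF aC] zC by simp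
    then show "\<gamma> z a = ?c \<odot>\<^bsub>A\<^esub> a" using A.nrm_minus_eq_0 ga[OF aC] zC by blast
  qed
  then show ?thesis
    using closure_of_subset_eq[of "G n" M.mtopology] gauge_component_subset by auto
qed

text \<open>
  The map \<open>\<gamma>\<^sub>z - z\<^sup>m\<close> annihilates degree \<open>m\<close>. With \<open>z\<^sup>n\<^sup>-\<^sup>m = -1\<close> it multiplies degree \<open>n\<close> by a
  nonzero scalar, so that a summand can be eliminated without losing the term of degree \<open>n\<close>.
\<close>
lemma gauge_components_independent:
  assumes "finite I" "\<forall>n\<in>I. f n \<in> G n" "(\<Oplus>\<^bsub>A\<^esub>n\<in>I. f n) = \<zero>\<^bsub>A\<^esub>"
  shows "\<forall>n\<in>I. f n = \<zero>\<^bsub>A\<^esub>"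
  using assms
proof (induction I arbitrary: f rule: finite_induct)
  case (insert m I)
  have fC: "f n \<in> carrier A" if "n \<in> insert m I" for n using insert.prems(1) that gauge_component_D(1) by blast
  have zero: "f n = \<zero>\<^bsub>A\<^esub>" if n: "n \<in> I" for n
  proof -
    have nm: "n \<noteq> m" using n insert.hyps by auto
    define z where "z = cis (pi / of_int (n - m))"
    have z: "cmod z = 1" "z \<noteq> 0" by (simp_all add: z_def)
    have "z powi (n - m) = -1" using nm by (simp add: z_def cis_power_int)
    then have zn: "z powi n = - (z powi m)" using z(2) by (simp add: power_int_diff divide_eq_eq)
    define h where "h a = \<gamma> z a \<ominus>\<^bsub>A\<^esub> z powi m \<odot>\<^bsub>A\<^esub> a" for a
    note ga = star_homD(1)[OF gauge_hom[OF z(1)]]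
    have hC: "h \<in> carrier A \<rightarrow> carrier A" using ga A.smult_closed by (auto simp: h_def)
    have h0: "h \<zero>\<^bsub>A\<^esub> = \<zero>\<^bsub>A\<^esub>" by (simp add: h_def gauge_zero[OF z(1)] A.smult_zero A.minus_eq)
    have hadd: "h (a \<oplus>\<^bsub>A\<^esub> b) = h a \<oplus>\<^bsub>A\<^esub> h b" if "a \<in> carrier A" "b \<in> carrier A" for a b
      using that star_homD(2)[OF gauge_hom[OF z(1)] that] ga A.smult_closed
      by (simp add: h_def A.smult_distr_right A.minus_add_minus)
    have hf: "h (f k) = (z powi k - z powi m) \<odot>\<^bsub>A\<^esub> f k" if k: "k \<in> insert m I" for k
    proof -
      have "f k \<in> G k" using insert.prems(1) k by blast
      then have "h (f k) = z powi k \<odot>\<^bsub>A\<^esub> f k \<oplus>\<^bsub>A\<^esub> (- (z powi m)) \<odot>\<^bsub>A\<^esub> f k"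
        using gauge_component_D(2)[OF _ z(1)] fC[OF k] by (simp add: h_def A.minus_conv A.smult_closed A.smult_smult)
      then show ?thesis using A.smult_distr_left[OF fC[OF k], of "z powi k" "- (z powi m)"] by simp
    qed
    have "h (\<Oplus>\<^bsub>A\<^esub>k\<in>insert m I. f k) = (\<Oplus>\<^bsub>A\<^esub>k\<in>insert m I. h (f k))"
      by (rule A.finsum_additive) (use insert.hyps fC hC h0 hadd in auto)
    also have "\<dots> = h (f m) \<oplus>\<^bsub>A\<^esub> (\<Oplus>\<^bsub>A\<^esub>k\<in>I. h (f k))"
      using insert.hyps fC hC by (subst A.finsum_insert) auto
    also have "h (f m) = \<zero>\<^bsub>A\<^esub>" using hf[of m] fC[of m] by (simp add: A.smult_zero_left)
    also have "(\<Oplus>\<^bsub>A\<^esub>k\<in>I. h (f k)) = (\<Oplus>\<^bsub>A\<^esub>k\<in>I. (z powi k - z powi m) \<odot>\<^bsub>A\<^esub> f k)"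
      using hf fC A.smult_closed by (intro A.finsum_cong') auto
    finally have "(\<Oplus>\<^bsub>A\<^esub>k\<in>I. (z powi k - z powi m) \<odot>\<^bsub>A\<^esub> f k) = \<zero>\<^bsub>A\<^esub>"
      using insert.prems(2) h0 fC A.smult_closed by simp
    then have "(z powi n - z powi m) \<odot>\<^bsub>A\<^esub> f n = \<zero>\<^bsub>A\<^esub>"
      using insert.IH[of "\<lambda>k. (z powi k - z powi m) \<odot>\<^bsub>A\<^esub> f k"] insert.prems(1) n gauge_component_scale by blast
    then have "cmod (z powi n - z powi m) * nrm A (f n) = 0"
      using A.nrm_smult[OF fC, of n "z powi n - z powi m"] n A.nrm_zero by simp
    then have "nrm A (f n) = 0" using z by (simp add: zn norm_power_int flip: mult_2)
    then show ?thesis using A.nrm_eq_0_iff fC n by blast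
  qed
  have "(\<Oplus>\<^bsub>A\<^esub>n\<in>I. f n) = \<zero>\<^bsub>A\<^esub>"
    using zero by (simp cong: A.finsum_cong)
  then have "f m = \<zero>\<^bsub>A\<^esub>"
    using insert.prems(2) insert.hyps fC by (simp add: A.finsum_insert)
  then show ?case using zero by blast
qed simp

lemma span_product_hull:
  "span_product A (G m) (G n) = additive_hull A {c \<odot>\<^bsub>A\<^esub> (a \<otimes>\<^bsub>A\<^esub> b) | c a b. a \<in> G m \<and> b \<in> G n}"
proof -
  have "{a \<otimes>\<^bsub>A\<^esub> b | a b. a \<in> G m \<and> b \<in> G n} \<subseteq> carrier A"
    using gauge_component_D(1) A.mult_closed by blast
  moreover have "{c \<odot>\<^bsub>A\<^esub> x | c x. x \<in> {a \<otimes>\<^bsub>A\<^esub> b | a b. a \<in> G m \<and> b \<in> G n}} =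
      {c \<odot>\<^bsub>A\<^esub> (a \<otimes>\<^bsub>A\<^esub> b) | c a b. a \<in> G m \<and> b \<in> G n}" by blast
  ultimately show ?thesis
    unfolding span_product_def by (simp only: cspan_eq_hull[OF A.complex_algebra_axioms])
qed

lemma span_product_component: "span_product A (G m) (G n) \<subseteq> G (m + n)"
proof
  fix x assume "x \<in> span_product A (G m) (G n)"
  then show "x \<in> G (m + n)" unfolding span_product_hull
    by induction (auto intro: gauge_component_zero gauge_component_add gauge_component_scale gauge_component_mult)
qed

theorem graded_graph_cstar: "graded_cstar_algebra A G"
proof -
  let ?D = "{(\<Oplus>\<^bsub>A\<^esub>n\<in>I. f n) | I f. finite I \<and> (\<forall>n\<in>I. f n \<in> G n)}"
  have subspace: "complex_subspace (G n) A" for n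
    unfolding complex_subspace_def
  proof (intro conjI allI ballI additive_subgroup_from_closure)
    show "\<ominus>\<^bsub>A\<^esub> x \<in> G n" if "x \<in> G n" for x
      using gauge_component_scale[OF that, of "-1"] gauge_component_D(1)[OF that] by (simp add: A.smult_minus_one)
  qed (use A.abelian_group_axioms gauge_component_subset gauge_component_zero gauge_component_add gauge_component_scale in auto)
  have image: "\<pi> x \<in> ?D" if x: "x \<in> F" for x
  proof -
    let ?I = "word_degree ` Poly_Mapping.keys x"
    have CF: "component n x \<in> F" for n using component_homogeneous[OF x] by (rule homogeneous_free)
    have "(\<Oplus>\<^bsub>A\<^esub>n\<in>I. \<pi> (component n x)) = \<pi> (\<Sum>n\<in>I. component n x)" if "finite I" for I
      using that
    proof (induction I rule: finite_induct)
      case (insert i I)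
      then show ?case using CF by (subst A.finsum_insert) (auto simp: image_closed image_ops(1) free_algebra_sum)
    qed (simp add: image_ops(6))
    from this[of ?I] have "\<pi> x = (\<Oplus>\<^bsub>A\<^esub>n\<in>?I. \<pi> (component n x))"
      using sum_components[of ?I x] by simp
    then show ?thesis
      using image_homogeneous[OF component_homogeneous[OF x]] finite_imageI[OF finite_keys]
      by (intro CollectI exI[of _ ?I] exI[of _ "\<lambda>n. \<pi> (component n x)"]) simp
  qed
  have "norm_topology A closure_of ?D = carrier A"
  proof (intro equalityI subsetI)
    fix a assume a: "a \<in> carrier A"
    have "\<exists>b\<in>?D. b \<in> carrier A \<and> nrm A (a \<ominus>\<^bsub>A\<^esub> b) < \<epsilon>" if \<epsilon>: "0 < \<epsilon>" for \<epsilon>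
    proof -
      obtain x where x: "x \<in> F" "nrm A (a \<ominus>\<^bsub>A\<^esub> \<pi> x) < \<epsilon>" using image_dense[OF a \<epsilon>] by blast
      show ?thesis by (rule bexI[of _ "\<pi> x"], rule conjI, rule image_closed[OF x(1)], rule x(2), rule image[OF x(1)])
    qed
    then show "a \<in> norm_topology A closure_of ?D" using a unfolding A.closure_of_iff by (intro conjI allI impI)
  qed (simp add: A.closure_of_iff)
  moreover have "adj A ` G n \<subseteq> G (- n)" for n using gauge_component_adj by blast
  moreover have "\<forall>I f. finite I \<and> (\<forall>n\<in>I. f n \<in> G n) \<and> (\<Oplus>\<^bsub>A\<^esub>n\<in>I. f n) = \<zero>\<^bsub>A\<^esub> \<longrightarrow>
      (\<forall>n\<in>I. f n = \<zero>\<^bsub>A\<^esub>)"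
    by (intro allI impI, elim conjE) (rule gauge_components_independent)
  ultimately show ?thesis
    unfolding graded_cstar_algebra_def
    using A.cstar_algebra_axioms subspace gauge_component_closedin span_product_component
    by (intro conjI allI) simp_all
qed

lemma image_products:
  assumes "p \<in> products E m n" shows "\<pi> p \<in> span_product A (G m) (G n)"
  using assms
proof induction
  case products_0
  then show ?case unfolding span_product_hull image_ops(6) by (rule hull_zero)
next
  case (products_step x y p)
  note h = products_step(1,2)[THEN homogeneous_free] and g = products_step(1,2)[THEN image_homogeneous]
  have "\<pi> (x * y + p) = (1 \<odot>\<^bsub>A\<^esub> (\<pi> x \<otimes>\<^bsub>A\<^esub> \<pi> y)) \<oplus>\<^bsub>A\<^esub> \<pi> p"
    using h products_free[OF products_step(3)] by (simp add: image_ops A.smult_one A.mult_closed image_closed)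
  then show ?case using products_step(4) g unfolding span_product_hull by (auto intro!: hull_add)
qed

lemma product_dense:
  assumes a: "a \<in> G m" and b: "b \<in> G n" and \<epsilon>: "0 < \<epsilon>"
  shows "\<exists>x\<in>homogeneous E m. \<exists>y\<in>homogeneous E n. nrm A (a \<otimes>\<^bsub>A\<^esub> b \<ominus>\<^bsub>A\<^esub> \<pi> (x * y)) < \<epsilon>"
proof -
  note aC = gauge_component_D(1)[OF a] and bC = gauge_component_D(1)[OF b]
  have pos: "0 < nrm A a + 1" using A.nrm_nonneg[OF aC] by simp
  obtain y where y: "y \<in> homogeneous E n" "nrm A (b \<ominus>\<^bsub>A\<^esub> \<pi> y) < \<epsilon> / 2 / (nrm A a + 1)"
    using homogeneous_dense[OF b, of "\<epsilon> / 2 / (nrm A a + 1)"] \<epsilon> pos by auto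
  note yC = image_closed[OF homogeneous_free[OF y(1)]]
  have pos': "0 < nrm A (\<pi> y) + 1" using A.nrm_nonneg[OF yC] by simp
  obtain x where x: "x \<in> homogeneous E m" "nrm A (a \<ominus>\<^bsub>A\<^esub> \<pi> x) < \<epsilon> / 2 / (nrm A (\<pi> y) + 1)"
    using homogeneous_dense[OF a, of "\<epsilon> / 2 / (nrm A (\<pi> y) + 1)"] \<epsilon> pos' by auto
  note xC = image_closed[OF homogeneous_free[OF x(1)]]
  have "nrm A (a \<otimes>\<^bsub>A\<^esub> b \<ominus>\<^bsub>A\<^esub> \<pi> x \<otimes>\<^bsub>A\<^esub> \<pi> y)
      \<le> nrm A a * nrm A (b \<ominus>\<^bsub>A\<^esub> \<pi> y) + nrm A (a \<ominus>\<^bsub>A\<^esub> \<pi> x) * nrm A (\<pi> y)"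
    by (rule A.minus_mult_estimate[OF aC bC xC yC])
  also have "nrm A a * nrm A (b \<ominus>\<^bsub>A\<^esub> \<pi> y) \<le> (nrm A a + 1) * nrm A (b \<ominus>\<^bsub>A\<^esub> \<pi> y)"
    using bC yC A.nrm_nonneg by (intro mult_right_mono) auto
  also have "\<dots> < \<epsilon> / 2" using y(2) pos by (simp add: field_simps)
  also have "nrm A (a \<ominus>\<^bsub>A\<^esub> \<pi> x) * nrm A (\<pi> y) \<le> nrm A (a \<ominus>\<^bsub>A\<^esub> \<pi> x) * (nrm A (\<pi> y) + 1)"
    using aC xC A.nrm_nonneg by (intro mult_left_mono) auto
  also have "\<dots> < \<epsilon> / 2" using x(2) pos' by (simp add: field_simps)
  finally have "nrm A (a \<otimes>\<^bsub>A\<^esub> b \<ominus>\<^bsub>A\<^esub> \<pi> (x * y)) < \<epsilon>"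
    using image_ops(2)[OF homogeneous_free[OF x(1)] homogeneous_free[OF y(1)]] by simp
  then show ?thesis using x(1) y(1) by blast
qed

lemma span_product_dense:
  assumes "a \<in> span_product A (G m) (G n)" "0 < \<epsilon>"
  shows "\<exists>p\<in>products E m n. nrm A (a \<ominus>\<^bsub>A\<^esub> \<pi> p) < \<epsilon>"
  using assms unfolding span_product_hull
proof (induction arbitrary: \<epsilon>)
  case hull_zero
  then show ?case
    using A.nrm_minus_eq_0[of "\<zero>\<^bsub>A\<^esub>" "\<zero>\<^bsub>A\<^esub>"] by (intro bexI[OF _ products_0]) (simp add: image_ops(6))
next
  case (hull_add s a)
  then obtain c b d where s: "s = c \<odot>\<^bsub>A\<^esub> (b \<otimes>\<^bsub>A\<^esub> d)" and bd: "b \<in> G m" "d \<in> G n" by blast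
  obtain p where p: "p \<in> products E m n" "nrm A (a \<ominus>\<^bsub>A\<^esub> \<pi> p) < \<epsilon> / 2"
    using hull_add.IH[of "\<epsilon> / 2"] hull_add.prems by auto
  \<comment> \<open>The summand \<open>1\<close> allows for \<open>c = 0\<close>.\<close>
  have c: "0 < cmod c + 1" by (simp add: add_nonneg_pos)
  obtain x y where xy: "x \<in> homogeneous E m" "y \<in> homogeneous E n"
    "nrm A (b \<otimes>\<^bsub>A\<^esub> d \<ominus>\<^bsub>A\<^esub> \<pi> (x * y)) < \<epsilon> / 2 / (cmod c + 1)"
    using product_dense[OF bd, of "\<epsilon> / 2 / (cmod c + 1)"] hull_add.prems c by auto
  let ?q = "pscale c x * y"
  have q: "?q + p \<in> products E m n" by (rule products_step[OF homogeneous_scale[OF xy(1)] xy(2) p(1)])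
  have F: "x * y \<in> F" "p \<in> F"
    using homogeneous_free[OF xy(1)] homogeneous_free[OF xy(2)] products_free[OF p(1)] by auto
  have bdC: "b \<otimes>\<^bsub>A\<^esub> d \<in> carrier A" using bd gauge_component_D(1) A.mult_closed by blast
  have aC: "a \<in> carrier A"
    using hull_add.hyps(2) span_product_component[of m n] gauge_component_subset unfolding span_product_hull by blast
  note C = image_closed[OF F(1)] image_closed[OF F(2)]
  have \<pi>q: "\<pi> (?q + p) = c \<odot>\<^bsub>A\<^esub> \<pi> (x * y) \<oplus>\<^bsub>A\<^esub> \<pi> p"
    using F by (simp add: pscale_mult_left image_ops(1,4))
  have "s \<oplus>\<^bsub>A\<^esub> a \<ominus>\<^bsub>A\<^esub> \<pi> (?q + p) = c \<odot>\<^bsub>A\<^esub> (b \<otimes>\<^bsub>A\<^esub> d \<ominus>\<^bsub>A\<^esub> \<pi> (x * y)) \<oplus>\<^bsub>A\<^esub> (a \<ominus>\<^bsub>A\<^esub> \<pi> p)"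
    unfolding \<pi>q s using bdC aC C by (simp add: A.minus_add_minus A.minus_smult A.smult_closed)
  then have "nrm A (s \<oplus>\<^bsub>A\<^esub> a \<ominus>\<^bsub>A\<^esub> \<pi> (?q + p))
      \<le> cmod c * nrm A (b \<otimes>\<^bsub>A\<^esub> d \<ominus>\<^bsub>A\<^esub> \<pi> (x * y)) + nrm A (a \<ominus>\<^bsub>A\<^esub> \<pi> p)"
    using A.nrm_triangle[of "c \<odot>\<^bsub>A\<^esub> (b \<otimes>\<^bsub>A\<^esub> d \<ominus>\<^bsub>A\<^esub> \<pi> (x * y))" "a \<ominus>\<^bsub>A\<^esub> \<pi> p"] bdC aC C
    by (simp add: A.nrm_smult A.smult_closed)
  also have "cmod c * nrm A (b \<otimes>\<^bsub>A\<^esub> d \<ominus>\<^bsub>A\<^esub> \<pi> (x * y)) \<le> (cmod c + 1) * nrm A (b \<otimes>\<^bsub>A\<^esub> d \<ominus>\<^bsub>A\<^esub> \<pi> (x * y))"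
    using bdC C A.nrm_nonneg by (intro mult_right_mono) auto
  also have "\<dots> < \<epsilon> / 2" using xy(3) c by (simp add: field_simps)
  finally have "nrm A (s \<oplus>\<^bsub>A\<^esub> a \<ominus>\<^bsub>A\<^esub> \<pi> (?q + p)) < \<epsilon>" using p(2) by simp
  then show ?case using q by blast
qed

text \<open>
  Polynomials of degree \<open>m + n\<close> are dense in the component of that degree, and modulo the Leavitt
  relations, which hold in \<open>C*(E)\<close>, each of them is a sum of products.
\<close>
lemma strongly_graded_cstar_from_leavitt:
  assumes "strongly_graded_ring (leavitt_path_algebra E) (leavitt_component E)"
  shows "strongly_graded_cstar_algebra A G"
proof -
  have sub: "homogeneous E (m + n) \<subseteq> factorable E m n" for m n
    using assms strongly_graded_leavitt_iff[OF wf] by blast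
  have "a \<in> norm_topology A closure_of span_product A (G m) (G n)" if a: "a \<in> G (m + n)" for a m n
    unfolding A.closure_of_iff
  proof (intro conjI allI impI gauge_component_D(1)[OF a])
    fix \<epsilon> :: real assume "0 < \<epsilon>"
    then obtain x where x: "x \<in> homogeneous E (m + n)" "nrm A (a \<ominus>\<^bsub>A\<^esub> \<pi> x) < \<epsilon>"
      using homogeneous_dense[OF a] by blast
    then obtain p where p: "p \<in> products E m n" "leavitt_eq E x p"
      using sub unfolding factorable_def by blast
    have "\<pi> x \<in> span_product A (G m) (G n)"
      using image_products[OF p(1)] image_leavitt_eq[OF p(2)] by simp
    then show "\<exists>b\<in>span_product A (G m) (G n). b \<in> carrier A \<and> nrm A (a \<ominus>\<^bsub>A\<^esub> b) < \<epsilon>"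
      using x(2) image_closed[OF homogeneous_free[OF x(1)]] by blast
  qed
  then show ?thesis
    unfolding strongly_graded_cstar_algebra_def using graded_graph_cstar by blast
qed

text \<open>
  Any distance below \<open>1\<close> is small enough to contradict the unit gap found in the boundary path
  representation.
\<close>
lemma vertex_approximation:
  assumes strong: "strongly_graded_cstar_algebra A G" and v: "v \<in> verts E"
  shows "\<exists>p\<in>products E (- d) d. U (vtx v - p) < 1"
proof -
  have "\<pi> (vtx v) \<in> G (- d + d)" using image_homogeneous[OF homogeneous_gens(1)[OF v]] by simp
  then have cl: "\<pi> (vtx v) \<in> norm_topology A closure_of span_product A (G (- d)) (G d)"
    using strong unfolding strongly_graded_cstar_algebra_def by blast
  obtain b where b: "b \<in> span_product A (G (- d)) (G d)" "b \<in> carrier A" "nrm A (\<pi> (vtx v) \<ominus>\<^bsub>A\<^esub> b) < 1 / 2"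
    using cl unfolding A.closure_of_iff by (metis half_gt_zero zero_less_one)
  obtain p where p: "p \<in> products E (- d) d" "nrm A (b \<ominus>\<^bsub>A\<^esub> \<pi> p) < 1 / 2"
    using span_product_dense[OF b(1), of "1 / 2"] by auto
  note F = free_algebra_gens(1)[OF v] products_free[OF p(1)]
  have "U (vtx v - p) = nrm A (\<pi> (vtx v) \<ominus>\<^bsub>A\<^esub> \<pi> p)"
    using image_ops(3)[OF F] image_ops(7)[of "vtx v - p"] F by simp
  also have "\<dots> \<le> nrm A (\<pi> (vtx v) \<ominus>\<^bsub>A\<^esub> b) + nrm A (b \<ominus>\<^bsub>A\<^esub> \<pi> p)"
    by (rule A.nrm_minus_triangle[OF image_closed[OF F(1)] b(2) image_closed[OF F(2)]])
  also have "\<dots> < 1" using b(3) p(2) by simp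
  finally show ?thesis using p(1) by blast
qed

end

theorem proposition7:
  fixes E :: "('v, 'e) pre_digraph"
  assumes "wf_digraph E"
  shows "strongly_graded_cstar_algebra (graph_cstar E) (gauge_component E) \<longleftrightarrow>
         strongly_graded_ring (leavitt_path_algebra E) (leavitt_component E)"
proof
  assume "strongly_graded_cstar_algebra (graph_cstar E) (gauge_component E)"
  note approx = vertex_approximation[OF assms this]
  show "strongly_graded_ring (leavitt_path_algebra E) (leavitt_component E)"
    by (rule strongly_graded_leavitt_from_vertices[OF assms])
      (rule vertices_factorable[OF assms approx]; assumption)+
qed (rule strongly_graded_cstar_from_leavitt[OF assms])

end
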